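(* ($\Sigma$-compactness theorem.) Let $(X,\mathcal{H},\lambda)$ be a homogenizer with $X$ metrizable, $\Omega\subset X$ a nonempty open set (with the restriction of $\lambda$), $A$ a homogenization algebra on $(X,\mathcal{H},\lambda)$, and $1<p<+\infty$. Let $S$ be a fundamental sequence and $(u_\varepsilon)_{\varepsilon\in S}$ a bounded sequence in $L^p(\Omega)$. Then there is a subsequence $S'$ of $S$ such that $(u_\varepsilon)_{\varepsilon\in S'}$ weakly $\Sigma$-converges in $L^p(\Omega)$ to some $u_0\in L^p(\Omega\times\Delta(A))$.
   Context: An $\mathbb{R}$-group is an abelian group $E$ (operation written multiplicatively) whose underlying set is a subset of $\mathbb{R}$ containing all positive integers, such that: (RG1) with the natural order of $\mathbb{R}$, $E$ is a totally ordered group; (RG2) with the topology induced from $\mathbb{R}$, $E$ is a locally compact group; (RG3) there is a nonconstant continuous homomorphism $h:E\to\mathbb{R}_+^*$ such that for every $\alpha\in E$ the set $\{\varepsilon\in E:\varepsilon\ge\alpha\}$ is integrable for $h\cdot m$, $m$ a Haar measure on $E$. $e$ is the identity of $E$, $\varepsilon^{-1}$ the group inverse, $\theta=\inf E\in\mathbb{R}\cup\{\pm\infty\}$; inequalities refer to the order of $\mathbb{R}$. An action of $E$ on $X$ is a family $(H_\varepsilon)_{\varepsilon\in E}$ of bijections of $X$ with $H_\varepsilon\circ H_{\varepsilon'}=H_{\varepsilon\varepsilon'}$, $H_e=\mathrm{id}_X$; continuous if $(\varepsilon,x)\mapsto H_\varepsilon(x)$ is continuous on $E\times X$; absorptive if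 some $\omega\in X$ satisfies: for every neighbourhood $V$ of $\omega$ and every $x\in X$ there are a neighbourhood $U$ of $x$ and $\alpha\in E$ with $H_{\varepsilon^{-1}}(U)\subset V$ for all $\varepsilon\le\alpha$; this $\omega$ is unique, the center. A positive Radon measure $\lambda$ is $\mathcal{H}$-homogeneous if for each $\varepsilon$ there is $c(\varepsilon)>0$ with $\int\varphi(H_\varepsilon(x))d\lambda(x)=c(\varepsilon)\int\varphi\,d\lambda$ for all $\varphi\in\mathcal{K}(X)$; nontrivial if $\lambda\ne0$, $\lambda\ne\delta_\omega$. A homogenizer is a triple $(X,\mathcal{H},\lambda)$ with $X$ a noncompact locally compact space in which each point has a countable neighbourhood base, $\mathcal{H}$ a continuous absorptive action of an $\mathbb{R}$-group $E$ on $X$, $\lambda$ a nontrivial $\mathcal{H}$-homogeneous positive Radon measure; $X$ is equipped with $\lambda$. $\mathcal{B}(X)$ is the space of bounded continuous complex functions on $X$ with the sup norm. $\Pi^\infty(X,\mathcal{H},\lambda)$ is the space of $u\in\mathcal{B}(X)$ for which there is a constant $\tilde u$ with $u\circ H_\varepsilon\to\tilde u$ weak-$*$ in $L^\infty(X)$ as $\varepsilon\to\theta$; $M(u)=\tilde u$. A homogenization algebra on $(X,\mathcal{H},\lambda)$ is a closed subalgebra $A$ of $\mathcal{B}(X)$ which is separable for the sup norm, contains the constants, is closed under complex conjugation, and satisfies $A\subset\Pi^\infty(X,\mathcal{H},\lambda)$. $\Delta(A)$ is its spectrum (nonzero multiplicative linear forms, with the weak-$*$ topology; a compact metrizable space),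 $\mathcal{G}:A\to\mathcal{C}(\Delta(A))$, $\mathcal{G}(u)(s)=s(u)$, the Gelfand transformation, and $\beta$ the unique Radon (probability) measure on $\Delta(A)$ with $M(u)=\int_{\Delta(A)}\mathcal{G}(u)\,d\beta$ for all $u\in A$; $\Delta(A)$ carries $\beta$. For $\psi\in L^{p'}(\Omega;A)$ ($1/p'=1-1/p$), $\psi^\varepsilon(x)=\psi(x,H_\varepsilon(x))$, where $\psi(x,y)$ is the value at $y$ of $\psi(x)\in A$ (this lies in $L^{p'}(\Omega)$), and $\widehat\psi(x,s)=\mathcal{G}(\psi(x))(s)$. A fundamental sequence is a sequence $S=(\varepsilon_n)_{n\in\mathbb{N}}$ in $E$ with $\varepsilon_n\le e$ and $\varepsilon_n\to\theta$. A sequence $(u_\varepsilon)_{\varepsilon\in S}$ in $L^p(\Omega)$ weakly $\Sigma$-converges in $L^p(\Omega)$ to $u_0\in L^p(\Omega\times\Delta(A))$ if, as $S\ni\varepsilon\to\theta$, $\int_\Omega u_\varepsilon\psi^\varepsilon\,d\lambda\to\iint_{\Omega\times\Delta(A)}u_0(x,s)\widehat\psi(x,s)\,d\lambda(x)\,d\beta(s)$ for all $\psi\in L^{p'}(\Omega;A)$. *)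

theory Defs
  imports "HOL-Analysis.Analysis"
begin

definition radon_on :: "'a::topological_space set \<Rightarrow> 'a measure \<Rightarrow> bool" where
  "radon_on S M \<longleftrightarrow>
     sets M = sets (restrict_space borel S) \<and>
     (\<forall>K. compact K \<and> K \<subseteq> S \<longrightarrow> emeasure M K < \<infinity>) \<and>
     (\<forall>B \<in> sets M. emeasure M B = (INF U \<in> {U. openin (top_of_set S) U \<and> B \<subseteq> U}. emeasure M U)) \<and>
     (\<forall>U. openin (top_of_set S) U \<longrightarrow> emeasure M U = (SUP K \<in> {K. compact K \<and> K \<subseteq> U}. emeasure M K))"

definition haar_measure :: "real set \<Rightarrow> (real \<Rightarrow> real \<Rightarrow> real) \<Rightarrow> real measure \<Rightarrow> bool" where
  "haar_measure E mul m \<longleftrightarrow>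
     radon_on E m \<and> emeasure m E \<noteq> 0 \<and>
     (\<forall>a \<in> E. \<forall>B \<in> sets m. emeasure m ((\<lambda>x. mul a x) ` B) = emeasure m B)"

definition R_group :: "real set \<Rightarrow> (real \<Rightarrow> real \<Rightarrow> real) \<Rightarrow> real \<Rightarrow> (real \<Rightarrow> real) \<Rightarrow> bool" where
  "R_group E mul one ginv \<longleftrightarrow>
     (\<forall>n::nat. n \<ge> 1 \<longrightarrow> real n \<in> E) \<and>
     \<comment> \<open>abelian group\<close>
     (\<forall>a\<in>E. \<forall>b\<in>E. mul a b \<in> E) \<and>
     (\<forall>a\<in>E. \<forall>b\<in>E. \<forall>c\<in>E. mul (mul a b) c = mul a (mul b c)) \<and>
     (\<forall>a\<in>E. \<forall>b\<in>E. mul a b = mul b a) \<and>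
     one \<in> E \<and> (\<forall>a\<in>E. mul one a = a) \<and>
     (\<forall>a\<in>E. ginv a \<in> E \<and> mul (ginv a) a = one) \<and>
     \<comment> \<open>(RG1) totally ordered group for the order of the reals\<close>
     (\<forall>a\<in>E. \<forall>b\<in>E. \<forall>c\<in>E. a \<le> b \<longrightarrow> mul a c \<le> mul b c) \<and>
     \<comment> \<open>(RG2) locally compact topological group for the induced topology\<close>
     continuous_on (E \<times> E) (\<lambda>(a, b). mul a b) \<and> continuous_on E ginv \<and>
     locally_compact_space (top_of_set E) \<and>
     \<comment> \<open>(RG3)\<close>
     (\<exists>h m. (\<forall>a\<in>E. h a > 0) \<and> (\<forall>a\<in>E. \<forall>b\<in>E. h (mul a b) = h a * h b) \<and>
        continuous_on E h \<and> (\<exists>a\<in>E. \<exists>b\<in>E. h a \<noteq> h b) \<and>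
        haar_measure E mul m \<and>
        (\<forall>\<alpha>\<in>E. (\<integral>\<^sup>+ x. ennreal (h x) * indicator {x\<in>E. \<alpha> \<le> x} x \<partial>m) < \<infinity>))"

definition theta :: "real set \<Rightarrow> ereal" where
  "theta E = Inf (ereal ` E)"

definition to_theta :: "real set \<Rightarrow> real filter" where
  "to_theta E = inf (filtercomap ereal (nhds (theta E))) (principal E)"

definition action :: "real set \<Rightarrow> (real \<Rightarrow> real \<Rightarrow> real) \<Rightarrow> real \<Rightarrow> (real \<Rightarrow> 'x \<Rightarrow> 'x) \<Rightarrow> bool" where
  "action E mul one H \<longleftrightarrow>
     (\<forall>a\<in>E. bij (H a)) \<and> (\<forall>a\<in>E. \<forall>b\<in>E. H a \<circ> H b = H (mul a b)) \<and> H one = id"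

definition continuous_action :: "real set \<Rightarrow> (real \<Rightarrow> 'x::topological_space \<Rightarrow> 'x) \<Rightarrow> bool" where
  "continuous_action E H \<longleftrightarrow> continuous_on (E \<times> UNIV) (\<lambda>(a, x). H a x)"

definition absorption_center ::
  "real set \<Rightarrow> (real \<Rightarrow> real) \<Rightarrow> (real \<Rightarrow> 'x::topological_space \<Rightarrow> 'x) \<Rightarrow> 'x \<Rightarrow> bool" where
  "absorption_center E ginv H \<omega> \<longleftrightarrow>
     (\<forall>V. open V \<and> \<omega> \<in> V \<longrightarrow>
        (\<forall>x. \<exists>U \<alpha>. open U \<and> x \<in> U \<and> \<alpha> \<in> E \<and> (\<forall>\<epsilon>\<in>E. \<epsilon> \<le> \<alpha> \<longrightarrow> H (ginv \<epsilon>) ` U \<subseteq> V)))"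

definition Kfun :: "('x::topological_space \<Rightarrow> complex) \<Rightarrow> bool" where
  "Kfun \<phi> \<longleftrightarrow> continuous_on UNIV \<phi> \<and> compact (closure {x. \<phi> x \<noteq> 0})"

definition homogeneous_measure :: "real set \<Rightarrow> (real \<Rightarrow> 'x::topological_space \<Rightarrow> 'x) \<Rightarrow> 'x measure \<Rightarrow> bool" where
  "homogeneous_measure E H lam \<longleftrightarrow>
     (\<forall>\<epsilon>\<in>E. \<exists>c::real. c > 0 \<and>
        (\<forall>\<phi>. Kfun \<phi> \<longrightarrow> (\<integral>x. \<phi> (H \<epsilon> x) \<partial>lam) = complex_of_real c * (\<integral>x. \<phi> x \<partial>lam)))"

text \<open>Homogenizer (X is the type 'x; metrizability is given by the metric_space class,
which also provides first countability).\<close>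
definition homogenizer ::
  "real set \<Rightarrow> (real \<Rightarrow> real \<Rightarrow> real) \<Rightarrow> real \<Rightarrow> (real \<Rightarrow> real) \<Rightarrow>
   (real \<Rightarrow> 'x::metric_space \<Rightarrow> 'x) \<Rightarrow> 'x measure \<Rightarrow> bool" where
  "homogenizer E mul one ginv H lam \<longleftrightarrow>
     \<not> compact (UNIV :: 'x set) \<and> locally_compact_space (euclidean :: 'x topology) \<and>
     R_group E mul one ginv \<and> action E mul one H \<and> continuous_action E H \<and>
     (\<exists>\<omega>. absorption_center E ginv H \<omega> \<and>
        radon_on UNIV lam \<and> homogeneous_measure E H lam \<and>
        (\<exists>B \<in> sets lam. emeasure lam B \<noteq> 0) \<and> \<not> (\<forall>B \<in> sets lam. emeasure lam B = indicator B \<omega>))"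

text \<open>u in Pi-infinity: u o H_eps converges weak-* in L-infinity (i.e. against every L1 function)
to a constant as eps \<rightarrow> theta.\<close>
definition Pi_inf :: "real set \<Rightarrow> (real \<Rightarrow> 'x::metric_space \<Rightarrow> 'x) \<Rightarrow> 'x measure \<Rightarrow> ('x \<Rightarrow>\<^sub>C complex) \<Rightarrow> complex \<Rightarrow> bool" where
  "Pi_inf E H lam u c \<longleftrightarrow>
     (\<forall>f::'x \<Rightarrow> complex. integrable lam f \<longrightarrow>
        ((\<lambda>\<epsilon>. \<integral>x. apply_bcontfun u (H \<epsilon> x) * f x \<partial>lam) \<longlongrightarrow> c * (\<integral>x. f x \<partial>lam)) (to_theta E))"

definition mean :: "real set \<Rightarrow> (real \<Rightarrow> 'x::metric_space \<Rightarrow> 'x) \<Rightarrow> 'x measure \<Rightarrow> ('x \<Rightarrow>\<^sub>C complex) \<Rightarrow> complex" where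
  "mean E H lam u = (THE c. Pi_inf E H lam u c)"

definition homogenization_algebra ::
  "real set \<Rightarrow> (real \<Rightarrow> 'x::metric_space \<Rightarrow> 'x) \<Rightarrow> 'x measure \<Rightarrow> ('x \<Rightarrow>\<^sub>C complex) set \<Rightarrow> bool" where
  "homogenization_algebra E H lam A \<longleftrightarrow>
     closed A \<and>
     (\<exists>D. countable D \<and> D \<subseteq> A \<and> A \<subseteq> closure D) \<and>
     (\<forall>c. const_bcontfun c \<in> A) \<and>
     (\<forall>u\<in>A. \<forall>v\<in>A. u + v \<in> A) \<and>
     (\<forall>u\<in>A. \<forall>c::complex. \<exists>w\<in>A. \<forall>y. apply_bcontfun w y = c * apply_bcontfun u y) \<and>
     (\<forall>u\<in>A. \<forall>v\<in>A. \<exists>w\<in>A. \<forall>y. apply_bcontfun w y = apply_bcontfun u y * apply_bcontfun v y) \<and>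
     (\<forall>u\<in>A. \<exists>w\<in>A. \<forall>y. apply_bcontfun w y = cnj (apply_bcontfun u y)) \<and>
     (\<forall>u\<in>A. \<exists>c. Pi_inf E H lam u c)"

text \<open>Spectrum of A: nonzero multiplicative linear forms on A (extended by 0 outside A).\<close>
definition spectrum_set :: "('x::topological_space \<Rightarrow>\<^sub>C complex) set \<Rightarrow> (('x \<Rightarrow>\<^sub>C complex) \<Rightarrow> complex) set" where
  "spectrum_set A = {s.
     (\<forall>u\<in>A. \<forall>v\<in>A. s (u + v) = s u + s v) \<and>
     (\<forall>u\<in>A. \<forall>w\<in>A. \<forall>c. (\<forall>y. apply_bcontfun w y = c * apply_bcontfun u y) \<longrightarrow> s w = c * s u) \<and>
     (\<forall>u\<in>A. \<forall>v\<in>A. \<forall>w\<in>A. (\<forall>y. apply_bcontfun w y = apply_bcontfun u y * apply_bcontfun v y) \<longrightarrow> s w = s u * s v) \<and>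
     (\<exists>u\<in>A. s u \<noteq> 0) \<and> (\<forall>u. u \<notin> A \<longrightarrow> s u = 0)}"

text \<open>Borel sigma algebra of the weak-* topology of the spectrum (generated by the Gelfand
transforms s \<mapsto> s u, u in A).\<close>
definition spectrum_space :: "('x::topological_space \<Rightarrow>\<^sub>C complex) set \<Rightarrow> (('x \<Rightarrow>\<^sub>C complex) \<Rightarrow> complex) measure" where
  "spectrum_space A = sigma (spectrum_set A)
     {{s \<in> spectrum_set A. s u \<in> U} | u U. u \<in> A \<and> open U}"

definition is_beta :: "real set \<Rightarrow> (real \<Rightarrow> 'x::metric_space \<Rightarrow> 'x) \<Rightarrow> 'x measure \<Rightarrow>
    ('x \<Rightarrow>\<^sub>C complex) set \<Rightarrow> (('x \<Rightarrow>\<^sub>C complex) \<Rightarrow> complex) measure \<Rightarrow> bool" where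
  "is_beta E H lam A \<beta> \<longleftrightarrow>
     sets \<beta> = sets (spectrum_space A) \<and> emeasure \<beta> (space \<beta>) = 1 \<and>
     (\<forall>u\<in>A. mean E H lam u = (\<integral>s. s u \<partial>\<beta>))"

definition Lp :: "'a measure \<Rightarrow> real \<Rightarrow> ('a \<Rightarrow> 'b::{banach, second_countable_topology}) \<Rightarrow> bool" where
  "Lp M p f \<longleftrightarrow> f \<in> borel_measurable M \<and> integrable M (\<lambda>x. norm (f x) powr p)"

text \<open>psi in L^q(Omega; A): Borel (hence, A being separable, strongly) measurable A-valued
function with integrable q-th power of the norm.\<close>
definition Lp_A :: "'x measure \<Rightarrow> real \<Rightarrow> ('x::metric_space \<Rightarrow>\<^sub>C complex) set \<Rightarrow> ('x \<Rightarrow> ('x \<Rightarrow>\<^sub>C complex)) \<Rightarrow> bool" where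
  "Lp_A M q A \<psi> \<longleftrightarrow> \<psi> \<in> borel_measurable M \<and> (\<forall>x\<in>space M. \<psi> x \<in> A) \<and>
     integrable M (\<lambda>x. norm (\<psi> x) powr q)"

definition fundamental_sequence :: "real set \<Rightarrow> real \<Rightarrow> (nat \<Rightarrow> real) \<Rightarrow> bool" where
  "fundamental_sequence E one eps \<longleftrightarrow>
     (\<forall>n. eps n \<in> E \<and> eps n \<le> one) \<and> ((\<lambda>n. ereal (eps n)) \<longlonglongrightarrow> theta E)"

definition weak_Sigma_conv ::
  "(real \<Rightarrow> 'x::metric_space \<Rightarrow> 'x) \<Rightarrow> 'x measure \<Rightarrow> ('x \<Rightarrow>\<^sub>C complex) set \<Rightarrow>
   (('x \<Rightarrow>\<^sub>C complex) \<Rightarrow> complex) measure \<Rightarrow> real \<Rightarrow>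
   (nat \<Rightarrow> real) \<Rightarrow> (nat \<Rightarrow> 'x \<Rightarrow> complex) \<Rightarrow> ('x \<times> (('x \<Rightarrow>\<^sub>C complex) \<Rightarrow> complex) \<Rightarrow> complex) \<Rightarrow> bool" where
  "weak_Sigma_conv H lamO A \<beta> p eps u u0 \<longleftrightarrow>
     (\<forall>\<psi>. Lp_A lamO (p / (p - 1)) A \<psi> \<longrightarrow>
        ((\<lambda>n. \<integral>x. u n x * apply_bcontfun (\<psi> x) (H (eps n) x) \<partial>lamO) \<longlongrightarrow>
          (\<integral>z. u0 z * snd z (\<psi> (fst z)) \<partial>(lamO \<Otimes>\<^sub>M \<beta>))) sequentially)"

end

theory Submission
  imports Defs "HOL-Library.Diagonal_Subsequence"
begin

text \<open>
  Weak limits of \<open>\<integral> u\<^sub>n \<psi>\<^sup>\<epsilon>\<close> along a subsequence exist for all \<open>\<psi>\<close> because the pairing is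
  equicontinuous and both \<open>L\<^sup>q(\<Omega>)\<close> (a homogenizer is sigma-compact and \<open>\<lambda>\<close> outer regular) and \<open>A\<close>
  are separable.  Write \<open>\<psi>'\<close> for the Gelfand transform of \<open>\<psi>\<close>.  Since \<open>\<bar>a\<bar>\<^sup>q \<in> A\<close> for \<open>a \<in> A\<close>, the
  integrals \<open>\<integral>\<bar>\<psi>\<^sup>\<epsilon>\<bar>\<^sup>q\<close> converge to \<open>\<integral>\<integral>\<bar>\<psi>'\<bar>\<^sup>q\<close> for simple \<open>\<psi>\<close>, so by Young's inequality the limit
  functional is at most \<open>C/p + \<integral>\<integral>\<bar>\<psi>'\<bar>\<^sup>q/q\<close>.  Minimising \<open>\<integral>\<integral>\<bar>w\<bar>\<^sup>q/q\<close> minus the functional over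
  \<open>w = \<psi>'\<close> then produces the representing function \<open>u\<^sub>0 \<in> L\<^sup>p\<close>.
\<close>

section \<open>Uniform convexity of powers of the norm\<close>

text \<open>The obstacle is the norm in which the limit functional is bounded. Boundedness of
  \<open>u\<close> alone controls it by the integral of \<open>norm (\<psi> x) powr q\<close>, a sup
  norm in the second variable; it would not even be clear that the limit depends on
  \<open>\<psi>\<close> only through its transform. Young's inequality inserted before the limit
  replaces this by the \<open>L^q\<close> norm of the transform on the product with
  \<open>\<beta>\<close>. The additive constant \<open>C / p\<close> is harmless: the bound holds on
  a real linear space, so scaling turns it into continuity and well-definedness. Characters are not
  approximated by point evaluations. The bound \<open>norm (s u) \<le> norm u\<close>, compatibility
  with conjugation and Weierstrass approximation show that every character commutes with
  \<open>a \<mapsto> |a|^q\<close>; this identifies the limit of the energies. Only \<open>A\<close>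
  is separable, not the space of all bounded continuous functions, so differences of measurable maps
  into that space are handled through scalar dominants.\<close>

definition powr_grad :: "real \<Rightarrow> complex \<Rightarrow> complex" where
  "powr_grad q z = complex_of_real (norm z powr (q - 2)) * cnj z"

lemma norm_powr_grad: "norm (powr_grad q z) = norm z powr (q - 1)"
proof (cases "z = 0")
  case False
  have "norm z powr (q - 2) * norm z = norm z powr (q - 2) * norm z powr 1"
    using False by simp
  also have "\<dots> = norm z powr (q - 1)"
    by (subst powr_add[symmetric]) simp
  finally show ?thesis by (simp add: powr_grad_def norm_mult)
qed (simp add: powr_grad_def)

lemma norm_powr_diff_2: "norm z powr (q - 2) * (norm z)\<^sup>2 = norm z powr q" for z :: complex
proof (cases "z = 0")
  case False
  have "norm z powr (q - 2) * (norm z)\<^sup>2 = norm z powr (q - 2) * norm z powr 2"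
    using False by simp
  also have "\<dots> = norm z powr q"
    by (subst powr_add[symmetric]) simp
  finally show ?thesis .
qed simp

lemma powr_grad_mult_self: "powr_grad q z * z = complex_of_real (norm z powr q)"
proof -
  have "complex_of_real (norm z powr (q - 2)) * complex_of_real ((norm z)\<^sup>2) = complex_of_real (norm z powr q)"
    by (metis of_real_mult norm_powr_diff_2)
  then show ?thesis
    by (simp add: powr_grad_def mult.assoc mult.commute[of "cnj z"] complex_norm_square del: of_real_power)
qed

text \<open>For \<open>q < 2\<close> the factor \<open>norm z powr (q - 2)\<close> is unbounded near
  0, so continuity at 0 is read off \<open>norm_powr_grad\<close>: the norm is a positive power of
  \<open>norm z\<close>.\<close>

lemma isCont_powr_grad:
  assumes q: "1 < q" shows "isCont (powr_grad q) z"
proof (cases "z = 0")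
  case True
  have "((\<lambda>w::complex. norm w powr (q - 1)) \<longlongrightarrow> 0 powr (q - 1)) (at 0)"
    using q tendsto_norm[OF tendsto_ident_at, of "0::complex" UNIV]
    by (intro tendsto_powr' tendsto_const) auto
  then have "((\<lambda>w. norm (powr_grad q w)) \<longlongrightarrow> 0) (at 0)"
    by (simp add: norm_powr_grad)
  then have "((\<lambda>w. powr_grad q w) \<longlongrightarrow> 0) (at 0)"
    by (rule tendsto_norm_zero_cancel)
  moreover have "powr_grad q 0 = 0" by (simp add: powr_grad_def)
  ultimately show ?thesis
    using True by (simp add: isCont_def)
next
  case False
  then show ?thesis unfolding powr_grad_def
    by (intro continuous_intros) auto
qed

lemma continuous_on_powr_grad: "1 < q \<Longrightarrow> continuous_on UNIV (powr_grad q)"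
  by (simp add: continuous_on_eq_continuous_at isCont_powr_grad)

text \<open>With \<open>G\<close> the left side, \<open>X = t powr q / G\<close> and
  \<open>Y = s powr q / G\<close>, the weighted logarithms
  \<open>ln X / q + (q - 1) / q * ln Y\<close> sum to 0. Then \<open>ln x \<le> x - 1\<close> gives
  the inequality, strictly because \<open>X = 1\<close> would force \<open>s = t\<close>.\<close>

lemma Young_strict:
  fixes s t q :: real
  assumes q: "1 < q" and st: "0 \<le> s" "0 \<le> t" "s \<noteq> t"
  shows "s powr (q - 1) * t < t powr q / q + (q - 1) / q * s powr q"
proof (cases "s = 0 \<or> t = 0")
  case True
  then show ?thesis using st q by (auto intro: add_pos_nonneg divide_pos_pos mult_pos_pos)
next
  case False
  then have st: "0 < s" "0 < t" "s \<noteq> t" using st by auto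
  define G where "G = s powr (q - 1) * t"
  have G: "G > 0" using st by (simp add: G_def)
  have strict: "ln x < x - 1" if "0 < x" "x \<noteq> 1" for x :: real
    using ln_le_minus_one[OF that(1)] ln_eq_minus_one[OF that(1)] that by fastforce
  have lnG: "ln G = (q - 1) * ln s + ln t"
    using st by (simp add: G_def ln_mult ln_powr)
  let ?x = "t powr q / G" and ?y = "s powr q / G"
  have ne: "?x \<noteq> 1"
  proof
    assume "?x = 1"
    then have "ln (t powr q) = ln G" using G by simp
    then have "(q - 1) * ln s = (q - 1) * ln t"
      using lnG st by (simp add: ln_powr algebra_simps)
    then show False using q st by simp
  qed
  have "ln ?x = q * ln t - ln G" "ln ?y = q * ln s - ln G"
    using G st by (simp_all add: ln_div ln_powr)
  then have "ln ?x / q + (q - 1) / q * ln ?y = 0"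
    using q by (simp add: lnG) (simp add: field_simps)
  moreover have "ln ?x < ?x - 1" using strict[of ?x] ne G st by simp
  moreover have "ln ?y \<le> ?y - 1" using G st by (intro ln_le_minus_one) simp
  ultimately have "0 < (?x - 1) / q + (q - 1) / q * (?y - 1)"
    using q by (smt (verit) divide_strict_right_mono mult_left_mono divide_pos_pos)
  moreover have "(X - 1) / q + (q - 1) / q * (Y - 1) = X / q + (q - 1) / q * Y - 1" for X Y
    using q by (simp add: field_simps)
  ultimately have "0 < (?x / q + (q - 1) / q * ?y) - 1"
    by metis
  then have "0 < ((?x / q + (q - 1) / q * ?y) - 1) * G" using G by simp
  also have "\<dots> = (?x * G) / q + (q - 1) / q * (?y * G) - G"
    by (simp only: left_diff_distrib distrib_right mult.assoc times_divide_eq_left mult_1)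
  also have "\<dots> = t powr q / q + (q - 1) / q * s powr q - G"
    using G by simp
  finally show ?thesis by (simp add: G_def)
qed

text \<open>\<open>Re (powr_grad q a * h)\<close> is the derivative of
  \<open>norm z powr q / q\<close> at \<open>a\<close> in direction \<open>h\<close>, so this is a
  strict tangent inequality. Strictness has two sources: Young's inequality if the norms differ, and
  \<open>norm (a - b) > 0\<close> if they agree.\<close>

lemma powr_grad_strict:
  assumes q: "1 < q" and ab: "a \<noteq> b"
  shows "Re (powr_grad q a * (b - a)) < (norm b powr q - norm a powr q) / q"
proof -
  have e: "Re (powr_grad q a * (b - a)) = Re (powr_grad q a * b) - norm a powr q"
    by (simp add: right_diff_distrib powr_grad_mult_self)
  show ?thesis
  proof (cases "norm a = norm b")
    case False
    have "Re (powr_grad q a * b) \<le> norm a powr (q - 1) * norm b"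
      using complex_Re_le_cmod[of "powr_grad q a * b"] by (simp add: norm_mult norm_powr_grad)
    also have "\<dots> < norm b powr q / q + (q - 1) / q * norm a powr q"
      using Young_strict[OF q _ _ False] by simp
    finally show ?thesis using q unfolding e by (simp add: field_simps)
  next
    case True
    with ab have a0: "a \<noteq> 0" by auto
    have "0 < (norm (a - b))\<^sup>2" using ab by simp
    also have "(norm (a - b))\<^sup>2 = (norm a)\<^sup>2 + (norm b)\<^sup>2 - 2 * Re (cnj a * b)"
      unfolding cmod_power2 by (simp add: power2_eq_square algebra_simps)
    finally have "Re (cnj a * b) < (norm a)\<^sup>2" using True by simp
    then have "norm a powr (q - 2) * Re (cnj a * b) < norm a powr (q - 2) * (norm a)\<^sup>2"
      using a0 by simp
    also have "\<dots> = norm a powr q" by (rule norm_powr_diff_2)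
    finally have "Re (powr_grad q a * b) < norm a powr q"
      by (simp add: powr_grad_def algebra_simps)
    then show ?thesis unfolding e using True by simp
  qed
qed

lemma powr_grad_le:
  assumes q: "1 < q"
  shows "Re (powr_grad q a * (b - a)) \<le> (norm b powr q - norm a powr q) / q"
  using powr_grad_strict[OF q, of a b] by (cases "a = b") auto

text \<open>The tangent inequalities at the midpoint towards \<open>a\<close> and towards
  \<open>b\<close> are added; their linear parts cancel.\<close>

lemma norm_powr_midpoint_strict:
  fixes a b :: complex
  assumes q: "1 < q" and ab: "a \<noteq> b"
  shows "2 * norm ((a + b) / 2) powr q < norm a powr q + norm b powr q"
proof -
  let ?m = "(a + b) / 2"
  have *: "?m \<noteq> a" "?m \<noteq> b" using ab by (auto simp: field_simps)
  have "Re (powr_grad q ?m * (a - ?m)) + Re (powr_grad q ?m * (b - ?m)) =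
     Re (powr_grad q ?m * ((a - ?m) + (b - ?m)))" by (simp only: distrib_left plus_complex.sel)
  also have "(a - ?m) + (b - ?m) = 0" by (simp add: field_simps)
  finally have "0 < (norm a powr q - norm ?m powr q) / q + (norm b powr q - norm ?m powr q) / q"
    using powr_grad_strict[OF q *(1)] powr_grad_strict[OF q *(2)] by simp
  also have "\<dots> = (norm a powr q + norm b powr q - 2 * norm ?m powr q) / q"
    by (simp add: diff_divide_distrib add_divide_distrib)
  finally show ?thesis using q by (simp add: zero_less_divide_iff)
qed

lemma powr_add_le:
  fixes s t q :: real
  assumes "0 \<le> s" "0 \<le> t" "0 < q"
  shows "(s + t) powr q \<le> 2 powr q * (s powr q + t powr q)"
proof -
  have "(s + t) powr q \<le> (2 * max s t) powr q"
    using assms by (intro powr_mono2) auto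
  also have "\<dots> = 2 powr q * max s t powr q"
    by (simp add: powr_mult)
  also have "\<dots> \<le> 2 powr q * (s powr q + t powr q)"
    by (intro mult_left_mono) (auto simp: max_def)
  finally show ?thesis .
qed

text \<open>Compactness of the unit sphere and homogeneity turn strict convexity into a
  quantitative estimate; this replaces Clarkson's inequalities.\<close>
lemma norm_powr_uniformly_convex:
  assumes q: "1 < q" and \<delta>: "0 < \<delta>"
  obtains K where "0 \<le> K" "\<And>a b::complex. norm (a - b) powr q \<le>
    \<delta> * (norm a powr q + norm b powr q) + K * (norm a powr q + norm b powr q - 2 * norm ((a + b) / 2) powr q)"
proof -
  let ?s = "\<lambda>z::complex \<times> complex. norm (fst z) powr q + norm (snd z) powr q"
  let ?D = "\<lambda>z::complex \<times> complex. ?s z - 2 * norm ((fst z + snd z) / 2) powr q"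
  \<comment> \<open>On the unit sphere outside \<open>S\<close> the \<open>\<delta>\<close> term
    alone suffices. On \<open>S\<close> the two components differ, so the convexity gap
    \<open>?D\<close> is positive and, by compactness, bounded away from 0.\<close>
  define S where "S = {z. norm z = 1 \<and> \<delta> * ?s z \<le> norm (fst z - snd z) powr q}"
  have cont: "continuous_on UNIV (\<lambda>z::complex \<times> complex. norm (f z) powr q)"
    if "continuous_on UNIV f" for f :: "complex \<times> complex \<Rightarrow> complex"
    using that q by (intro continuous_on_powr' continuous_intros) auto
  have cs: "continuous_on UNIV ?s"
    by (intro continuous_on_add cont continuous_intros)
  have cd: "continuous_on UNIV (\<lambda>z::complex \<times> complex. norm (fst z - snd z) powr q)"
    by (intro cont continuous_intros)
  have cD: "continuous_on UNIV ?D"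
    by (intro continuous_on_diff cs continuous_on_mult cont continuous_intros) auto
  have "compact (sphere (0::complex\<times>complex) 1)" by simp
  moreover have "closed {z. \<delta> * ?s z \<le> norm (fst z - snd z) powr q}"
    by (intro closed_Collect_le cd continuous_on_mult cs continuous_intros)
  ultimately have "compact (sphere 0 1 \<inter> {z. \<delta> * ?s z \<le> norm (fst z - snd z) powr q})"
    by (rule compact_Int_closed)
  also have "sphere 0 1 \<inter> {z. \<delta> * ?s z \<le> norm (fst z - snd z) powr q} = S"
    by (auto simp: S_def)
  finally have cS: "compact S" .
  have spos: "0 < ?s z" if "z \<noteq> 0" for z
    using that by (cases z) (auto simp: zero_prod_def intro: add_pos_nonneg add_nonneg_pos)
  have Dpos: "0 < ?D z" if "z \<in> S" for z
  proof -
    have "z \<noteq> 0" using that by (auto simp: S_def)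
    then have "0 < \<delta> * ?s z" using \<delta> spos by simp
    also have "\<dots> \<le> norm (fst z - snd z) powr q" using that by (simp add: S_def)
    finally have "fst z \<noteq> snd z" by auto
    then show ?thesis using norm_powr_midpoint_strict[OF q] by simp
  qed
  have Dnn: "0 \<le> ?D z" for z
    using norm_powr_midpoint_strict[OF q, of "fst z" "snd z"] by (cases "fst z = snd z") auto
  obtain \<mu> where \<mu>: "0 < \<mu>" "\<And>z. z \<in> S \<Longrightarrow> \<mu> \<le> ?D z"
  proof (cases "S = {}")
    case True then show ?thesis using that[of 1] by auto
  next
    case False
    then obtain z0 where "z0 \<in> S" "\<And>z. z \<in> S \<Longrightarrow> ?D z0 \<le> ?D z"
      using continuous_attains_inf[OF cS False continuous_on_subset[OF cD]] by auto
    then show ?thesis using that[of "?D z0"] Dpos by auto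
  qed
  \<comment> \<open>\<open>2 powr q\<close> bounds \<open>norm (a - b) powr q\<close> on the unit
    sphere, and \<open>\<mu>\<close> bounds the gap on \<open>S\<close> from below.\<close>
  define K where "K = 2 powr q / \<mu>"
  have unit: "norm (fst z - snd z) powr q \<le> \<delta> * ?s z + K * ?D z" if z: "norm z = 1" for z
  proof (cases "z \<in> S")
    case False
    then have "norm (fst z - snd z) powr q \<le> \<delta> * ?s z" using z by (auto simp: S_def)
    moreover have "0 \<le> K * ?D z" using Dnn \<mu>(1) by (simp add: K_def)
    ultimately show ?thesis by linarith
  next
    case True
    have "norm (fst z) \<le> 1" "norm (snd z) \<le> 1"
      using z norm_fst_le[of "fst z" "snd z"] norm_snd_le[of "snd z" "fst z"] by auto
    then have "norm (fst z - snd z) \<le> 2" using norm_triangle_ineq4[of "fst z" "snd z"] by linarith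
    then have "norm (fst z - snd z) powr q \<le> 2 powr q" using q by (intro powr_mono2) auto
    also have "\<dots> = K * \<mu>" using \<mu> by (simp add: K_def)
    also have "\<dots> \<le> K * ?D z" using \<mu>(1) \<mu>(2)[OF True] by (intro mult_left_mono) (auto simp: K_def)
    also have "\<dots> \<le> \<delta> * ?s z + K * ?D z" using \<delta> by simp
    finally show ?thesis .
  qed
  show thesis
  proof (rule that[of K])
    show "0 \<le> K" using \<mu> by (simp add: K_def)
    fix a b :: complex
    show "norm (a - b) powr q \<le> \<delta> * (norm a powr q + norm b powr q) +
        K * (norm a powr q + norm b powr q - 2 * norm ((a + b) / 2) powr q)"
    proof (cases "(a, b) = 0")
      case True then show ?thesis by (auto simp: zero_prod_def)
    next
      case False
      define r where "r = norm (a, b)"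
      have r: "r > 0" using False by (simp add: r_def)
      have sc: "norm (c / complex_of_real r) powr q = norm c powr q / r powr q" for c
        using r by (simp add: norm_divide powr_divide)
      let ?z = "(a / complex_of_real r, b / complex_of_real r)"
      have "norm ?z = norm ((1 / r) *\<^sub>R (a, b))" by (simp add: scaleR_conv_of_real)
      also have "\<dots> = 1" using r by (simp only: norm_scaleR) (simp add: r_def)
      finally have "norm ?z = 1" .
      from unit[OF this]
      have "norm ((a - b) / complex_of_real r) powr q \<le> \<delta> * (norm (a / complex_of_real r) powr q + norm (b / complex_of_real r) powr q)
        + K * (norm (a / complex_of_real r) powr q + norm (b / complex_of_real r) powr q - 2 * norm (((a + b) / 2) / complex_of_real r) powr q)"
        by (simp add: diff_divide_distrib add_divide_distrib mult.commute)
      then have "norm (a - b) powr q / r powr q \<le> (\<delta> * (norm a powr q + norm b powr q) +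
        K * (norm a powr q + norm b powr q - 2 * norm ((a + b) / 2) powr q)) / r powr q"
        unfolding sc by (simp add: add_divide_distrib diff_divide_distrib distrib_left right_diff_distrib)
      moreover have "0 < r powr q" using r by simp
      ultimately show ?thesis by (simp only: divide_le_cancel)
    qed
  qed
qed

section \<open>Functionals on \<open>L\<^sup>q\<close>\<close>

text \<open>A Riesz-Fischer argument by weights in place of Minkowski's inequality. The rate in
  \<open>rapid\<close> survives the factor \<open>(2 ^ k) powr q\<close>, so the weighted increments
  have an integrable sum \<open>h\<close>, and each increment is at most
  \<open>(1/2) ^ k * h x powr (1 / q)\<close>. The single dominant \<open>W\<close> serves the later
  limits under the integral.\<close>

lemma Lq_rapid_Cauchy_dominated:
  fixes v :: "nat \<Rightarrow> 'a \<Rightarrow> complex"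
  assumes q: "1 < q"
    and meas [measurable]: "\<And>k. v k \<in> borel_measurable M"
    and int: "\<And>k. integrable M (\<lambda>x. norm (v k x) powr q)"
    and intd: "\<And>k. integrable M (\<lambda>x. norm (v (Suc k) x - v k x) powr q)"
    and rapid: "\<And>k. (\<integral>x. norm (v (Suc k) x - v k x) powr q \<partial>M) \<le> (1/2) ^ k * ((1/2) ^ k) powr q"
  obtains V W where "V \<in> borel_measurable M" "W \<in> borel_measurable M" "\<And>x. 0 \<le> W x"
    "integrable M (\<lambda>x. W x powr q)" "AE x in M. (\<lambda>k. v k x) \<longlonglongrightarrow> V x" "AE x in M. \<forall>k. norm (v k x) \<le> W x"
proof -
  define f where "f k x = (2 ^ k) powr q * norm (v (Suc k) x - v k x) powr q" for k x
  have fm [measurable]: "f k \<in> borel_measurable M" for k unfolding f_def by measurable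
  have fnn: "0 \<le> f k x" for k x by (simp add: f_def)
  have fint: "integrable M (f k)" for k
    unfolding f_def by (intro integrable_mult_right intd)
  have fle: "(\<integral>x. f k x \<partial>M) \<le> (1/2) ^ k" for k
  proof -
    have "(\<integral>x. f k x \<partial>M) = (2 ^ k) powr q * (\<integral>x. norm (v (Suc k) x - v k x) powr q \<partial>M)"
      by (simp add: f_def)
    also have "\<dots> \<le> (2 ^ k) powr q * ((1/2) ^ k * ((1/2) ^ k) powr q)"
      by (intro mult_left_mono rapid) simp
    also have "\<dots> = (1/2) ^ k * (2 ^ k * (1/2) ^ k) powr q"
      by (simp add: powr_mult)
    also have "\<dots> = (1/2) ^ k" by (simp flip: power_mult_distrib)
    finally show ?thesis .
  qed
  have sI: "summable (\<lambda>k. \<integral>x. norm (f k x) \<partial>M)"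
  proof (rule summable_comparison_test')
    show "summable (\<lambda>k. (1/2::real) ^ k)" by (rule summable_geometric) simp
    show "norm (\<integral>x. norm (f k x) \<partial>M) \<le> (1/2) ^ k" if "0 \<le> k" for k
      using fle[of k] fnn by (simp add: integral_nonneg_AE)
  qed
  have "(\<integral>\<^sup>+x. (\<Sum>k. ennreal (f k x)) \<partial>M) = (\<Sum>k. \<integral>\<^sup>+x. ennreal (f k x) \<partial>M)"
    by (rule nn_integral_suminf) simp
  also have "\<dots> = (\<Sum>k. ennreal (\<integral>x. f k x \<partial>M))"
    using fint fnn by (intro suminf_cong nn_integral_eq_integral) auto
  also have "\<dots> = ennreal (\<Sum>k. \<integral>x. f k x \<partial>M)"
    using sI fnn by (intro suminf_ennreal2) (auto intro: integral_nonneg_AE)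
  finally have "(\<integral>\<^sup>+x. (\<Sum>k. ennreal (f k x)) \<partial>M) \<noteq> \<infinity>" by simp
  then have "AE x in M. (\<Sum>k. ennreal (f k x)) \<noteq> \<infinity>"
    by (intro nn_integral_noteq_infinite) auto
  then have AEs: "AE x in M. summable (\<lambda>k. f k x)"
    by eventually_elim (auto intro: summable_suminf_not_top fnn)
  \<comment> \<open>Summing in \<open>ennreal\<close> makes \<open>h\<close> measurable and
    nonnegative everywhere; where the series diverges its value is 0.\<close>
  define h where "h x = enn2real (\<Sum>k. ennreal (f k x))" for x
  have heq: "h x = (\<Sum>k. f k x)" if "summable (\<lambda>k. f k x)" for x
    using that fnn by (simp add: h_def suminf_ennreal2 suminf_nonneg)
  have hint: "integrable M (\<lambda>x. \<Sum>k. f k x)"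
    using AEs fnn by (intro integrable_suminf fint sI) simp
  have hm [measurable]: "h \<in> borel_measurable M"
    unfolding h_def by measurable
  have hint': "integrable M h"
    using AEs by (intro integrable_cong_AE_imp[OF hint hm]) (auto simp: heq)
  have hnn: "0 \<le> h x" for x by (simp add: h_def)
  \<comment> \<open>The factor 2 is the sum of the geometric series of ratio
    \<open>1/2\<close>.\<close>
  define W where "W x = norm (v 0 x) + 2 * h x powr (1 / q)" for x
  define V where "V x = lim (\<lambda>k. v k x)" for x
  have step: "norm (v (Suc k) x - v k x) \<le> (1/2) ^ k * h x powr (1 / q)"
    if s: "summable (\<lambda>k. f k x)" for k x
  proof -
    have "f k x \<le> h x"
      using sum_le_suminf[OF s, of "{k}"] fnn s by (simp add: heq)
    then have "f k x powr (1 / q) \<le> h x powr (1 / q)"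
      using q fnn by (intro powr_mono2) auto
    moreover have "f k x = (2 ^ k * norm (v (Suc k) x - v k x)) powr q"
      by (simp add: f_def powr_mult)
    ultimately have "2 ^ k * norm (v (Suc k) x - v k x) \<le> h x powr (1 / q)"
      using q by (simp add: powr_powr)
    then show ?thesis by (simp add: field_simps power_one_over)
  qed
  have bd: "norm (v k x) \<le> W x" if s: "summable (\<lambda>k. f k x)" for k x
  proof -
    have "norm (v k x) \<le> norm (v 0 x) + (\<Sum>i<k. (1/2) ^ i) * h x powr (1 / q)"
    proof (induction k)
      case (Suc k)
      have "norm (v (Suc k) x) \<le> norm (v k x) + norm (v (Suc k) x - v k x)"
        by (rule norm_triangle_sub)
      then show ?case using Suc step[OF s, of k] by (simp add: distrib_right)
    qed simp
    also have "(\<Sum>i<k. (1/2::real) ^ i) \<le> 2"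
      using sum_le_suminf[of "\<lambda>i. (1/2::real) ^ i" "{..<k}"] suminf_geometric[of "1/2::real"]
        summable_geometric[of "1/2::real"] by simp
    then have "norm (v 0 x) + (\<Sum>i<k. (1/2) ^ i) * h x powr (1 / q) \<le> W x"
      by (simp add: W_def mult_right_mono)
    finally show ?thesis .
  qed
  have conv: "(\<lambda>k. v k x) \<longlonglongrightarrow> V x" if s: "summable (\<lambda>k. f k x)" for x
  proof -
    have "summable (\<lambda>k. v (Suc k) x - v k x)"
    proof (rule summable_comparison_test')
      show "summable (\<lambda>k. (1/2::real) ^ k * h x powr (1 / q))"
        by (intro summable_mult2 summable_geometric) simp
      show "norm (v (Suc k) x - v k x) \<le> (1/2) ^ k * h x powr (1 / q)" if "0 \<le> k" for k
        by (rule step[OF s])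
    qed
    then have "(\<lambda>n. \<Sum>k<n. v (Suc k) x - v k x) \<longlonglongrightarrow> (\<Sum>k. v (Suc k) x - v k x)"
      by (rule summable_LIMSEQ)
    then have "(\<lambda>n. v n x - v 0 x) \<longlonglongrightarrow> (\<Sum>k. v (Suc k) x - v k x)"
      by (simp add: sum_lessThan_telescope[of "\<lambda>k. v k x"])
    then have "(\<lambda>n. (v n x - v 0 x) + v 0 x) \<longlonglongrightarrow> (\<Sum>k. v (Suc k) x - v k x) + v 0 x"
      by (intro tendsto_add tendsto_const)
    then show ?thesis
      unfolding V_def by (simp add: limI)
  qed
  show thesis
  proof (rule that[of V W])
    show "V \<in> borel_measurable M" unfolding V_def by (rule borel_measurable_lim_metric) simp
    show "W \<in> borel_measurable M" unfolding W_def by measurable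
    show "0 \<le> W x" for x by (simp add: W_def)
    show "AE x in M. (\<lambda>k. v k x) \<longlonglongrightarrow> V x" using AEs by eventually_elim (rule conv)
    show "AE x in M. \<forall>k. norm (v k x) \<le> W x" using AEs by eventually_elim (auto intro: bd)
    have "integrable M (\<lambda>x. 2 powr q * (norm (v 0 x) powr q + 2 powr q * h x))"
      by (intro integrable_mult_right Bochner_Integration.integrable_add int hint')
    then show "integrable M (\<lambda>x. W x powr q)"
    proof (rule Bochner_Integration.integrable_bound)
      show "(\<lambda>x. W x powr q) \<in> borel_measurable M" unfolding W_def by measurable
      have "W x powr q \<le> 2 powr q * (norm (v 0 x) powr q + 2 powr q * h x)" for x
      proof -
        have "W x powr q \<le> 2 powr q * (norm (v 0 x) powr q + (2 * h x powr (1 / q)) powr q)"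
          unfolding W_def using q by (intro powr_add_le) auto
        also have "(2 * h x powr (1 / q)) powr q = 2 powr q * h x"
          using q hnn by (simp add: powr_mult powr_powr)
        finally show ?thesis .
      qed
      then show "AE x in M. norm (W x powr q) \<le> norm (2 powr q * (norm (v 0 x) powr q + 2 powr q * h x))"
        using hnn by (intro AE_I2) (simp add: abs_of_nonneg)
    qed
  qed
qed

lemma integrable_norm_add_powr:
  fixes f g :: "'a \<Rightarrow> 'b::{real_normed_vector, second_countable_topology}"
  assumes q: "0 < q" and [measurable]: "f \<in> borel_measurable M" "g \<in> borel_measurable M"
    and "integrable M (\<lambda>x. norm (f x) powr q)" "integrable M (\<lambda>x. norm (g x) powr q)"
  shows "integrable M (\<lambda>x. norm (f x + g x) powr q)"
proof (rule Bochner_Integration.integrable_bound)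
  show "integrable M (\<lambda>x. 2 powr q * (norm (f x) powr q + norm (g x) powr q))"
    using assms by simp
  have "norm (f x + g x) powr q \<le> 2 powr q * (norm (f x) powr q + norm (g x) powr q)" for x
    using q by (intro order_trans[OF powr_mono2 powr_add_le] norm_triangle_ineq) auto
  then show "AE x in M. norm (norm (f x + g x) powr q) \<le> norm (2 powr q * (norm (f x) powr q + norm (g x) powr q))"
    by (intro AE_I2) (simp add: abs_of_nonneg)
qed measurable

lemma norm_add_scaled_le:
  fixes y z :: complex
  assumes "norm y \<le> a" "0 \<le> t" "t \<le> 1"
  shows "norm (y + complex_of_real t * z) \<le> a + norm z"
proof -
  have "norm (y + complex_of_real t * z) \<le> norm y + t * norm z"
    using norm_triangle_ineq[of y "complex_of_real t * z"] assms by (simp add: norm_mult)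
  also have "\<dots> \<le> a + norm z"
    using assms by (intro add_mono) (auto intro: mult_left_le_one_le)
  finally show ?thesis .
qed

text \<open>One bound for all \<open>t\<close> in the unit interval: it is the dominant under which
  the derivative is taken to the limit as \<open>t\<close> tends to 0.\<close>

lemma Re_powr_grad_mult_le:
  assumes q: "1 < q" and "norm y \<le> a" "0 \<le> t" "t \<le> 1"
  shows "\<bar>Re (powr_grad q (y + complex_of_real t * z) * z)\<bar> \<le> (a + norm z) powr q"
proof -
  have y: "norm (y + complex_of_real t * z) \<le> a + norm z"
    using assms by (intro norm_add_scaled_le)
  have a: "0 \<le> a" using assms(2) norm_ge_zero order_trans by blast
  have "\<bar>Re (powr_grad q (y + complex_of_real t * z) * z)\<bar> \<le> norm (y + complex_of_real t * z) powr (q - 1) * norm z"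
    using abs_Re_le_cmod[of "powr_grad q (y + complex_of_real t * z) * z"] by (simp add: norm_mult norm_powr_grad)
  also have "\<dots> \<le> (a + norm z) powr (q - 1) * (a + norm z) powr 1"
    using y q a by (intro mult_mono powr_mono2) auto
  also have "\<dots> = (a + norm z) powr q" by (subst powr_add[symmetric]) simp
  finally show ?thesis .
qed

text \<open>The representing function is the derivative \<open>\<bar>v\<bar>\<^sup>q\<^sup>-\<^sup>2 cnj v\<close> of the strictly convex
  functional \<open>w \<mapsto> \<integral>\<bar>w\<bar>\<^sup>q / q\<close> at the minimiser of \<open>\<integral>\<bar>w\<bar>\<^sup>q / q - c\<close>, so neither duality of
  the Lebesgue spaces nor the Hahn-Banach theorem is needed.  The functional is given by its
  graph \<open>P\<close>; that \<open>c\<close> depends only on \<open>w\<close> is a consequence of the bound.\<close>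
lemma Lq_functional_representation:
  fixes P :: "(('a \<Rightarrow> complex) \<times> real) set"
  assumes q: "1 < q"
    and ne: "P \<noteq> {}"
    and meas: "\<And>w c. (w, c) \<in> P \<Longrightarrow> w \<in> borel_measurable M"
    and int: "\<And>w c. (w, c) \<in> P \<Longrightarrow> integrable M (\<lambda>x. norm (w x) powr q)"
    and add: "\<And>w c w' c'. (w, c) \<in> P \<Longrightarrow> (w', c') \<in> P \<Longrightarrow> ((\<lambda>x. w x + w' x), c + c') \<in> P"
    and scale: "\<And>w c t. (w, c) \<in> P \<Longrightarrow> ((\<lambda>x. complex_of_real t * w x), t * c) \<in> P"
    and bound: "\<And>w c. (w, c) \<in> P \<Longrightarrow> c \<le> K + (\<integral>x. norm (w x) powr q \<partial>M) / q"
  obtains u where "Lp M (q / (q - 1)) u"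
    "\<And>w c. (w, c) \<in> P \<Longrightarrow> (\<integral>x. Re (u x * w x) \<partial>M) = c"
proof -
  define I where "I w = (\<integral>x. norm (w x) powr q \<partial>M)" for w :: "'a \<Rightarrow> complex"
  define J where "J z = I (fst z) / q - snd z" for z :: "('a \<Rightarrow> complex) \<times> real"
  define m where "m = Inf (J ` P)"
  have Inn: "0 \<le> I w" for w by (simp add: I_def)
  have Iscale: "I (\<lambda>x. complex_of_real t * w x) = \<bar>t\<bar> powr q * I w" for t w
    by (simp add: I_def norm_mult powr_mult)
  have boundI: "c \<le> K + I w / q" if "(w, c) \<in> P" for w c
    using bound[OF that] by (simp add: I_def)
  have bdd: "bdd_below (J ` P)"
    by (rule bdd_belowI2[of _ "- K"]) (use bound in \<open>force simp: J_def I_def\<close>)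
  have mle: "m \<le> J z" if "z \<in> P" for z
    unfolding m_def using bdd that by (rule cINF_lower)
  \<comment> \<open>Since \<open>q > 1\<close>, halving \<open>w\<close> shrinks \<open>I\<close> by
    more than a factor 2 while \<open>c\<close> is exactly halved. The hypothesis
    \<open>bound\<close> at \<open>w / 2\<close> therefore makes \<open>J\<close> coercive, and
    minimising sequences have bounded energy.\<close>
  have half: "(1/2::real) powr q < 1/2"
    using powr_less_mono'[of "1/2" 1 q] q by simp
  have Ibound: "((1/2) - (1/2) powr q) * I w \<le> q * (J (w, c) + 2 * K) / 2" if "(w, c) \<in> P" for w c
  proof -
    have "(1/2) * c \<le> K + (1/2) powr q * I w / q"
      using boundI[OF scale[OF that, of "1/2"]] unfolding Iscale by simp
    then have "q * c / 2 \<le> q * K + (1/2) powr q * I w"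
      using q by (simp add: field_simps)
    then show ?thesis using q by (simp add: J_def algebra_simps)
  qed
  have "\<exists>z\<in>P. J z < m + 1 / Suc n" for n
    using cInf_lessD[of "J ` P" "m + 1 / Suc n"] ne by (auto simp: m_def)
  then obtain z where zP: "\<And>n. z n \<in> P" and zJ: "\<And>n. J (z n) < m + 1 / Suc n" by metis
  define w where "w n = fst (z n)" for n
  define c where "c n = snd (z n)" for n
  have wc: "(w n, c n) \<in> P" for n using zP[of n] by (simp add: w_def c_def)
  have wJ: "J (w n, c n) < m + 1 / Suc n" for n using zJ[of n] by (simp add: w_def c_def)
  define B where "B = (q * (m + 1 + 2 * K) / 2) / ((1/2) - (1/2) powr q)"
  have IB: "I (w n) \<le> B" for n
  proof -
    have "1 / real (Suc n) \<le> 1" by simp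
    then have "J (w n, c n) \<le> m + 1" using wJ[of n] by linarith
    then have "q * (J (w n, c n) + 2 * K) / 2 \<le> q * (m + 1 + 2 * K) / 2"
      using q by simp
    then have "((1/2) - (1/2) powr q) * I (w n) \<le> q * (m + 1 + 2 * K) / 2"
      using Ibound[OF wc[of n]] by linarith
    then show ?thesis unfolding B_def using half by (subst pos_le_divide_eq) (simp, simp only: mult.commute)
  qed
  have diffP: "((\<lambda>x. w x - w' x), c - c') \<in> P" if "(w, c) \<in> P" "(w', c') \<in> P" for w w' c c'
    using add[OF that(1) scale[OF that(2), of "-1"]] by simp
  \<comment> \<open>The midpoint is again in \<open>P\<close>, so its \<open>J\<close> is at least
    \<open>m\<close>; the linear parts \<open>c\<close> cancel and the convexity gap of
    \<open>I\<close> remains.\<close>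
  have mid: "I (w k) + I (w l) - 2 * I (\<lambda>x. (w k x + w l x) / 2) \<le> q * (1 / Suc k + 1 / Suc l)" for k l
  proof -
    have "((\<lambda>x. (w k x + w l x) / 2), (c k + c l) / 2) \<in> P"
      using scale[OF add[OF wc[of k] wc[of l]], of "1/2"] by (simp add: field_simps)
    from mle[OF this] have "m \<le> I (\<lambda>x. (w k x + w l x) / 2) / q - (c k + c l) / 2" by (simp add: J_def)
    then have "(I (w k) + I (w l) - 2 * I (\<lambda>x. (w k x + w l x) / 2)) / q \<le> 1 / Suc k + 1 / Suc l"
      using wJ[of k] wJ[of l] by (simp add: J_def diff_divide_distrib add_divide_distrib del: of_nat_Suc)
    then show ?thesis using q by (simp add: pos_divide_le_eq mult.commute del: of_nat_Suc)
  qed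
  have Cauchy: "\<exists>N. \<forall>k\<ge>N. \<forall>l\<ge>N. I (\<lambda>x. w k x - w l x) \<le> e" if e: "0 < e" for e
  proof -
    have B0: "0 \<le> B" using IB[of 0] Inn[of "w 0"] by linarith
    \<comment> \<open>Both energies are at most \<open>B\<close>, so the \<open>\<delta>\<close>
      term costs at most \<open>e / 2\<close>; the \<open>+ 1\<close> covers
      \<open>B = 0\<close>.\<close>
    define \<delta> where "\<delta> = e / (4 * (B + 1))"
    have \<delta>: "0 < \<delta>" using e B0 by (simp add: \<delta>_def)
    have \<delta>B: "\<delta> * (2 * B) \<le> e / 2"
    proof -
      have "\<delta> * (2 * B) \<le> \<delta> * (2 * (B + 1))" using \<delta> by simp
      also have "\<dots> = e / 2" using B0 by (simp add: \<delta>_def field_simps)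
      finally show ?thesis .
    qed
    obtain L where L: "0 \<le> L" "\<And>a b::complex. norm (a - b) powr q \<le> \<delta> * (norm a powr q + norm b powr q)
        + L * (norm a powr q + norm b powr q - 2 * norm ((a + b) / 2) powr q)"
      using norm_powr_uniformly_convex[OF q \<delta>] by blast
    have *: "I (\<lambda>x. w k x - w l x) \<le> e / 2 + L * q * (1 / Suc k + 1 / Suc l)" for k l
    proof -
      have P1: "((\<lambda>x. (w k x + w l x) / 2), (c k + c l) / 2) \<in> P"
        using scale[OF add[OF wc[of k] wc[of l]], of "1/2"] by (simp add: field_simps)
      note i = int[OF wc[of k]] int[OF wc[of l]] int[OF P1] int[OF diffP[OF wc[of k] wc[of l]]]
      have "I (\<lambda>x. w k x - w l x) \<le> (\<integral>x. \<delta> * (norm (w k x) powr q + norm (w l x) powr q) +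
        L * (norm (w k x) powr q + norm (w l x) powr q - 2 * norm ((w k x + w l x) / 2) powr q) \<partial>M)"
        unfolding I_def using i L(2)
        by (intro integral_mono Bochner_Integration.integrable_add Bochner_Integration.integrable_diff integrable_mult_right) auto
      also have "\<dots> = \<delta> * (I (w k) + I (w l)) + L * (I (w k) + I (w l) - 2 * I (\<lambda>x. (w k x + w l x) / 2))"
        unfolding I_def using i by simp
      also have "\<dots> \<le> \<delta> * (2 * B) + L * (q * (1 / Suc k + 1 / Suc l))"
        using IB[of k] IB[of l] mid[of k l] L(1) \<delta> by (intro add_mono mult_left_mono) auto
      finally show ?thesis using \<delta>B by (simp add: mult.assoc)
    qed
    have "(\<lambda>k. 2 * L * q * (1 / Suc k)) \<longlonglongrightarrow> 2 * L * q * 0"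
      by (intro tendsto_mult tendsto_const LIMSEQ_Suc lim_1_over_n)
    then have "eventually (\<lambda>k. 2 * L * q * (1 / Suc k) < e / 2) sequentially"
      using e by (intro order_tendstoD(2)) auto
    then obtain N where N: "2 * L * q * (1 / Suc N) < e / 2" by (auto simp: eventually_sequentially)
    have "I (\<lambda>x. w k x - w l x) \<le> e" if "N \<le> k" "N \<le> l" for k l
    proof -
      have "1 / Suc k \<le> 1 / Suc N" "1 / Suc l \<le> 1 / Suc N" using that by (simp_all add: frac_le)
      then have "L * q * (1 / Suc k + 1 / Suc l) \<le> L * q * (1 / Suc N + 1 / Suc N)"
        using L(1) q by (intro mult_left_mono add_mono) auto
      also have "\<dots> = 2 * L * q * (1 / Suc N)" by simp
      also have "\<dots> < e / 2" by (rule N)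
      finally show ?thesis using *[of k l] by linarith
    qed
    then show ?thesis by blast
  qed
  have "\<exists>N. \<forall>i. \<forall>k\<ge>N i. \<forall>l\<ge>N i. I (\<lambda>x. w k x - w l x) \<le> (1/2) ^ i * ((1/2) ^ i) powr q"
    by (rule choice) (auto intro!: Cauchy)
  then obtain N where N: "\<And>i k l. N i \<le> k \<Longrightarrow> N i \<le> l \<Longrightarrow> I (\<lambda>x. w k x - w l x) \<le> (1/2) ^ i * ((1/2) ^ i) powr q"
    by blast
  \<comment> \<open>Partial sums of \<open>Suc (N i)\<close> are monotone, dominate each
    \<open>N k\<close> and are at least \<open>k\<close>, so the Cauchy rate and the minimising rate
    both carry over to \<open>v\<close>.\<close>
  define r where "r k = (\<Sum>i\<le>k. Suc (N i))" for k
  have r1: "N k \<le> r k" for k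
    unfolding r_def by (rule order_trans[OF _ member_le_sum[of k]]) auto
  have r2: "r k \<le> r (Suc k)" for k by (simp add: r_def)
  have r3: "k \<le> r k" for k by (induction k) (auto simp: r_def)
  define v where "v k = w (r k)" for k
  define cv where "cv k = c (r k)" for k
  have vc: "(v k, cv k) \<in> P" for k unfolding v_def cv_def by (rule wc)
  have vJ: "J (v k, cv k) < m + 1 / Suc k" for k
  proof -
    have "1 / real (Suc (r k)) \<le> 1 / real (Suc k)" using r3[of k] by (intro frac_le) auto
    then show ?thesis using wJ[of "r k"] unfolding v_def cv_def by linarith
  qed
  have [measurable]: "v k \<in> borel_measurable M" for k by (rule meas[OF vc])
  obtain V W where [measurable]: "V \<in> borel_measurable M" "W \<in> borel_measurable M" and W0: "\<And>x. 0 \<le> W x"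
    and Wint: "integrable M (\<lambda>x. W x powr q)" and VL: "AE x in M. (\<lambda>k. v k x) \<longlonglongrightarrow> V x"
    and vW: "AE x in M. \<forall>k. norm (v k x) \<le> W x"
  proof (rule Lq_rapid_Cauchy_dominated[OF q, of v M])
    show "integrable M (\<lambda>x. norm (v k x) powr q)" for k by (rule int[OF vc])
    show "integrable M (\<lambda>x. norm (v (Suc k) x - v k x) powr q)" for k
      by (rule int[OF diffP[OF vc vc]])
    show "(\<integral>x. norm (v (Suc k) x - v k x) powr q \<partial>M) \<le> (1/2) ^ k * ((1/2) ^ k) powr q" for k
      using N[of k "r (Suc k)" "r k"] r1[of k] r2[of k] by (simp add: I_def v_def)
  qed auto
  have VW: "AE x in M. norm (V x) \<le> W x"
    using VL vW by eventually_elim (auto intro: LIMSEQ_le_const2[OF tendsto_norm])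
  define u where "u x = powr_grad q (V x)" for x
  have [measurable]: "powr_grad q \<in> borel_measurable borel"
    using q by (intro borel_measurable_continuous_onI continuous_on_powr_grad)
  have um [measurable]: "u \<in> borel_measurable M" unfolding u_def by measurable
  \<comment> \<open>The limit \<open>V\<close> need not belong to the domain of \<open>P\<close>.
    Minimality is therefore tested at \<open>v k\<close> in direction \<open>w'\<close> and passed
    to the limit afterwards, first in \<open>k\<close>, then in \<open>t\<close>.\<close>
  have ineq: "c' \<le> (\<integral>x. Re (u x * w' x) \<partial>M)" if P': "(w', c') \<in> P" for w' c'
  proof -
    have [measurable]: "w' \<in> borel_measurable M" by (rule meas[OF P'])
    define G where "G x = (W x + norm (w' x)) powr q" for x
    have Gint: "integrable M G"
      using integrable_norm_add_powr[of q W M "\<lambda>x. norm (w' x)"] q Wint int[OF P'] W0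
      by (simp add: G_def[abs_def])
    have sc: "(\<lambda>k. I (\<lambda>x. v k x + complex_of_real t * w' x)) \<longlonglongrightarrow> I (\<lambda>x. V x + complex_of_real t * w' x)"
      if t: "0 \<le> t" "t \<le> 1" for t
      unfolding I_def
    proof (rule integral_dominated_convergence[where w = G])
      show "integrable M G" by (rule Gint)
      show "AE x in M. (\<lambda>k. norm (v k x + complex_of_real t * w' x) powr q) \<longlonglongrightarrow> norm (V x + complex_of_real t * w' x) powr q"
        using VL by eventually_elim (use q in \<open>intro tendsto_powr' tendsto_intros, auto\<close>)
      show "AE x in M. norm (norm (v k x + complex_of_real t * w' x) powr q) \<le> G x" for k
        using vW
      proof eventually_elim
        case (elim x)
        then show ?case unfolding G_def using q t by (simp add: powr_mono2 norm_add_scaled_le)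
      qed
    qed measurable
    \<comment> \<open>The tangent inequality is taken at the displaced point
      \<open>V + t w'\<close>, which bounds the increment of the energy from above by
      \<open>t\<close> times a derivative.\<close>
    have key: "c' \<le> (\<integral>x. Re (powr_grad q (V x + complex_of_real t * w' x) * w' x) \<partial>M)"
      if t: "0 < t" "t \<le> 1" for t
    proof -
      \<comment> \<open>The zero multiple in the second integral keeps it in the shape covered by
        \<open>sc\<close>.\<close>
      have "t * c' \<le> (I (\<lambda>x. v k x + complex_of_real t * w' x) - I (\<lambda>x. v k x + complex_of_real 0 * w' x)) / q + 1 / Suc k" for k
        using mle[OF add[OF vc[of k] scale[OF P', of t]]] vJ[of k]
        by (simp add: J_def diff_divide_distrib)
      moreover have "(\<lambda>k. (I (\<lambda>x. v k x + complex_of_real t * w' x) - I (\<lambda>x. v k x + complex_of_real 0 * w' x)) / q + 1 / Suc k)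
        \<longlonglongrightarrow> (I (\<lambda>x. V x + complex_of_real t * w' x) - I (\<lambda>x. V x + complex_of_real 0 * w' x)) / q + 0"
        using t q by (intro tendsto_intros sc LIMSEQ_Suc[OF lim_1_over_n]) auto
      ultimately have "t * c' \<le> (I (\<lambda>x. V x + complex_of_real t * w' x) - I (\<lambda>x. V x + complex_of_real 0 * w' x)) / q + 0"
        by (intro LIMSEQ_le_const) auto
      then have 1: "t * c' \<le> (I (\<lambda>x. V x + complex_of_real t * w' x) - I V) / q" by simp
      have i1: "integrable M (\<lambda>x. norm (V x + complex_of_real s * w' x) powr q)" if "0 \<le> s" "s \<le> 1" for s
        using Gint
      proof (rule Bochner_Integration.integrable_bound)
        show "AE x in M. norm (norm (V x + complex_of_real s * w' x) powr q) \<le> norm (G x)"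
          using VW
        proof eventually_elim
          case (elim x)
          then show ?case unfolding G_def using q that by (simp add: powr_mono2 norm_add_scaled_le)
        qed
      qed measurable
      have i2: "integrable M (\<lambda>x. norm (V x) powr q)" using i1[of 0] by simp
      have i3: "integrable M (\<lambda>x. Re (powr_grad q (V x + complex_of_real t * w' x) * w' x))"
        using Gint
      proof (rule Bochner_Integration.integrable_bound)
        show "AE x in M. norm (Re (powr_grad q (V x + complex_of_real t * w' x) * w' x)) \<le> norm (G x)"
          using VW
          by eventually_elim (use q t in \<open>simp add: G_def Re_powr_grad_mult_le del: times_complex.sel\<close>)
      qed measurable
      have "(I (\<lambda>x. V x + complex_of_real t * w' x) - I V) / q =
          (\<integral>x. (norm (V x + complex_of_real t * w' x) powr q - norm (V x) powr q) / q \<partial>M)"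
        unfolding I_def using i1[of t] t i2 by simp
      also have "\<dots> \<le> (\<integral>x. t * Re (powr_grad q (V x + complex_of_real t * w' x) * w' x) \<partial>M)"
      proof (rule integral_mono)
        show "(norm (V x + complex_of_real t * w' x) powr q - norm (V x) powr q) / q
           \<le> t * Re (powr_grad q (V x + complex_of_real t * w' x) * w' x)" for x
          using powr_grad_le[OF q, of "V x + complex_of_real t * w' x" "V x"]
          by (simp add: diff_divide_distrib algebra_simps)
      qed (use i1[of t] i2 i3 t in auto)
      finally have "t * c' \<le> t * (\<integral>x. Re (powr_grad q (V x + complex_of_real t * w' x) * w' x) \<partial>M)"
        using 1 by simp
      then show ?thesis using t by simp
    qed
    have "(\<lambda>n. \<integral>x. Re (powr_grad q (V x + complex_of_real (1 / Suc n) * w' x) * w' x) \<partial>M) \<longlonglongrightarrow> (\<integral>x. Re (u x * w' x) \<partial>M)"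
    proof (rule integral_dominated_convergence[where w = G])
      show "integrable M G" by (rule Gint)
      show "AE x in M. (\<lambda>n. Re (powr_grad q (V x + complex_of_real (1 / Suc n) * w' x) * w' x)) \<longlonglongrightarrow> Re (u x * w' x)"
      proof (rule AE_I2)
        fix x
        have "(\<lambda>n. V x + complex_of_real (1 / Suc n) * w' x) \<longlonglongrightarrow> V x + complex_of_real 0 * w' x"
          by (intro tendsto_intros LIMSEQ_Suc[OF lim_1_over_n])
        then have "(\<lambda>n. powr_grad q (V x + complex_of_real (1 / Suc n) * w' x)) \<longlonglongrightarrow> powr_grad q (V x)"
          by (intro isCont_tendsto_compose[OF isCont_powr_grad[OF q]]) simp
        then show "(\<lambda>n. Re (powr_grad q (V x + complex_of_real (1 / Suc n) * w' x) * w' x)) \<longlonglongrightarrow> Re (u x * w' x)"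
          unfolding u_def by (intro tendsto_Re tendsto_mult tendsto_const)
      qed
      show "AE x in M. norm (Re (powr_grad q (V x + complex_of_real (1 / Suc n) * w' x) * w' x)) \<le> G x" for n
        using VW
      proof eventually_elim
        case (elim x)
        then show ?case unfolding G_def real_norm_def by (intro Re_powr_grad_mult_le q) auto
      qed
    qed measurable
    then show ?thesis
      by (rule LIMSEQ_le_const) (intro exI[of _ 0] allI impI key, simp_all)
  qed
  show thesis
  proof (rule that[of u])
    have "norm (u x) powr (q / (q - 1)) = norm (V x) powr q" for x
      using q by (simp add: u_def norm_powr_grad powr_powr)
    moreover have "integrable M (\<lambda>x. norm (V x) powr q)"
      using Wint by (rule Bochner_Integration.integrable_bound)
        (use VW q in \<open>auto elim!: eventually_mono intro: powr_mono2\<close>)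
    ultimately show "Lp M (q / (q - 1)) u" by (simp add: Lp_def um)
    show "(\<integral>x. Re (u x * w' x) \<partial>M) = c'" if "(w', c') \<in> P" for w' c'
    proof -
      \<comment> \<open>The inequality for \<open>- w'\<close> is the reverse inequality for
        \<open>w'\<close>.\<close>
      have "(\<lambda>x. Re (u x * (complex_of_real (- 1) * w' x))) = (\<lambda>x. - Re (u x * w' x))" by auto
      then show ?thesis
        using ineq[OF that] ineq[OF scale[OF that, of "-1"]] by (simp del: times_complex.sel)
    qed
  qed
qed

section \<open>Characters of algebras of bounded continuous functions\<close>

lemma norm_apply_bcontfun_le: "norm (apply_bcontfun u y) \<le> norm u"
  using dist_bounded[of u y 0] by (simp add: dist_norm)

locale selfadjoint_algebra =
  fixes A :: "('x::metric_space \<Rightarrow>\<^sub>C complex) set"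
  assumes closed: "closed A"
    and const: "const_bcontfun c \<in> A"
    and add: "u \<in> A \<Longrightarrow> v \<in> A \<Longrightarrow> u + v \<in> A"
    and ex_scale: "u \<in> A \<Longrightarrow> \<exists>w\<in>A. \<forall>y. apply_bcontfun w y = c * apply_bcontfun u y"
    and ex_mult: "u \<in> A \<Longrightarrow> v \<in> A \<Longrightarrow> \<exists>w\<in>A. \<forall>y. apply_bcontfun w y = apply_bcontfun u y * apply_bcontfun v y"
    and ex_cnj: "u \<in> A \<Longrightarrow> \<exists>w\<in>A. \<forall>y. apply_bcontfun w y = cnj (apply_bcontfun u y)"
begin

lemma zero: "0 \<in> A"
proof -
  have "const_bcontfun 0 = (0 :: 'x \<Rightarrow>\<^sub>C complex)"
    by (rule bcontfun_eqI) (simp add: const_bcontfun.rep_eq)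
  then show ?thesis using const[of 0] by metis
qed

lemma scaleR: "u \<in> A \<Longrightarrow> t *\<^sub>R u \<in> A"
proof -
  assume "u \<in> A"
  then obtain w where w: "w \<in> A" "\<And>y. apply_bcontfun w y = complex_of_real t * apply_bcontfun u y"
    using ex_scale[of u "complex_of_real t"] by blast
  then have "w = t *\<^sub>R u"
    by (intro bcontfun_eqI) (simp add: scaleR_bcontfun.rep_eq scaleR_conv_of_real)
  then show ?thesis using w(1) by simp
qed

lemma diff: "u \<in> A \<Longrightarrow> v \<in> A \<Longrightarrow> u - v \<in> A"
  using add[OF _ scaleR[of v "-1"], of u] by simp

text \<open>Closedness of \<open>A\<close> in terms of values: it supplies the sum of the geometric
  series in \<open>norm_s_le\<close> and the powers in \<open>norm_powr_mem\<close>.\<close>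

lemma uniform_limit_mem:
  assumes "\<And>e. 0 < e \<Longrightarrow> \<exists>w\<in>A. \<forall>y. norm (apply_bcontfun w y - f y) \<le> e"
  obtains w where "w \<in> A" "\<And>y. apply_bcontfun w y = f y"
proof -
  have "\<exists>w\<in>A. \<forall>y. norm (apply_bcontfun w y - f y) \<le> 1 / Suc n" for n
    by (rule assms) simp
  then obtain w where w: "\<And>n. w n \<in> A" and wf: "\<And>n y. norm (apply_bcontfun (w n) y - f y) \<le> 1 / Suc n" by metis
  have "uniform_limit UNIV (\<lambda>n. apply_bcontfun (w n)) f sequentially"
  proof (rule uniform_limitI)
    fix e :: real assume "0 < e"
    then have "eventually (\<lambda>n. 1 / real (Suc n) < e) sequentially"
      by (intro order_tendstoD(2)[OF LIMSEQ_Suc[OF lim_1_over_n]])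
    then show "\<forall>\<^sub>F n in sequentially. \<forall>x\<in>UNIV. dist (apply_bcontfun (w n) x) (f x) < e"
      by eventually_elim (auto simp: dist_norm intro: le_less_trans[OF wf])
  qed
  then obtain l where l: "f = apply_bcontfun l" "w \<longlonglongrightarrow> l"
    by (rule uniform_limit_bcontfunE) auto
  have "l \<in> A" using closed w l(2) unfolding closed_sequential_limits by blast
  then show thesis using l(1) that[of l] by simp
qed

text \<open>For \<open>u\<close> in \<open>A\<close> the choice is unique, elements being determined
  by their values. A function, rather than a mere witness, lets complex multiples of
  \<open>A\<close>-valued maps be formed pointwise.\<close>

definition scale :: "complex \<Rightarrow> ('x \<Rightarrow>\<^sub>C complex) \<Rightarrow> 'x \<Rightarrow>\<^sub>C complex" where
  "scale c u = (SOME w. w \<in> A \<and> (\<forall>y. apply_bcontfun w y = c * apply_bcontfun u y))"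

lemma scale:
  assumes "u \<in> A"
  shows scale_mem: "scale c u \<in> A" and apply_scale: "apply_bcontfun (scale c u) y = c * apply_bcontfun u y"
  using someI_ex[of "\<lambda>w. w \<in> A \<and> (\<forall>y. apply_bcontfun w y = c * apply_bcontfun u y)"] ex_scale[OF assms]
  unfolding scale_def by blast+

end

locale spectrum_char = selfadjoint_algebra +
  fixes s
  assumes s: "s \<in> spectrum_set A"
begin

lemma s_add: "u \<in> A \<Longrightarrow> v \<in> A \<Longrightarrow> s (u + v) = s u + s v"
  using s unfolding spectrum_set_def by blast

lemma s_scale: "u \<in> A \<Longrightarrow> w \<in> A \<Longrightarrow> (\<And>y. apply_bcontfun w y = c * apply_bcontfun u y) \<Longrightarrow> s w = c * s u"
  using s unfolding spectrum_set_def by blast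

lemma s_mult: "u \<in> A \<Longrightarrow> v \<in> A \<Longrightarrow> w \<in> A \<Longrightarrow>
    (\<And>y. apply_bcontfun w y = apply_bcontfun u y * apply_bcontfun v y) \<Longrightarrow> s w = s u * s v"
  using s unfolding spectrum_set_def by blast

lemma s_scaleR: "u \<in> A \<Longrightarrow> s (t *\<^sub>R u) = complex_of_real t * s u"
  by (rule s_scale) (auto simp: scaleR scaleR_bcontfun.rep_eq scaleR_conv_of_real)

lemma s_diff: "u \<in> A \<Longrightarrow> v \<in> A \<Longrightarrow> s (u - v) = s u - s v"
  using s_add[OF _ scaleR[of v "-1"], of u] s_scaleR[of v "-1"] by simp

lemma s_zero: "s 0 = 0"
  using s_scaleR[OF zero, of 0] by simp

lemma s_one: "s (const_bcontfun 1) = 1"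
proof -
  obtain u where u: "u \<in> A" "s u \<noteq> 0" using s unfolding spectrum_set_def by blast
  have "s u = s (const_bcontfun 1) * s u"
    by (rule s_mult[OF const u(1) u(1)]) (simp add: const_bcontfun.rep_eq)
  then show ?thesis using u(2) by simp
qed

lemma s_const: "s (const_bcontfun c) = c"
  using s_scale[OF const[of 1] const[of c], of c] by (simp add: const_bcontfun.rep_eq s_one)

text \<open>If \<open>s u = 1\<close> and \<open>\<parallel>u\<parallel> < 1\<close> then \<open>v = u / (1 - u)\<close> would give \<open>s v = 1 + s v\<close>.\<close>
lemma norm_s_le:
  assumes u: "u \<in> A" shows "norm (s u) \<le> norm u"
proof (rule ccontr)
  assume "\<not> norm (s u) \<le> norm u"
  then have lt: "norm u < norm (s u)" and s0: "s u \<noteq> 0" by auto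
  define a where "a = scale (1 / s u) u"
  have a: "a \<in> A" unfolding a_def by (rule scale_mem[OF u])
  have ay: "apply_bcontfun a y = apply_bcontfun u y / s u" for y
    unfolding a_def by (simp add: apply_scale[OF u])
  have sa: "s a = 1" using s_scale[OF u a, of "1 / s u"] s0 by (simp add: ay)
  define r where "r = norm u / norm (s u)"
  have r: "0 \<le> r" "r < 1" using lt s0 by (auto simp: r_def)
  have an: "norm (apply_bcontfun a y) \<le> r" for y
    unfolding ay r_def norm_divide by (intro divide_right_mono norm_apply_bcontfun_le) simp
  have a1: "1 - r \<le> norm (1 - apply_bcontfun a y)" for y
    using norm_triangle_ineq2[of 1 "apply_bcontfun a y"] an[of y] by simp
  then have ne: "apply_bcontfun a y \<noteq> 1" for y using r by (metis diff_self norm_zero not_less diff_gt_0_iff_gt)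
  have partial: "\<exists>w\<in>A. \<forall>y. apply_bcontfun w y = (\<Sum>k<n. apply_bcontfun a y ^ Suc k)" for n
  proof (induction n)
    case 0 then show ?case using zero by (intro bexI[of _ 0]) auto
  next
    case (Suc n)
    then obtain w where w: "w \<in> A" "\<And>y. apply_bcontfun w y = (\<Sum>k<n. apply_bcontfun a y ^ Suc k)" by blast
    obtain w' where w': "w' \<in> A" "\<And>y. apply_bcontfun w' y = apply_bcontfun w y * apply_bcontfun a y"
      using ex_mult[OF w(1) a] by blast
    have "apply_bcontfun (w' + a) y = (\<Sum>k<Suc n. apply_bcontfun a y ^ Suc k)" for y
      unfolding plus_bcontfun.rep_eq w'(2) w(2) sum.lessThan_Suc_shift by (simp add: sum_distrib_left mult.commute)
    then show ?case using add[OF w'(1) a] by blast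
  qed
  \<comment> \<open>The geometric series from its first power on converges uniformly, because
    \<open>norm (1 - apply_bcontfun a y)\<close> is at least \<open>1 - r\<close>; hence its sum
    \<open>a / (1 - a)\<close> belongs to the algebra.\<close>
  obtain v where v: "v \<in> A" "\<And>y. apply_bcontfun v y = apply_bcontfun a y / (1 - apply_bcontfun a y)"
  proof (rule uniform_limit_mem[of "\<lambda>y. apply_bcontfun a y / (1 - apply_bcontfun a y)"])
    fix e :: real assume e: "0 < e"
    have "(\<lambda>n. r ^ Suc n / (1 - r)) \<longlonglongrightarrow> 0 / (1 - r)"
      using r by (intro tendsto_divide tendsto_const LIMSEQ_Suc LIMSEQ_power_zero) auto
    then have "eventually (\<lambda>n. r ^ Suc n / (1 - r) < e) sequentially"
      using e by (intro order_tendstoD(2)) auto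
    then obtain n where n: "r ^ Suc n / (1 - r) < e" by (auto simp: eventually_sequentially)
    obtain w where w: "w \<in> A" "\<And>y. apply_bcontfun w y = (\<Sum>k<n. apply_bcontfun a y ^ Suc k)" using partial by blast
    have "norm (apply_bcontfun w y - apply_bcontfun a y / (1 - apply_bcontfun a y)) \<le> e" for y
    proof -
      let ?z = "apply_bcontfun a y"
      have "(\<Sum>k<n. ?z ^ Suc k) = ?z * (\<Sum>k<n. ?z ^ k)" by (simp add: sum_distrib_left)
      also have "\<dots> = ?z * ((1 - ?z ^ n) / (1 - ?z))" using ne[of y] by (simp add: sum_gp_strict)
      finally have eq: "(\<Sum>k<n. ?z ^ Suc k) = ?z * ((1 - ?z ^ n) / (1 - ?z))" .
      have "apply_bcontfun w y - ?z / (1 - ?z) = - (?z ^ Suc n / (1 - ?z))"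
        unfolding w(2) eq by (simp add: right_diff_distrib diff_divide_distrib)
      then have "norm (apply_bcontfun w y - ?z / (1 - ?z)) = norm ?z ^ Suc n / norm (1 - ?z)"
        by (simp add: norm_divide norm_power norm_mult)
      also have "\<dots> \<le> r ^ Suc n / (1 - r)"
        using an[of y] a1[of y] r by (intro frac_le power_mono) auto
      finally show ?thesis using n by simp
    qed
    then show "\<exists>w\<in>A. \<forall>y. norm (apply_bcontfun w y - apply_bcontfun a y / (1 - apply_bcontfun a y)) \<le> e"
      using w(1) by blast
  qed blast
  have "s (v - a) = s v * s a"
  proof (rule s_mult[OF v(1) a diff[OF v(1) a]])
    show "apply_bcontfun (v - a) y = apply_bcontfun v y * apply_bcontfun a y" for y
      using ne[of y] by (simp add: minus_bcontfun.rep_eq v(2) field_simps)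
  qed
  then show False using s_diff[OF v(1) a] sa by simp
qed

lemma s_tendsto:
  assumes "w \<in> A" "0 < e" "w' \<in> A" "\<And>y. norm (apply_bcontfun w y - apply_bcontfun w' y) \<le> e"
  shows "norm (s w - s w') \<le> e"
proof -
  have "norm (s w - s w') \<le> norm (w - w')"
    using norm_s_le[OF diff[OF assms(1,3)]] s_diff[OF assms(1,3)] by simp
  also have "\<dots> \<le> e" unfolding dist_norm[symmetric] by (rule dist_bound) (simp add: dist_norm assms)
  finally show ?thesis .
qed

text \<open>Arens' argument: adding the constant \<open>\<i> * t\<close> to a real-valued
  \<open>u\<close> raises the bound on the squared sup norm only by \<open>t^2\<close>. After
  cancelling \<open>t^2\<close> a term linear in \<open>t\<close> stays bounded above for all real
  \<open>t\<close>, so its coefficient vanishes.\<close>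

lemma s_real:
  assumes u: "u \<in> A" and re: "\<And>y. Im (apply_bcontfun u y) = 0"
  shows "Im (s u) = 0"
proof -
  have *: "2 * Im (s u) * t \<le> (norm u)\<^sup>2" for t
  proof -
    have m: "u + const_bcontfun (\<i> * complex_of_real t) \<in> A" by (intro add u const)
    have "norm (s (u + const_bcontfun (\<i> * complex_of_real t))) \<le> sqrt ((norm u)\<^sup>2 + t\<^sup>2)"
    proof (rule order_trans[OF norm_s_le[OF m]])
      have "norm (u + const_bcontfun (\<i> * complex_of_real t)) = dist (u + const_bcontfun (\<i> * complex_of_real t)) 0"
        by simp
      also have "\<dots> \<le> sqrt ((norm u)\<^sup>2 + t\<^sup>2)"
      proof (rule dist_bound)
        fix y
        have "(Re (apply_bcontfun u y))\<^sup>2 \<le> (norm u)\<^sup>2"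
          using norm_apply_bcontfun_le[of u y] abs_Re_le_cmod[of "apply_bcontfun u y"]
          by (intro abs_le_square_iff[THEN iffD1]) simp
        then show "dist (apply_bcontfun (u + const_bcontfun (\<i> * complex_of_real t)) y) (apply_bcontfun 0 y) \<le> sqrt ((norm u)\<^sup>2 + t\<^sup>2)"
          by (simp add: dist_norm plus_bcontfun.rep_eq const_bcontfun.rep_eq cmod_def re)
      qed
      finally show "norm (u + const_bcontfun (\<i> * complex_of_real t)) \<le> sqrt ((norm u)\<^sup>2 + t\<^sup>2)" .
    qed
    then have "(norm (s u + \<i> * complex_of_real t))\<^sup>2 \<le> (norm u)\<^sup>2 + t\<^sup>2"
      unfolding s_add[OF u const] s_const by (intro sqrt_ge_absD) simp
    then have "(Re (s u))\<^sup>2 + (Im (s u))\<^sup>2 + 2 * Im (s u) * t \<le> (norm u)\<^sup>2"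
      by (simp add: cmod_power2 power2_sum)
    then show ?thesis using zero_le_power2[of "Re (s u)"] zero_le_power2[of "Im (s u)"] by linarith
  qed
  show ?thesis
  proof (rule ccontr)
    assume "Im (s u) \<noteq> 0"
    then show False using *[of "((norm u)\<^sup>2 + 1) / (2 * Im (s u))"] by simp
  qed
qed

text \<open>Both \<open>u + w\<close> and \<open>\<i> * (u - w)\<close> are real valued;
  \<open>s_real\<close> for these two gives the two components.\<close>

lemma s_cnj:
  assumes u: "u \<in> A" and w: "w \<in> A" "\<And>y. apply_bcontfun w y = cnj (apply_bcontfun u y)"
  shows "s w = cnj (s u)"
proof -
  have 1: "Im (s (u + w)) = 0"
    by (rule s_real[OF add[OF u w(1)]]) (simp add: plus_bcontfun.rep_eq w)
  have "Im (s (scale \<i> (u - w))) = 0"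
    by (rule s_real[OF scale_mem[OF diff[OF u w(1)]]])
      (simp add: apply_scale[OF diff[OF u w(1)]] minus_bcontfun.rep_eq w)
  moreover have "s (scale \<i> (u - w)) = \<i> * s (u - w)"
    by (rule s_scale[OF diff[OF u w(1)] scale_mem[OF diff[OF u w(1)]]])
      (simp add: apply_scale[OF diff[OF u w(1)]])
  ultimately have "Im (\<i> * (s u - s w)) = 0" using s_diff[OF u w(1)] by simp
  then show ?thesis using 1 s_add[OF u w(1)] by (simp add: complex_eq_iff)
qed

end

context selfadjoint_algebra begin

text \<open>The power is \<open>t powr (q / 2)\<close> at \<open>t = a * cnj a\<close>, and
  polynomials in that product stay in \<open>A\<close>. By \<open>norm_s_le\<close> the interval
  from 0 to \<open>(norm a)^2\<close> also contains the values at characters, so one Weierstrass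
  polynomial is accurate at points and at characters alike.\<close>

lemma norm_powr_mem:
  assumes a: "a \<in> A" and q: "0 < q"
  obtains b where "b \<in> A" "\<And>y. apply_bcontfun b y = complex_of_real (norm (apply_bcontfun a y) powr q)"
    "\<And>s. s \<in> spectrum_set A \<Longrightarrow> s b = complex_of_real (norm (s a) powr q)"
proof -
  obtain a' where a': "a' \<in> A" "\<And>y. apply_bcontfun a' y = cnj (apply_bcontfun a y)" using ex_cnj[OF a] by blast
  obtain d where d: "d \<in> A" "\<And>y. apply_bcontfun d y = apply_bcontfun a y * apply_bcontfun a' y"
    using ex_mult[OF a a'(1)] by blast
  have dy: "apply_bcontfun d y = complex_of_real ((norm (apply_bcontfun a y))\<^sup>2)" for y
    unfolding d(2) a'(2) complex_norm_square ..
  have sd: "s d = complex_of_real ((norm (s a))\<^sup>2)" if "s \<in> spectrum_set A" for s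
  proof -
    interpret spectrum_char A s by unfold_locales (rule that)
    show ?thesis using s_mult[OF a a'(1) d] s_cnj[OF a a'] by (simp add: complex_norm_square del: of_real_power)
  qed
  let ?R = "(norm a)\<^sup>2"
  let ?f = "\<lambda>t::real. t powr (q / 2)"
  have fsq: "?f ((norm z)\<^sup>2) = norm z powr q" for z :: complex
    by (cases "z = 0") (auto simp: powr_powr simp flip: powr_numeral)
  have poly: "\<exists>w\<in>A. (\<forall>y. apply_bcontfun w y = (\<Sum>i\<le>n. complex_of_real (c i) * apply_bcontfun d y ^ i)) \<and>
      (\<forall>s\<in>spectrum_set A. s w = (\<Sum>i\<le>n. complex_of_real (c i) * s d ^ i))" for c :: "nat \<Rightarrow> real" and n
  proof -
    have pw: "\<exists>w\<in>A. (\<forall>y. apply_bcontfun w y = apply_bcontfun d y ^ i) \<and> (\<forall>s\<in>spectrum_set A. s w = s d ^ i)" for i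
    proof (induction i)
      case 0
      have "s (const_bcontfun 1) = 1" if "s \<in> spectrum_set A" for s
      proof -
        interpret spectrum_char A s by unfold_locales (rule that)
        show ?thesis by (rule s_one)
      qed
      then show ?case using const[of 1] by (intro bexI[of _ "const_bcontfun 1"]) (auto simp: const_bcontfun.rep_eq)
    next
      case (Suc i)
      then obtain w where w: "w \<in> A" "\<And>y. apply_bcontfun w y = apply_bcontfun d y ^ i" "\<And>s. s \<in> spectrum_set A \<Longrightarrow> s w = s d ^ i" by blast
      obtain w' where w': "w' \<in> A" "\<And>y. apply_bcontfun w' y = apply_bcontfun d y * apply_bcontfun w y" using ex_mult[OF d(1) w(1)] by blast
      have "s w' = s d ^ Suc i" if "s \<in> spectrum_set A" for s
      proof -
        interpret spectrum_char A s by unfold_locales (rule that)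
        show ?thesis using s_mult[OF d(1) w(1) w'] w(3)[OF that] by simp
      qed
      then show ?case using w' w(2) by (intro bexI[of _ w']) auto
    qed
    have sc: "\<exists>w\<in>A. (\<forall>y. apply_bcontfun w y = complex_of_real (c i) * apply_bcontfun d y ^ i) \<and>
       (\<forall>s\<in>spectrum_set A. s w = complex_of_real (c i) * s d ^ i)" for i
    proof -
      obtain w where w: "w \<in> A" "\<And>y. apply_bcontfun w y = apply_bcontfun d y ^ i" "\<And>s. s \<in> spectrum_set A \<Longrightarrow> s w = s d ^ i"
        using pw[of i] by blast
      have "s (c i *\<^sub>R w) = complex_of_real (c i) * s d ^ i" if "s \<in> spectrum_set A" for s
      proof -
        interpret spectrum_char A s by unfold_locales (rule that)
        show ?thesis using s_scaleR[OF w(1)] w(3)[OF that] by simp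
      qed
      then show ?thesis using scaleR[OF w(1), of "c i"] w(2)
        by (intro bexI[of _ "c i *\<^sub>R w"]) (auto simp: scaleR_bcontfun.rep_eq scaleR_conv_of_real)
    qed
    show ?thesis
    proof (induction n)
      case 0 then show ?case using sc[of 0] by simp
    next
      case (Suc n)
      then obtain w where w: "w \<in> A" "\<And>y. apply_bcontfun w y = (\<Sum>i\<le>n. complex_of_real (c i) * apply_bcontfun d y ^ i)"
        "\<And>s. s \<in> spectrum_set A \<Longrightarrow> s w = (\<Sum>i\<le>n. complex_of_real (c i) * s d ^ i)" by blast
      obtain w' where w': "w' \<in> A" "\<And>y. apply_bcontfun w' y = complex_of_real (c (Suc n)) * apply_bcontfun d y ^ Suc n"
        "\<And>s. s \<in> spectrum_set A \<Longrightarrow> s w' = complex_of_real (c (Suc n)) * s d ^ Suc n" using sc[of "Suc n"] by blast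
      have "s (w + w') = (\<Sum>i\<le>Suc n. complex_of_real (c i) * s d ^ i)" if "s \<in> spectrum_set A" for s
      proof -
        interpret spectrum_char A s by unfold_locales (rule that)
        show ?thesis using s_add[OF w(1) w'(1)] w(3)[OF that] w'(3)[OF that] by simp
      qed
      then show ?case using add[OF w(1) w'(1)] w(2) w'(2)
        by (intro bexI[of _ "w + w'"]) (auto simp: plus_bcontfun.rep_eq)
    qed
  qed
  have approx: "\<exists>w\<in>A. (\<forall>y. norm (apply_bcontfun w y - complex_of_real (norm (apply_bcontfun a y) powr q)) \<le> e) \<and>
    (\<forall>s\<in>spectrum_set A. norm (s w - complex_of_real (norm (s a) powr q)) \<le> e)" if e: "0 < e" for e
  proof -
    have "continuous_on {0..?R} ?f" using q by (intro continuous_on_powr' continuous_intros) auto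
    then obtain g where g: "real_polynomial_function g" "\<And>t. t \<in> {0..?R} \<Longrightarrow> \<bar>?f t - g t\<bar> < e"
      using Stone_Weierstrass_real_polynomial_function[of "{0..?R}" ?f e] e by auto
    from g(1) obtain c n where gc: "g = (\<lambda>t. \<Sum>i\<le>n. c i * t ^ i)" by (auto simp: real_polynomial_function_iff_sum)
    obtain w where w: "w \<in> A" "\<And>y. apply_bcontfun w y = (\<Sum>i\<le>n. complex_of_real (c i) * apply_bcontfun d y ^ i)"
      "\<And>s. s \<in> spectrum_set A \<Longrightarrow> s w = (\<Sum>i\<le>n. complex_of_real (c i) * s d ^ i)" using poly[of c n] by blast
    \<comment> \<open>Stated for arbitrary \<open>z\<close> because it serves for the values of
      \<open>a\<close> and for \<open>s a\<close>.\<close>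
    have gz: "norm (complex_of_real (g ((norm z)\<^sup>2)) - complex_of_real (norm z powr q)) \<le> e" if "norm z \<le> norm a" for z :: complex
    proof -
      have "(norm z)\<^sup>2 \<in> {0..?R}" using that by (auto intro: power_mono)
      from g(2)[OF this] show ?thesis unfolding fsq of_real_diff[symmetric] norm_of_real by (simp add: abs_minus_commute)
    qed
    have wy: "apply_bcontfun w y = complex_of_real (g ((norm (apply_bcontfun a y))\<^sup>2))" for y
      unfolding w(2) dy gc by simp
    have sw: "s w = complex_of_real (g ((norm (s a))\<^sup>2))" if "s \<in> spectrum_set A" for s
      unfolding w(3)[OF that] sd[OF that] gc by simp
    have sle: "norm (s a) \<le> norm a" if "s \<in> spectrum_set A" for s
    proof -
      interpret spectrum_char A s by unfold_locales (rule that)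
      show ?thesis by (rule norm_s_le[OF a])
    qed
    show ?thesis
    proof (intro bexI[of _ w] conjI allI ballI)
      show "norm (apply_bcontfun w y - complex_of_real (norm (apply_bcontfun a y) powr q)) \<le> e" for y
        unfolding wy by (rule gz[OF norm_apply_bcontfun_le])
      show "norm (s w - complex_of_real (norm (s a) powr q)) \<le> e" if "s \<in> spectrum_set A" for s
        unfolding sw[OF that] by (rule gz[OF sle[OF that]])
    qed (rule w(1))
  qed
  obtain b where b: "b \<in> A" "\<And>y. apply_bcontfun b y = complex_of_real (norm (apply_bcontfun a y) powr q)"
    using uniform_limit_mem[of "\<lambda>y. complex_of_real (norm (apply_bcontfun a y) powr q)"] approx by blast
  have "s b = complex_of_real (norm (s a) powr q)" if sA: "s \<in> spectrum_set A" for s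
  proof -
    interpret spectrum_char A s by unfold_locales (rule sA)
    have "norm (s b - complex_of_real (norm (s a) powr q)) \<le> 0 + e" if e: "0 < e" for e
    proof -
      obtain w where w: "w \<in> A" "\<And>y. norm (apply_bcontfun w y - complex_of_real (norm (apply_bcontfun a y) powr q)) \<le> e / 2"
         "norm (s w - complex_of_real (norm (s a) powr q)) \<le> e / 2" using approx[of "e / 2"] e sA by auto
      have "norm (s b - s w) \<le> e / 2"
        using e w(2) by (intro s_tendsto b(1) w(1)) (auto simp: b(2) norm_minus_commute)
      then show ?thesis using w(3) norm_triangle_ineq[of "s b - s w" "s w - complex_of_real (norm (s a) powr q)"] by simp
    qed
    then have "norm (s b - complex_of_real (norm (s a) powr q)) \<le> 0" by (rule field_le_epsilon)
    then show ?thesis by simp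
  qed
  then show thesis using b that by blast
qed

end

section \<open>Approximation, pairings and diagonal subsequences\<close>

text \<open>Greedy choice: stage \<open>j + 1\<close> switches to \<open>d j\<close> exactly where
  this is strictly closer. Starting from 0, the error decreases, so it stays below
  \<open>norm (\<psi> x)\<close> without truncation. The ambient space is not assumed separable;
  measurability of the error is carried through the induction as that of a minimum of scalar
  functions.\<close>

lemma simple_function_approximation:
  fixes \<psi> :: "'a \<Rightarrow> 'b::real_normed_vector"
  assumes \<psi>: "\<psi> \<in> borel_measurable N" "\<And>x. x \<in> space N \<Longrightarrow> \<psi> x \<in> A"
    and A: "0 \<in> A" "countable D" "D \<subseteq> A" "A \<subseteq> closure D"
  shows "\<exists>g :: nat \<Rightarrow> 'a \<Rightarrow> 'b. (\<forall>j. simple_function N (g j)) \<and> (\<forall>j x. g j x \<in> A) \<and>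
    (\<forall>j. (\<lambda>x. norm (\<psi> x - g j x)) \<in> borel_measurable N) \<and>
    (\<forall>j x. norm (\<psi> x - g j x) \<le> norm (\<psi> x)) \<and>
    (\<forall>x\<in>space N. (\<lambda>j. norm (\<psi> x - g j x)) \<longlonglongrightarrow> 0)"
proof -
  have "D \<noteq> {}" using A by auto
  define d where "d = from_nat_into D"
  have d: "d j \<in> D" for j unfolding d_def by (rule from_nat_into) fact
  have dsurj: "\<exists>j. d j = b" if "b \<in> D" for b unfolding d_def using A(2) that by (metis from_nat_into_surj)
  define g where "g = rec_nat (\<lambda>x. 0) (\<lambda>j f x. if norm (\<psi> x - d j) < norm (\<psi> x - f x) then d j else f x)"
  have g0: "g 0 x = 0" for x by (simp add: g_def)
  have gS: "g (Suc j) x = (if norm (\<psi> x - d j) < norm (\<psi> x - g j x) then d j else g j x)" for j x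
    by (simp add: g_def)
  have nm: "(\<lambda>x. norm (\<psi> x - c)) \<in> borel_measurable N" for c
    by (rule measurable_compose[OF \<psi>(1)]) (intro borel_measurable_continuous_onI continuous_intros)
  have *: "simple_function N (g j) \<and> (\<lambda>x. norm (\<psi> x - g j x)) \<in> borel_measurable N" for j
  proof (induction j)
    case 0 then show ?case using nm[of 0] by (simp add: g0[abs_def])
  next
    case (Suc j)
    then have [measurable]: "(\<lambda>x. norm (\<psi> x - g j x)) \<in> borel_measurable N" by simp
    note [measurable] = nm
    have "simple_function N (\<lambda>x. if norm (\<psi> x - d j) < norm (\<psi> x - g j x) then d j else g j x)"
      using Suc by (intro simple_function_If) (auto intro!: simple_function_const)
    moreover have "(\<lambda>x. norm (\<psi> x - g (Suc j) x)) = (\<lambda>x. min (norm (\<psi> x - d j)) (norm (\<psi> x - g j x)))"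
      by (auto simp: gS fun_eq_iff)
    ultimately show ?case by (simp add: gS[abs_def])
  qed
  have le: "norm (\<psi> x - g (Suc j) x) \<le> norm (\<psi> x - g j x)" "norm (\<psi> x - g (Suc j) x) \<le> norm (\<psi> x - d j)" for j x
    by (auto simp: gS)
  have dec: "decseq (\<lambda>j. norm (\<psi> x - g j x))" for x by (rule decseq_SucI) (rule le)
  show ?thesis
  proof (intro exI[of _ g] conjI allI ballI)
    show "simple_function N (g j)" "(\<lambda>x. norm (\<psi> x - g j x)) \<in> borel_measurable N" for j using * by blast+
    show "g j x \<in> A" for j x by (induction j) (use A d in \<open>auto simp: g0 gS\<close>)
    show "norm (\<psi> x - g j x) \<le> norm (\<psi> x)" for j x using decseqD[OF dec, of 0 j] by (simp add: g0)
    show "(\<lambda>j. norm (\<psi> x - g j x)) \<longlonglongrightarrow> 0" if x: "x \<in> space N" for x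
    proof (rule LIMSEQ_I)
      fix e :: real assume e: "0 < e"
      obtain b where b: "b \<in> D" "dist b (\<psi> x) < e" using \<psi>(2)[OF x] A(4) e by (meson closure_approachable subsetD)
      obtain k where k: "d k = b" using dsurj b by blast
      have "norm (\<psi> x - g j x) < e" if "Suc k \<le> j" for j
        using decseqD[OF dec that, of x] le(2)[of x k] b k by (simp add: dist_norm norm_minus_commute)
      then show "\<exists>no. \<forall>n\<ge>no. norm (norm (\<psi> x - g n x) - 0) < e" by auto
    qed
  qed
qed

text \<open>The range of \<open>g\<close> is finite, so measurability of each \<open>f a\<close>
  separately is enough.\<close>

lemma simple_function_apply_measurable:
  assumes g: "simple_function N g" and I: "\<And>x. x \<in> space N \<Longrightarrow> g x \<in> A"
    and f: "\<And>a. a \<in> A \<Longrightarrow> f a \<in> borel_measurable M" and \<pi>: "\<pi> \<in> measurable M N"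
  shows "(\<lambda>z. f (g (\<pi> z)) z) \<in> borel_measurable M"
proof (rule measurable_compose_countable'[where I = "g ` space N"])
  show "f a \<in> borel_measurable M" if "a \<in> g ` space N" for a using that I f by auto
  have "g \<in> measurable N (count_space (g ` space N))"
    using g by (intro measurable_count_space_eq2[THEN iffD2]) (auto simp: simple_function_def)
  then show "(\<lambda>z. g (\<pi> z)) \<in> measurable M (count_space (g ` space N))"
    using \<pi> by (rule measurable_compose[rotated])
  show "countable (g ` space N)" using g by (auto simp: simple_function_def countable_finite)
qed

text \<open>Young's inequality for the product split as \<open>(\<eta> * a) * (b / \<eta>)\<close>.
  The free weight lets a small second factor outweigh a merely bounded first one, in the role of
  Hoelder's inequality.\<close>

lemma norm_mult_le_scaled_powr:
  fixes a b :: complex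
  assumes p: "1 < p" and \<eta>: "0 < \<eta>"
  shows "norm (a * b) \<le> \<eta> powr p * norm a powr p + (1 / \<eta>) powr (p / (p - 1)) * norm b powr (p / (p - 1))"
proof -
  let ?q = "p / (p - 1)"
  have q: "1 < ?q" using p by (simp add: field_simps)
  have div: "x / t \<le> x" if "0 \<le> x" "1 < t" for x t :: real
    using mult_left_mono[of 1 t x] that by (simp add: pos_divide_le_eq)
  have "norm (a * b) = (\<eta> * norm a) * ((1 / \<eta>) * norm b)" using \<eta> by (simp add: norm_mult)
  also have "\<dots> \<le> (\<eta> * norm a) powr p / p + ((1 / \<eta>) * norm b) powr ?q / ?q"
  proof (rule Youngs_inequality)
    show "1 / p + 1 / ?q = 1" using p by (simp add: field_simps)
  qed (use p q \<eta> in auto)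
  also have "\<dots> \<le> (\<eta> * norm a) powr p + ((1 / \<eta>) * norm b) powr ?q"
    by (intro add_mono div powr_ge_zero p q)
  also have "\<dots> = \<eta> powr p * norm a powr p + (1 / \<eta>) powr ?q * norm b powr ?q"
    by (simp only: powr_mult)
  finally show ?thesis .
qed

lemma Lp_pairing_integrable:
  fixes f g :: "'a \<Rightarrow> complex"
  assumes p: "1 < p" and f: "Lp M p f" and g: "Lp M (p / (p - 1)) g"
  shows "integrable M (\<lambda>x. f x * g x)"
proof (rule Bochner_Integration.integrable_bound)
  show "integrable M (\<lambda>x. norm (f x) powr p + norm (g x) powr (p / (p - 1)))"
    using f g by (simp add: Lp_def)
  show "(\<lambda>x. f x * g x) \<in> borel_measurable M" using f g by (auto simp: Lp_def)
  show "AE x in M. norm (f x * g x) \<le> norm (norm (f x) powr p + norm (g x) powr (p / (p - 1)))"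
    using norm_mult_le_scaled_powr[OF p, of 1] by (intro AE_I2) (simp add: abs_of_nonneg)
qed

text \<open>\<open>\<delta>\<close> does not depend on \<open>f\<close> and \<open>g\<close>; for a
  bounded sequence of functions \<open>f\<close> this is equicontinuity of the pairings.\<close>

lemma Lp_pairing_small:
  assumes p: "1 < p" and e: "0 < e"
  obtains \<delta> where "0 < \<delta>" "\<And>f g :: 'a \<Rightarrow> complex. Lp M p f \<Longrightarrow> (\<integral>x. norm (f x) powr p \<partial>M) \<le> C \<Longrightarrow>
     Lp M (p / (p - 1)) g \<Longrightarrow> (\<integral>x. norm (g x) powr (p / (p - 1)) \<partial>M) \<le> \<delta> \<Longrightarrow> norm (\<integral>x. f x * g x \<partial>M) \<le> e"
proof -
  let ?q = "p / (p - 1)"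
  \<comment> \<open>\<open>\<eta>\<close> makes the first Young term at most \<open>e / 2\<close>,
    and \<open>\<delta>\<close> then does the same for the second; \<open>\<bar>C\<bar> + 1\<close>
    is positive whatever \<open>C\<close> is.\<close>
  define \<eta> where "\<eta> = (e / (2 * (\<bar>C\<bar> + 1))) powr (1 / p)"
  have \<eta>: "0 < \<eta>" using e by (simp add: \<eta>_def)
  have \<eta>p: "\<eta> powr p = e / (2 * (\<bar>C\<bar> + 1))" using p e by (simp add: \<eta>_def powr_powr)
  define \<delta> where "\<delta> = e / 2 / ((1 / \<eta>) powr ?q)"
  have \<delta>: "0 < \<delta>" using \<eta> e by (simp add: \<delta>_def)
  show thesis
  proof (rule that[OF \<delta>])
    fix f g :: "'a \<Rightarrow> complex"
    assume f: "Lp M p f" "(\<integral>x. norm (f x) powr p \<partial>M) \<le> C" and g: "Lp M ?q g" "(\<integral>x. norm (g x) powr ?q \<partial>M) \<le> \<delta>"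
    have fi: "integrable M (\<lambda>x. norm (f x) powr p)" and gi: "integrable M (\<lambda>x. norm (g x) powr ?q)"
      using f g by (auto simp: Lp_def)
    have "norm (\<integral>x. f x * g x \<partial>M) \<le> (\<integral>x. norm (f x * g x) \<partial>M)"
      by (rule integral_norm_bound)
    also have "\<dots> \<le> (\<integral>x. \<eta> powr p * norm (f x) powr p + (1 / \<eta>) powr ?q * norm (g x) powr ?q \<partial>M)"
      by (intro integral_mono integrable_norm Lp_pairing_integrable[OF p f(1) g(1)]
          Bochner_Integration.integrable_add integrable_mult_right fi gi norm_mult_le_scaled_powr[OF p \<eta>])
    also have "\<dots> = \<eta> powr p * (\<integral>x. norm (f x) powr p \<partial>M) + (1 / \<eta>) powr ?q * (\<integral>x. norm (g x) powr ?q \<partial>M)"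
      using fi gi by simp
    also have "\<dots> \<le> \<eta> powr p * (\<bar>C\<bar> + 1) + (1 / \<eta>) powr ?q * \<delta>"
      using f(2) g(2) by (intro add_mono mult_left_mono) auto
    also have "\<dots> = e"
    proof -
      have "a / (2 * c) * c = a / 2" if "0 < c" for a c :: real using that by simp
      from this[of "\<bar>C\<bar> + 1" e] show ?thesis using \<eta> by (simp only: \<eta>p \<delta>_def) simp
    qed
    finally show "norm (\<integral>x. f x * g x \<partial>M) \<le> e" .
  qed
qed

lemma diagonal_convergent_subsequence:
  fixes f :: "nat \<Rightarrow> 'a \<Rightarrow> complex"
  assumes S: "countable S" and bdd: "\<And>x. x \<in> S \<Longrightarrow> bounded (range (\<lambda>n. f n x))"
  obtains r :: "nat \<Rightarrow> nat" where "strict_mono r" "\<And>x. x \<in> S \<Longrightarrow> convergent (\<lambda>n. f (r n) x)"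
proof (cases "S = {}")
  case True then show ?thesis using that[of id] by (simp add: strict_mono_def)
next
  case False
  define t where "t = from_nat_into S"
  have t: "t k \<in> S" for k unfolding t_def by (rule from_nat_into[OF False])
  interpret subseqs "\<lambda>k r. convergent (\<lambda>n. f (r n) (t k))"
  proof
    fix k and s :: "nat \<Rightarrow> nat"
    have "bounded (range (\<lambda>n. f (s n) (t k)))" by (rule bounded_subset[OF bdd[OF t[of k]]]) auto
    from bounded_imp_convergent_subsequence[OF this]
    obtain l r where "strict_mono r" "((\<lambda>n. f (s n) (t k)) \<circ> r) \<longlonglongrightarrow> l"
      by blast
    then show "\<exists>r'. strict_mono r' \<and> convergent (\<lambda>n. f ((s \<circ> r') n) (t k))" by (auto simp: o_def convergent_def)
  qed
  show thesis
  proof (rule that[OF subseq_diagseq])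
    fix x assume "x \<in> S"
    then obtain k where k: "t k = x" unfolding t_def using S by (metis from_nat_into_surj)
    \<comment> \<open>The diagonal sequence is guaranteed to refine the choice made for
      \<open>t k\<close> only from index \<open>Suc k\<close> on; convergence ignores the initial
      segment.\<close>
    have "convergent (\<lambda>n. f ((diagseq \<circ> (+) (Suc k)) n) (t k))"
    proof (rule diagseq_holds)
      fix r s n assume "strict_mono (r :: nat \<Rightarrow> nat)" "convergent (\<lambda>i. f (s i) (t n))"
      then show "convergent (\<lambda>i. f ((s \<circ> r) i) (t n))"
        using convergent_subseq_convergent[of "\<lambda>i. f (s i) (t n)" r] by (simp add: o_def)
    qed
    then show "convergent (\<lambda>n. f (diagseq n) x)"
      using convergent_ignore_initial_segment[of "\<lambda>n. f (diagseq n) (t k)" "Suc k"] by (simp add: k o_def add.commute)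
  qed
qed

section \<open>Weak limits in an abstract ergodic setting\<close>

text \<open>\<open>N\<close> stands for the measure on \<Omega>, \<open>h n\<close> for
  \<open>H (eps n)\<close> and \<open>D\<close> for a countable dense part of \<open>A\<close>. The
  action enters only through \<open>comp_measurable\<close> and \<open>mean_value\<close>; the
  latter is weak-star convergence with the mean already written as an integral against
  \<open>\<beta>\<close>.\<close>

locale sigma_setting = selfadjoint_algebra A + sigma_finite_measure N
  for A :: "('x::metric_space \<Rightarrow>\<^sub>C complex) set" and N :: "'x measure" +
  fixes D :: "('x \<Rightarrow>\<^sub>C complex) set" and \<beta> :: "(('x \<Rightarrow>\<^sub>C complex) \<Rightarrow> complex) measure"
    and p C :: real and h :: "nat \<Rightarrow> 'x \<Rightarrow> 'x" and u :: "nat \<Rightarrow> 'x \<Rightarrow> complex"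
  assumes D: "countable D" "D \<subseteq> A" "A \<subseteq> closure D"
    and p: "1 < p"
    and sets_\<beta>: "sets \<beta> = sets (spectrum_space A)"
    and prob_\<beta>: "emeasure \<beta> (space \<beta>) = 1"
    and comp_measurable: "\<And>w n. w \<in> A \<Longrightarrow> (\<lambda>x. apply_bcontfun w (h n x)) \<in> borel_measurable N"
    and u_Lp: "\<And>n. Lp N p (u n)"
    and u_bound: "\<And>n. (\<integral>x. norm (u n x) powr p \<partial>N) \<le> C"
    and mean_value: "\<And>a f. a \<in> A \<Longrightarrow> integrable N (f :: 'x \<Rightarrow> complex) \<Longrightarrow>
      (\<lambda>n. \<integral>x. apply_bcontfun a (h n x) * f x \<partial>N) \<longlonglongrightarrow> (\<integral>s. s a \<partial>\<beta>) * (\<integral>x. f x \<partial>N)"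
begin

abbreviation q :: real where "q \<equiv> p / (p - 1)"

lemma q: "1 < q" "0 < q" "q / (q - 1) = p"
  using p by (simp_all add: field_simps)

definition pair :: "nat \<Rightarrow> ('x \<Rightarrow> 'x \<Rightarrow>\<^sub>C complex) \<Rightarrow> complex" where
  "pair n \<psi> = (\<integral>x. u n x * apply_bcontfun (\<psi> x) (h n x) \<partial>N)"

definition hat :: "('x \<Rightarrow> 'x \<Rightarrow>\<^sub>C complex) \<Rightarrow> 'x \<times> (('x \<Rightarrow>\<^sub>C complex) \<Rightarrow> complex) \<Rightarrow> complex" where
  "hat \<psi> z = snd z (\<psi> (fst z))"

text \<open>Closeness in \<open>L^q\<close> through a scalar dominant \<open>G\<close> instead of
  the norm of the difference: the values lie in a space not assumed separable, where measurability
  of \<open>\<psi> - \<phi>\<close> is not automatic.\<close>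

definition close :: "real \<Rightarrow> ('x \<Rightarrow> 'x \<Rightarrow>\<^sub>C complex) \<Rightarrow> ('x \<Rightarrow> 'x \<Rightarrow>\<^sub>C complex) \<Rightarrow> bool" where
  "close \<delta> \<psi> \<phi> \<longleftrightarrow> (\<exists>G. integrable N (\<lambda>x. G x powr q) \<and> (\<integral>x. G x powr q \<partial>N) \<le> \<delta> \<and>
     (\<forall>x\<in>space N. norm (\<psi> x - \<phi> x) \<le> G x))"

section \<open>Measurability and integrability of traces and Gelfand transforms\<close>

lemma space_\<beta>: "space \<beta> = spectrum_set A"
  using sets_eq_imp_space_eq[OF sets_\<beta>] by (auto simp: spectrum_space_def space_measure_of_conv)

lemma finite_\<beta>: "finite_measure \<beta>"
  by standard (simp add: prob_\<beta>)

lemma pair_sigma_finite: "pair_sigma_finite N \<beta>"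
  using finite_\<beta> by (simp add: pair_sigma_finite_def sigma_finite_measure_axioms finite_measure_def)

lemma space_pair: "z \<in> space (N \<Otimes>\<^sub>M \<beta>) \<Longrightarrow> fst z \<in> space N \<and> snd z \<in> spectrum_set A"
  by (auto simp: space_pair_measure space_\<beta>)

lemma spectrum_char: "s \<in> spectrum_set A \<Longrightarrow> spectrum_char A s"
  by (simp add: spectrum_char_def spectrum_char_axioms_def selfadjoint_algebra_axioms)

lemmas s_norm_le = spectrum_char.norm_s_le[OF spectrum_char]
  and s_add = spectrum_char.s_add[OF spectrum_char]
  and s_diff = spectrum_char.s_diff[OF spectrum_char]
  and s_zero = spectrum_char.s_zero[OF spectrum_char]
  and s_scale = spectrum_char.s_scale[OF spectrum_char]

lemma evaluation_measurable:
  assumes a: "a \<in> A" shows "(\<lambda>s. s a) \<in> borel_measurable \<beta>"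
proof (rule borel_measurableI)
  fix U :: "complex set" assume "open U"
  then have "{s \<in> spectrum_set A. s a \<in> U} \<in> sets \<beta>"
    unfolding sets_\<beta> spectrum_space_def using a
    by (subst sets_measure_of) (auto intro!: sigma_sets.Basic)
  also have "{s \<in> spectrum_set A. s a \<in> U} = (\<lambda>s. s a) -` U \<inter> space \<beta>"
    by (auto simp: space_\<beta>)
  finally show "(\<lambda>s. s a) -` U \<inter> space \<beta> \<in> sets \<beta>" .
qed

lemma integral_product:
  fixes f :: "'x \<Rightarrow> real" and g :: "(('x \<Rightarrow>\<^sub>C complex) \<Rightarrow> complex) \<Rightarrow> real"
  assumes f: "integrable N f" and g: "integrable \<beta> g"
  shows "integrable (N \<Otimes>\<^sub>M \<beta>) (\<lambda>z. f (fst z) * g (snd z))"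
    and "(\<integral>z. f (fst z) * g (snd z) \<partial>(N \<Otimes>\<^sub>M \<beta>)) = (\<integral>x. f x \<partial>N) * (\<integral>s. g s \<partial>\<beta>)"
proof -
  interpret P: pair_sigma_finite N \<beta> by (rule pair_sigma_finite)
  have [measurable]: "f \<in> borel_measurable N" "g \<in> borel_measurable \<beta>" using f g by auto
  show i: "integrable (N \<Otimes>\<^sub>M \<beta>) (\<lambda>z. f (fst z) * g (snd z))"
    by (rule P.Fubini_integrable) (use f g in \<open>auto simp: abs_mult\<close>)
  show "(\<integral>z. f (fst z) * g (snd z) \<partial>(N \<Otimes>\<^sub>M \<beta>)) = (\<integral>x. f x \<partial>N) * (\<integral>s. g s \<partial>\<beta>)"
    using P.integral_fst'[OF i] by simp
qed

lemma dominated_Lq: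
  fixes f :: "'x \<Rightarrow> complex"
  assumes "f \<in> borel_measurable N" "integrable N (\<lambda>x. G x powr q)" "\<And>x. x \<in> space N \<Longrightarrow> norm (f x) \<le> G x"
  shows "Lp N q f" "(\<integral>x. norm (f x) powr q \<partial>N) \<le> (\<integral>x. G x powr q \<partial>N)"
proof -
  have le: "norm (f x) powr q \<le> G x powr q" if "x \<in> space N" for x
    using q assms(3)[OF that] by (intro powr_mono2) auto
  have i: "integrable N (\<lambda>x. norm (f x) powr q)"
    using assms(2)
    by (rule Bochner_Integration.integrable_bound) (use assms(1) le in \<open>auto intro!: AE_I2\<close>)
  then show "Lp N q f" using assms(1) by (simp add: Lp_def)
  show "(\<integral>x. norm (f x) powr q \<partial>N) \<le> (\<integral>x. G x powr q \<partial>N)"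
    by (rule integral_mono[OF i assms(2) le])
qed

lemma dominated_Lq_product:
  fixes f :: "'x \<times> (('x \<Rightarrow>\<^sub>C complex) \<Rightarrow> complex) \<Rightarrow> complex"
  assumes "f \<in> borel_measurable (N \<Otimes>\<^sub>M \<beta>)" "integrable N (\<lambda>x. G x powr q)"
    "\<And>z. z \<in> space (N \<Otimes>\<^sub>M \<beta>) \<Longrightarrow> norm (f z) \<le> G (fst z)"
  shows "Lp (N \<Otimes>\<^sub>M \<beta>) q f" "(\<integral>z. norm (f z) powr q \<partial>(N \<Otimes>\<^sub>M \<beta>)) \<le> (\<integral>x. G x powr q \<partial>N)"
proof -
  have "integrable \<beta> (\<lambda>_. 1 :: real)" by (rule finite_measure.integrable_const[OF finite_\<beta>])
  note G = integral_product[OF assms(2) this]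
  have \<beta>1: "measure \<beta> (space \<beta>) = 1" using prob_\<beta> by (simp add: measure_def)
  have le: "norm (f z) powr q \<le> G (fst z) powr q" if "z \<in> space (N \<Otimes>\<^sub>M \<beta>)" for z
    using q assms(3)[OF that] by (intro powr_mono2) auto
  have Gi: "integrable (N \<Otimes>\<^sub>M \<beta>) (\<lambda>z. G (fst z) powr q)" using G(1) by simp
  have i: "integrable (N \<Otimes>\<^sub>M \<beta>) (\<lambda>z. norm (f z) powr q)"
    using Gi by (rule Bochner_Integration.integrable_bound) (use assms(1) le in \<open>auto intro!: AE_I2\<close>)
  then show "Lp (N \<Otimes>\<^sub>M \<beta>) q f" using assms(1) by (simp add: Lp_def)
  have "(\<integral>z. norm (f z) powr q \<partial>(N \<Otimes>\<^sub>M \<beta>)) \<le> (\<integral>z. G (fst z) powr q \<partial>(N \<Otimes>\<^sub>M \<beta>))"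
    by (rule integral_mono[OF i Gi le])
  also have "\<dots> = (\<integral>x. G x powr q \<partial>N)" using G(2) \<beta>1 by simp
  finally show "(\<integral>z. norm (f z) powr q \<partial>(N \<Otimes>\<^sub>M \<beta>)) \<le> (\<integral>x. G x powr q \<partial>N)" .
qed

lemma norm_diff_apply_le: "norm (apply_bcontfun v y - apply_bcontfun w y) \<le> norm (v - w)"
  using norm_apply_bcontfun_le[of "v - w" y] by (simp add: minus_bcontfun.rep_eq)

lemma s_norm_diff_le: "s \<in> spectrum_set A \<Longrightarrow> v \<in> A \<Longrightarrow> w \<in> A \<Longrightarrow> norm (s v - s w) \<le> norm (v - w)"
  by (subst s_diff[symmetric]) (auto intro: s_norm_le diff)

context
  fixes \<psi> assumes \<psi>: "\<psi> \<in> borel_measurable N" "\<And>x. x \<in> space N \<Longrightarrow> \<psi> x \<in> A"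
begin

text \<open>For a simple approximant each of the finitely many values contributes a measurable
  function, and evaluations are 1-Lipschitz for the sup norm, so the approximants converge
  pointwise. \<open>hat_measurable\<close> uses the same scheme with characters, which are
  1-Lipschitz by \<open>norm_s_le\<close>.\<close>

lemma trace_measurable: "(\<lambda>x. apply_bcontfun (\<psi> x) (h n x)) \<in> borel_measurable N"
proof -
  obtain g where g: "\<And>j. simple_function N (g j)" "\<And>j x. g j x \<in> A"
    "\<And>x. x \<in> space N \<Longrightarrow> (\<lambda>j. norm (\<psi> x - g j x)) \<longlonglongrightarrow> 0"
    using simple_function_approximation[OF \<psi> zero D] by blast
  show ?thesis
  proof (rule borel_measurable_LIMSEQ_metric)
    show "(\<lambda>x. apply_bcontfun (g j x) (h n x)) \<in> borel_measurable N" for j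
      by (rule simple_function_apply_measurable[OF g(1), where A = A and f = "\<lambda>a x. apply_bcontfun a (h n x)" and \<pi> = "\<lambda>x. x"])
        (auto simp: g comp_measurable)
    show "(\<lambda>j. apply_bcontfun (g j x) (h n x)) \<longlonglongrightarrow> apply_bcontfun (\<psi> x) (h n x)" if "x \<in> space N" for x
    proof (rule metric_tendsto_imp_tendsto[OF g(3)[OF that]])
      have "norm (apply_bcontfun (g j x) (h n x) - apply_bcontfun (\<psi> x) (h n x)) \<le> norm (\<psi> x - g j x)" for j
        unfolding norm_minus_commute[of "\<psi> x"] by (rule norm_diff_apply_le)
      then show "\<forall>\<^sub>F j in sequentially. dist (apply_bcontfun (g j x) (h n x)) (apply_bcontfun (\<psi> x) (h n x))
          \<le> dist (norm (\<psi> x - g j x)) 0"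
        by (intro always_eventually) (simp add: dist_norm)
    qed
  qed
qed

lemma hat_measurable: "hat \<psi> \<in> borel_measurable (N \<Otimes>\<^sub>M \<beta>)"
proof -
  obtain g where g: "\<And>j. simple_function N (g j)" "\<And>j x. g j x \<in> A"
    "\<And>x. x \<in> space N \<Longrightarrow> (\<lambda>j. norm (\<psi> x - g j x)) \<longlonglongrightarrow> 0"
    using simple_function_approximation[OF \<psi> zero D] by blast
  show ?thesis
  proof (rule borel_measurable_LIMSEQ_metric)
    show "(\<lambda>z. snd z (g j (fst z))) \<in> borel_measurable (N \<Otimes>\<^sub>M \<beta>)" for j
      by (rule simple_function_apply_measurable[OF g(1), where A = A and f = "\<lambda>a z. snd z a" and \<pi> = fst])
        (auto intro!: g measurable_compose[OF measurable_snd evaluation_measurable])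
    show "(\<lambda>j. snd z (g j (fst z))) \<longlonglongrightarrow> hat \<psi> z" if z: "z \<in> space (N \<Otimes>\<^sub>M \<beta>)" for z
    proof (rule metric_tendsto_imp_tendsto[OF g(3)])
      show z': "fst z \<in> space N" using space_pair[OF z] by simp
      have "norm (snd z (g j (fst z)) - snd z (\<psi> (fst z))) \<le> norm (\<psi> (fst z) - g j (fst z))" for j
        unfolding norm_minus_commute[of "\<psi> (fst z)"]
        using space_pair[OF z] \<psi>(2)[OF z'] g(2) by (intro s_norm_diff_le) auto
      then show "\<forall>\<^sub>F j in sequentially. dist (snd z (g j (fst z))) (hat \<psi> z) \<le> dist (norm (\<psi> (fst z) - g j (fst z))) 0"
        by (intro always_eventually) (simp add: hat_def dist_norm)
    qed
  qed
qed

end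

section \<open>Equicontinuity of the pairings\<close>

lemma Lp_A_D:
  assumes "Lp_A N q A \<psi>"
  shows "\<psi> \<in> borel_measurable N" "\<And>x. x \<in> space N \<Longrightarrow> \<psi> x \<in> A" "integrable N (\<lambda>x. norm (\<psi> x) powr q)"
  using assms by (auto simp: Lp_A_def)

lemma trace_Lp:
  assumes "Lp_A N q A \<psi>" shows "Lp N q (\<lambda>x. apply_bcontfun (\<psi> x) (h n x))"
  by (rule dominated_Lq[OF trace_measurable[OF Lp_A_D(1,2)[OF assms]] Lp_A_D(3)[OF assms]])
    (auto simp: norm_apply_bcontfun_le)

lemma hat_Lp:
  assumes "Lp_A N q A \<psi>" shows "Lp (N \<Otimes>\<^sub>M \<beta>) q (hat \<psi>)"
  by (rule dominated_Lq_product[OF hat_measurable[OF Lp_A_D(1,2)[OF assms]] Lp_A_D(3)[OF assms]])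
    (use space_pair Lp_A_D(2)[OF assms] in \<open>auto simp: hat_def s_norm_le\<close>)

lemma pair_integrable:
  assumes "Lp_A N q A \<psi>" shows "integrable N (\<lambda>x. u n x * apply_bcontfun (\<psi> x) (h n x))"
  by (rule Lp_pairing_integrable[OF p u_Lp trace_Lp[OF assms]])

lemma pair_close:
  assumes e: "0 < e"
  obtains \<delta> where "0 < \<delta>" "\<And>\<psi> \<phi> n. Lp_A N q A \<psi> \<Longrightarrow> Lp_A N q A \<phi> \<Longrightarrow> close \<delta> \<psi> \<phi> \<Longrightarrow>
    norm (pair n \<psi> - pair n \<phi>) \<le> e"
proof -
  obtain \<delta> where \<delta>: "0 < \<delta>" "\<And>f g :: 'x \<Rightarrow> complex. Lp N p f \<Longrightarrow> (\<integral>x. norm (f x) powr p \<partial>N) \<le> C \<Longrightarrow>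
     Lp N q g \<Longrightarrow> (\<integral>x. norm (g x) powr q \<partial>N) \<le> \<delta> \<Longrightarrow> norm (\<integral>x. f x * g x \<partial>N) \<le> e"
    using Lp_pairing_small[OF p e] by blast
  show thesis
  proof (rule that[OF \<delta>(1)])
    fix \<psi> \<phi> n assume \<psi>: "Lp_A N q A \<psi>" and \<phi>: "Lp_A N q A \<phi>" and "close \<delta> \<psi> \<phi>"
    then obtain G where G: "integrable N (\<lambda>x. G x powr q)" "(\<integral>x. G x powr q \<partial>N) \<le> \<delta>"
      "\<And>x. x \<in> space N \<Longrightarrow> norm (\<psi> x - \<phi> x) \<le> G x" by (auto simp: close_def)
    let ?g = "\<lambda>x. apply_bcontfun (\<psi> x) (h n x) - apply_bcontfun (\<phi> x) (h n x)"
    have gm: "?g \<in> borel_measurable N"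
      by (intro borel_measurable_diff trace_measurable Lp_A_D[OF \<psi>] Lp_A_D[OF \<phi>])
    have gG: "norm (?g x) \<le> G x" if "x \<in> space N" for x
      using G(3)[OF that] norm_diff_apply_le order_trans by blast
    have "pair n \<psi> - pair n \<phi> = (\<integral>x. u n x * ?g x \<partial>N)"
      unfolding pair_def right_diff_distrib
      by (rule Bochner_Integration.integral_diff[symmetric]) (intro pair_integrable \<psi> \<phi>)+
    also have "norm \<dots> \<le> e"
      using dominated_Lq[OF gm G(1) gG] G(2) by (intro \<delta>(2) u_Lp u_bound) auto
    finally show "norm (pair n \<psi> - pair n \<phi>) \<le> e" .
  qed
qed

text \<open>The three-term estimate works because \<open>\<delta>\<close> in
  \<open>pair_close\<close> is independent of \<open>n\<close>. Every extension of convergence by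
  density below goes through this closure property.\<close>

lemma pair_convergent_closed:
  assumes \<psi>: "Lp_A N q A \<psi>"
    and approx: "\<And>\<delta>. 0 < \<delta> \<Longrightarrow> \<exists>\<phi>. Lp_A N q A \<phi> \<and> close \<delta> \<psi> \<phi> \<and> convergent (\<lambda>n. pair n \<phi>)"
  shows "convergent (\<lambda>n. pair n \<psi>)"
proof (rule Cauchy_convergent, rule CauchyI)
  fix e :: real assume "0 < e"
  then have e: "0 < e / 4" by simp
  obtain \<delta> where \<delta>: "0 < \<delta>" "\<And>\<psi> \<phi> n. Lp_A N q A \<psi> \<Longrightarrow> Lp_A N q A \<phi> \<Longrightarrow> close \<delta> \<psi> \<phi> \<Longrightarrow>
    norm (pair n \<psi> - pair n \<phi>) \<le> e / 4" using pair_close[OF e] by blast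
  obtain \<phi> where \<phi>: "Lp_A N q A \<phi>" "close \<delta> \<psi> \<phi>" "convergent (\<lambda>n. pair n \<phi>)" using approx[OF \<delta>(1)] by blast
  have "Cauchy (\<lambda>n. pair n \<phi>)" using \<phi>(3) by (rule convergent_Cauchy)
  then obtain M where M: "\<And>m n. M \<le> m \<Longrightarrow> M \<le> n \<Longrightarrow> norm (pair m \<phi> - pair n \<phi>) < e / 4"
    using CauchyD[OF _ e] by blast
  have *: "norm (pair m \<psi> - pair n \<psi>) < e" if "M \<le> m" "M \<le> n" for m n
  proof -
    have "norm (pair m \<psi> - pair n \<psi>) = norm ((pair m \<psi> - pair m \<phi>) + (pair m \<phi> - pair n \<phi>) + (pair n \<phi> - pair n \<psi>))" by simp
    also have "\<dots> \<le> norm (pair m \<psi> - pair m \<phi>) + norm (pair m \<phi> - pair n \<phi>) + norm (pair n \<phi> - pair n \<psi>)"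
      using norm_triangle_ineq[of "(pair m \<psi> - pair m \<phi>) + (pair m \<phi> - pair n \<phi>)" "pair n \<phi> - pair n \<psi>"]
        norm_triangle_ineq[of "pair m \<psi> - pair m \<phi>" "pair m \<phi> - pair n \<phi>"] by linarith
    also have "\<dots> < e"
      using \<delta>(2)[OF \<psi> \<phi>(1,2), of m] \<delta>(2)[OF \<psi> \<phi>(1,2), of n] M[OF that] \<open>0 < e\<close>
        norm_minus_commute[of "pair n \<phi>" "pair n \<psi>"] by linarith
    finally show ?thesis .
  qed
  show "\<exists>M. \<forall>m\<ge>M. \<forall>n\<ge>M. norm (pair m \<psi> - pair n \<psi>) < e"
    by (intro exI[of _ M] allI impI *)
qed

section \<open>Step functions and simple test functions\<close>

definition step :: "'x set \<Rightarrow> ('x \<Rightarrow>\<^sub>C complex) \<Rightarrow> 'x \<Rightarrow> 'x \<Rightarrow>\<^sub>C complex" where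
  "step B a x = indicator B x *\<^sub>R a"

definition simple :: "('x \<Rightarrow> 'x \<Rightarrow>\<^sub>C complex) \<Rightarrow> bool" where
  "simple \<psi> \<longleftrightarrow> Bochner_Integration.simple_bochner_integrable N \<psi> \<and> (\<forall>x\<in>space N. \<psi> x \<in> A)"

lemma simple_Lp_A:
  assumes "simple \<psi>" shows "Lp_A N q A \<psi>"
proof -
  have s: "Bochner_Integration.simple_bochner_integrable N \<psi>" and A: "\<And>x. x \<in> space N \<Longrightarrow> \<psi> x \<in> A" using assms by (auto simp: simple_def)
  have "\<psi> \<in> borel_measurable N"
    using s by (auto elim!: simple_bochner_integrable.cases intro: borel_measurable_simple_function)
  moreover have "Bochner_Integration.simple_bochner_integrable N (\<lambda>x. norm (\<psi> x) powr q)"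
    by (rule simple_bochner_integrable_compose2[where p = "\<lambda>a b. norm a powr q", OF _ s s]) simp
  ultimately show ?thesis using A by (auto simp: Lp_A_def intro: integrableI_simple_bochner_integrable)
qed

lemma simple_step:
  assumes "B \<in> sets N" "emeasure N B < \<infinity>" "a \<in> A" shows "simple (step B a)"
proof -
  have "simple_function N (\<lambda>x. step B a x)"
    unfolding step_def using assms by (intro simple_function_compose2[of N "indicator B" "\<lambda>_. a" "\<lambda>r b. r *\<^sub>R b"] simple_function_indicator simple_function_const)
  moreover have "emeasure N {y \<in> space N. step B a y \<noteq> 0} \<le> emeasure N B"
    using assms by (intro emeasure_mono) (auto simp: step_def split: split_indicator_asm)
  ultimately have "Bochner_Integration.simple_bochner_integrable N (step B a)"
    using assms by (intro simple_bochner_integrable.intros) (auto simp: top_unique)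
  then show ?thesis using scaleR[OF assms(3)] by (auto simp: simple_def step_def)
qed

lemma close_indicator:
  assumes S: "S \<in> sets N" "emeasure N S < \<infinity>" and c: "0 \<le> c" "c powr q * measure N S \<le> \<delta>"
    and le: "\<And>x. x \<in> space N \<Longrightarrow> norm (\<psi> x - \<phi> x) \<le> indicator S x * c"
  shows "close \<delta> \<psi> \<phi>"
proof -
  have "(\<lambda>x. (indicator S x * c) powr q) = (\<lambda>x. indicator S x * c powr q)"
    by (auto split: split_indicator)
  moreover have "integrable N (\<lambda>x. indicator S x * c powr q)" using S by simp
  moreover have "(\<integral>x. indicator S x * c powr q \<partial>N) \<le> \<delta>" using S c by (simp add: mult.commute)
  ultimately show ?thesis unfolding close_def by (intro exI[of _ "\<lambda>x. indicator S x * c"]) (simp add: le)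
qed

text \<open>The level sets are disjoint, so at each point at most one term survives. Thus
  \<open>F\<close> may be nonlinear: it is used both for linear expressions and for powers of
  norms.\<close>

lemma simple_decomposition:
  fixes F :: "('x \<Rightarrow>\<^sub>C complex) \<Rightarrow> 'c::comm_monoid_add"
  assumes "simple \<psi>" and x: "x \<in> space N" and F: "F 0 = 0"
  shows "F (\<psi> x) = (\<Sum>a\<in>\<psi> ` space N - {0}. F (step {y \<in> space N. \<psi> y = a} a x))"
proof -
  have "finite (\<psi> ` space N)"
    using assms(1) by (auto simp: simple_def simple_function_def elim!: simple_bochner_integrable.cases)
  moreover have "F (step {y \<in> space N. \<psi> y = a} a x) = (if a = \<psi> x then F (\<psi> x) else 0)" for a
    using x F by (auto simp: step_def split: split_indicator)
  ultimately show ?thesis using x F by (simp add: sum.delta)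
qed

text \<open>The value 0 is excluded because its level set may have infinite measure.\<close>

lemma simple_pieces:
  assumes "simple \<psi>" "a \<in> \<psi> ` space N - {0}"
  shows "{y \<in> space N. \<psi> y = a} \<in> sets N" "emeasure N {y \<in> space N. \<psi> y = a} < \<infinity>" "a \<in> A"
proof -
  have s: "simple_function N \<psi>" "emeasure N {y \<in> space N. \<psi> y \<noteq> 0} \<noteq> \<infinity>"
    using assms(1) by (auto simp: simple_def elim!: simple_bochner_integrable.cases)
  have e: "{y \<in> space N. \<psi> y = a} = \<psi> -` {a} \<inter> space N" by auto
  show 1: "{y \<in> space N. \<psi> y = a} \<in> sets N" unfolding e using s(1) by (rule simple_functionD(2))
  have "{y \<in> space N. \<psi> y \<noteq> 0} = space N - (\<psi> -` {0} \<inter> space N)" by auto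
  also have "\<dots> \<in> sets N" using simple_functionD(2)[OF s(1)] by auto
  finally have "emeasure N {y \<in> space N. \<psi> y = a} \<le> emeasure N {y \<in> space N. \<psi> y \<noteq> 0}"
    using assms(2) by (intro emeasure_mono) auto
  then show "emeasure N {y \<in> space N. \<psi> y = a} < \<infinity>" using s(2) by (auto simp: less_top top_unique)
  show "a \<in> A" using assms by (auto simp: simple_def)
qed

lemma Lp_A_approx_simple:
  assumes \<psi>: "Lp_A N q A \<psi>" and \<delta>: "0 < \<delta>"
  obtains \<phi> where "simple \<phi>" "close \<delta> \<psi> \<phi>"
proof -
  obtain g where g: "\<And>j. simple_function N (g j)" "\<And>j x. g j x \<in> A"
    "\<And>j. (\<lambda>x. norm (\<psi> x - g j x)) \<in> borel_measurable N"
    "\<And>j x. norm (\<psi> x - g j x) \<le> norm (\<psi> x)"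
    "\<And>x. x \<in> space N \<Longrightarrow> (\<lambda>j. norm (\<psi> x - g j x)) \<longlonglongrightarrow> 0"
    using simple_function_approximation[OF Lp_A_D(1,2)[OF \<psi>] zero D] by blast
  note [measurable] = g(3)
  have le: "norm (\<psi> x - g j x) powr q \<le> norm (\<psi> x) powr q" for j x
    using q g(4) by (intro powr_mono2) auto
  have int: "integrable N (\<lambda>x. norm (\<psi> x - g j x) powr q)" for j
    using Lp_A_D(3)[OF \<psi>] by (rule Bochner_Integration.integrable_bound) (use le in auto)
  have "(\<lambda>j. \<integral>x. norm (\<psi> x - g j x) powr q \<partial>N) \<longlonglongrightarrow> (\<integral>x. 0 \<partial>N)"
  proof (rule integral_dominated_convergence[where w = "\<lambda>x. norm (\<psi> x) powr q"])
    show "AE x in N. (\<lambda>j. norm (\<psi> x - g j x) powr q) \<longlonglongrightarrow> 0"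
    proof (rule AE_I2)
      fix x assume "x \<in> space N"
      then have "(\<lambda>j. norm (\<psi> x - g j x) powr q) \<longlonglongrightarrow> 0 powr q"
        using q by (intro tendsto_powr' g(5) tendsto_const) auto
      then show "(\<lambda>j. norm (\<psi> x - g j x) powr q) \<longlonglongrightarrow> 0" by simp
    qed
    show "integrable N (\<lambda>x. norm (\<psi> x) powr q)" by (rule Lp_A_D(3)[OF \<psi>])
  qed (use le in auto)
  then have "eventually (\<lambda>j. (\<integral>x. norm (\<psi> x - g j x) powr q \<partial>N) < \<delta>) sequentially"
    using \<delta> by (intro order_tendstoD(2)) auto
  then obtain j where j: "(\<integral>x. norm (\<psi> x - g j x) powr q \<partial>N) < \<delta>" by (auto simp: eventually_sequentially)
  show thesis
  proof (rule that[of "g j"])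
    show "close \<delta> \<psi> (g j)" unfolding close_def using int j by (intro exI[of _ "\<lambda>x. norm (\<psi> x - g j x)"]) auto
    \<comment> \<open>The bound \<open>norm (g j x) \<le> 2 * norm (\<psi> x)\<close> makes
      \<open>norm (g j x) powr q\<close> integrable; being simple, it vanishes off a set of finite
      measure, and so does \<open>g j\<close>.\<close>
    have sq: "simple_function N (\<lambda>x. norm (g j x) powr q)"
      using simple_function_compose1[OF g(1), of "\<lambda>a. norm a powr q" j] by simp
    have "norm (g j x) powr q \<le> 2 powr q * norm (\<psi> x) powr q" for x
    proof -
      have "norm (g j x) \<le> 2 * norm (\<psi> x)"
        using g(4)[of x j] norm_triangle_ineq4[of "\<psi> x" "\<psi> x - g j x"] by simp
      then have "norm (g j x) powr q \<le> (2 * norm (\<psi> x)) powr q" using q by (intro powr_mono2) auto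
      then show ?thesis by (simp add: powr_mult)
    qed
    then have "AE x in N. norm (norm (g j x) powr q) \<le> norm (2 powr q * norm (\<psi> x) powr q)"
      by (intro AE_I2) (simp add: abs_of_nonneg)
    with integrable_mult_right[OF Lp_A_D(3)[OF \<psi>]] borel_measurable_simple_function[OF sq]
    have "integrable N (\<lambda>x. norm (g j x) powr q)"
      by (rule Bochner_Integration.integrable_bound)
    then have "(\<integral>\<^sup>+x. norm (norm (g j x) powr q) \<partial>N) < \<infinity>" by (simp add: integrable_iff_bounded)
    then have "Bochner_Integration.simple_bochner_integrable N (\<lambda>x. norm (g j x) powr q)"
      by (rule simple_bochner_integrableI_bounded[OF sq])
    then have "emeasure N {y \<in> space N. norm (g j y) powr q \<noteq> 0} \<noteq> \<infinity>"
      by (auto elim!: simple_bochner_integrable.cases)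
    then show "simple (g j)"
      unfolding simple_def using g(1,2) by (intro conjI simple_bochner_integrable.intros) auto
  qed
qed

lemma pair_simple:
  assumes \<psi>: "simple \<psi>"
  shows "pair n \<psi> = (\<Sum>a\<in>\<psi> ` space N - {0}. pair n (step {y \<in> space N. \<psi> y = a} a))"
proof -
  let ?V = "\<psi> ` space N - {0}"
  have i: "integrable N (\<lambda>x. u n x * apply_bcontfun (step {y \<in> space N. \<psi> y = a} a x) (h n x))" if "a \<in> ?V" for a
    using simple_pieces[OF \<psi> that] by (intro pair_integrable simple_Lp_A simple_step)
  have "pair n \<psi> = (\<integral>x. (\<Sum>a\<in>?V. u n x * apply_bcontfun (step {y \<in> space N. \<psi> y = a} a x) (h n x)) \<partial>N)"
    unfolding pair_def
    using simple_decomposition[OF \<psi>, where F = "\<lambda>b. u n _ * apply_bcontfun b (h n _)"]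
    by (intro Bochner_Integration.integral_cong refl) simp
  also have "\<dots> = (\<Sum>a\<in>?V. pair n (step {y \<in> space N. \<psi> y = a} a))"
    unfolding pair_def using i by (rule Bochner_Integration.integral_sum)
  finally show ?thesis .
qed

lemma convergent_step_approx_set:
  assumes B: "B \<in> sets N" "emeasure N B < \<infinity>" and d: "d \<in> A"
    and approx: "\<And>e. 0 < e \<Longrightarrow> \<exists>R\<in>sets N. emeasure N R < \<infinity> \<and> measure N ((B - R) \<union> (R - B)) < e \<and> convergent (\<lambda>n. pair n (step R d))"
  shows "convergent (\<lambda>n. pair n (step B d))"
proof (rule pair_convergent_closed[OF simple_Lp_A[OF simple_step[OF B d]]])
  fix \<delta> :: real assume \<delta>: "0 < \<delta>"
  \<comment> \<open>An error on a set of measure \<open>m\<close> costs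
    \<open>norm d powr q * m\<close>; the \<open>+ 1\<close> covers \<open>d = 0\<close>.\<close>
  have "0 < \<delta> / (norm d powr q + 1)" using \<delta> by (intro divide_pos_pos add_nonneg_pos) auto
  from approx[OF this] obtain R where R: "R \<in> sets N" "emeasure N R < \<infinity>"
    "measure N ((B - R) \<union> (R - B)) < \<delta> / (norm d powr q + 1)" "convergent (\<lambda>n. pair n (step R d))" by blast
  have "close \<delta> (step B d) (step R d)"
  proof (rule close_indicator)
    show "(B - R) \<union> (R - B) \<in> sets N" using B R by auto
    have "emeasure N ((B - R) \<union> (R - B)) \<le> emeasure N (B \<union> R)" using B R by (intro emeasure_mono) auto
    also have "\<dots> \<le> emeasure N B + emeasure N R" using B R by (intro emeasure_subadditive) auto
    also have "\<dots> < \<infinity>" using B R by simp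
    finally show "emeasure N ((B - R) \<union> (R - B)) < \<infinity>" .
    have "norm d powr q * measure N ((B - R) \<union> (R - B)) \<le> (norm d powr q + 1) * measure N ((B - R) \<union> (R - B))"
      by (intro mult_right_mono) auto
    also have "\<dots> \<le> (norm d powr q + 1) * (\<delta> / (norm d powr q + 1))"
      using R(3) by (intro mult_left_mono) auto
    also have "\<dots> = \<delta>"
    proof -
      have "0 < norm d powr q + 1" by (intro add_nonneg_pos) auto
      then show ?thesis by simp
    qed
    finally show "norm d powr q * measure N ((B - R) \<union> (R - B)) \<le> \<delta>" .
    show "norm (step B d x - step R d x) \<le> indicator ((B - R) \<union> (R - B)) x * norm d" for x
      by (auto simp: step_def split: split_indicator)
  qed auto
  then show "\<exists>\<phi>. Lp_A N q A \<phi> \<and> close \<delta> (step B d) \<phi> \<and> convergent (\<lambda>n. pair n \<phi>)"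
    using R simple_Lp_A[OF simple_step[OF R(1,2) d]] by blast
qed

lemma convergent_step_approx_value:
  assumes B: "B \<in> sets N" "emeasure N B < \<infinity>" and a: "a \<in> A"
    and conv: "\<And>d. d \<in> D \<Longrightarrow> convergent (\<lambda>n. pair n (step B d))"
  shows "convergent (\<lambda>n. pair n (step B a))"
proof (rule pair_convergent_closed[OF simple_Lp_A[OF simple_step[OF B a]]])
  fix \<delta> :: real assume \<delta>: "0 < \<delta>"
  \<comment> \<open>The radius at which replacing the value on \<open>B\<close> costs at most
    \<open>\<delta>\<close>; the \<open>+ 1\<close> covers null sets \<open>B\<close>.\<close>
  define c where "c = (\<delta> / (measure N B + 1)) powr (1 / q)"
  have m: "0 < measure N B + 1" by (intro add_nonneg_pos) auto
  have c: "0 < c" using \<delta> m by (auto simp: c_def)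
  have cq: "c powr q = \<delta> / (measure N B + 1)" using \<delta> m p by (simp add: c_def powr_powr)
  obtain d where d: "d \<in> D" "dist d a < c" using D(3) a c closure_approachable by blast
  have dA: "d \<in> A" using d D(2) by blast
  have "close \<delta> (step B a) (step B d)"
  proof (rule close_indicator[OF B])
    have "c powr q * measure N B \<le> c powr q * (measure N B + 1)" by (intro mult_left_mono) auto
    also have "\<dots> = \<delta>" using m by (simp add: cq)
    finally show "c powr q * measure N B \<le> \<delta>" .
    show "norm (step B a x - step B d x) \<le> indicator B x * c" for x
      using d(2) by (auto simp: step_def dist_norm norm_minus_commute split: split_indicator)
  qed (use c in simp)
  then show "\<exists>\<phi>. Lp_A N q A \<phi> \<and> close \<delta> (step B a) \<phi> \<and> convergent (\<lambda>n. pair n \<phi>)"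
    using conv[OF d(1)] simple_Lp_A[OF simple_step[OF B dA]] by blast
qed

section \<open>Convergence of the energies\<close>

lemma energy_step:
  assumes B: "B \<in> sets N" "emeasure N B < \<infinity>" and a: "a \<in> A"
  shows "(\<lambda>n. \<integral>x. norm (apply_bcontfun (step B a x) (h n x)) powr q \<partial>N) \<longlonglongrightarrow>
    (\<integral>z. norm (hat (step B a) z) powr q \<partial>(N \<Otimes>\<^sub>M \<beta>))"
proof -
  \<comment> \<open>\<open>b\<close> is \<open>|a|^q\<close>. Its mean value tested against the
    indicator of \<open>B\<close> has the energy of the trace on the left; on the right Fubini turns
    the product of integrals into the energy of the transform.\<close>
  obtain b where b: "b \<in> A" "\<And>y. apply_bcontfun b y = complex_of_real (norm (apply_bcontfun a y) powr q)"
    "\<And>s. s \<in> spectrum_set A \<Longrightarrow> s b = complex_of_real (norm (s a) powr q)"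
    using norm_powr_mem[OF a q(2)] by blast
  have iB: "integrable N (indicator B :: 'x \<Rightarrow> real)" using B by simp
  then have iB': "integrable N (\<lambda>x. complex_of_real (indicator B x))" by simp
  have L: "(\<integral>x. apply_bcontfun b (h n x) * complex_of_real (indicator B x) \<partial>N) =
     complex_of_real (\<integral>x. norm (apply_bcontfun (step B a x) (h n x)) powr q \<partial>N)" for n
    unfolding integral_complex_of_real[symmetric]
    by (intro Bochner_Integration.integral_cong refl)
      (auto simp: b step_def scaleR_bcontfun.rep_eq split: split_indicator)
  have m: "(\<lambda>s. s a) \<in> borel_measurable \<beta>" by (rule evaluation_measurable[OF a])
  interpret \<beta>: finite_measure \<beta> by (rule finite_\<beta>)
  have i\<beta>: "integrable \<beta> (\<lambda>s. norm (s a) powr q)"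
  proof (rule \<beta>.integrable_const_bound[where B = "norm a powr q"])
    show "AE s in \<beta>. norm (norm (s a) powr q) \<le> norm a powr q"
      using q s_norm_le[OF _ a] by (intro AE_I2) (auto simp: space_\<beta> intro: powr_mono2)
  qed (use m in measurable)
  have R1: "(\<integral>s. s b \<partial>\<beta>) = complex_of_real (\<integral>s. norm (s a) powr q \<partial>\<beta>)"
    unfolding integral_complex_of_real[symmetric]
    by (intro Bochner_Integration.integral_cong refl) (simp add: b(3) space_\<beta>)
  have R2: "(\<integral>x. complex_of_real (indicator B x) \<partial>N) = complex_of_real (\<integral>x. indicator B x \<partial>N)"
    by (rule integral_complex_of_real)
  have "(\<integral>z. norm (hat (step B a) z) powr q \<partial>(N \<Otimes>\<^sub>M \<beta>)) =
     (\<integral>z. indicator B (fst z) * norm (snd z a) powr q \<partial>(N \<Otimes>\<^sub>M \<beta>))"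
  proof (intro Bochner_Integration.integral_cong refl)
    fix z assume "z \<in> space (N \<Otimes>\<^sub>M \<beta>)"
    then have "snd z \<in> spectrum_set A" using space_pair by blast
    then show "norm (hat (step B a) z) powr q = indicator B (fst z) * norm (snd z a) powr q"
      by (auto simp: hat_def step_def s_zero split: split_indicator)
  qed
  also have "\<dots> = (\<integral>x. indicator B x \<partial>N) * (\<integral>s. norm (s a) powr q \<partial>\<beta>)"
    by (rule integral_product(2)[OF iB i\<beta>])
  finally have R: "(\<integral>s. s b \<partial>\<beta>) * (\<integral>x. complex_of_real (indicator B x) \<partial>N) =
     complex_of_real (\<integral>z. norm (hat (step B a) z) powr q \<partial>(N \<Otimes>\<^sub>M \<beta>))"
    unfolding R1 R2 by (simp add: mult.commute)
  show ?thesis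
    using mean_value[OF b(1) iB'] unfolding L R by (simp only: tendsto_of_real_iff)
qed

text \<open>The means of \<open>\<bar>\<psi>\<bar>\<^sup>q\<close> converge because the algebra is stable under \<open>a \<mapsto> \<bar>a\<bar>\<^sup>q\<close>.\<close>
lemma energy_simple:
  assumes \<psi>: "simple \<psi>"
  shows "(\<lambda>n. \<integral>x. norm (apply_bcontfun (\<psi> x) (h n x)) powr q \<partial>N) \<longlonglongrightarrow>
    (\<integral>z. norm (hat \<psi> z) powr q \<partial>(N \<Otimes>\<^sub>M \<beta>))"
proof -
  let ?V = "\<psi> ` space N - {0}" and ?B = "\<lambda>a. {y \<in> space N. \<psi> y = a}"
  have s: "Lp_A N q A (step (?B a) a)" if "a \<in> ?V" for a
    using simple_pieces[OF \<psi> that] by (intro simple_Lp_A simple_step)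
  have L: "(\<integral>x. norm (apply_bcontfun (\<psi> x) (h n x)) powr q \<partial>N) =
    (\<Sum>a\<in>?V. \<integral>x. norm (apply_bcontfun (step (?B a) a x) (h n x)) powr q \<partial>N)" for n
  proof -
    have "(\<integral>x. norm (apply_bcontfun (\<psi> x) (h n x)) powr q \<partial>N) =
      (\<integral>x. (\<Sum>a\<in>?V. norm (apply_bcontfun (step (?B a) a x) (h n x)) powr q) \<partial>N)"
      using simple_decomposition[OF \<psi>, where F = "\<lambda>b. norm (apply_bcontfun b (h n _)) powr q"]
      by (intro Bochner_Integration.integral_cong refl) simp
    also have "\<dots> = (\<Sum>a\<in>?V. \<integral>x. norm (apply_bcontfun (step (?B a) a x) (h n x)) powr q \<partial>N)"
      using trace_Lp[OF s] by (intro Bochner_Integration.integral_sum) (simp add: Lp_def)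
    finally show ?thesis .
  qed
  have "(\<integral>z. norm (hat \<psi> z) powr q \<partial>(N \<Otimes>\<^sub>M \<beta>)) =
      (\<integral>z. (\<Sum>a\<in>?V. norm (hat (step (?B a) a) z) powr q) \<partial>(N \<Otimes>\<^sub>M \<beta>))"
  proof (intro Bochner_Integration.integral_cong refl)
    fix z assume "z \<in> space (N \<Otimes>\<^sub>M \<beta>)"
    then have "fst z \<in> space N" "snd z \<in> spectrum_set A" using space_pair by blast+
    then show "norm (hat \<psi> z) powr q = (\<Sum>a\<in>?V. norm (hat (step (?B a) a) z) powr q)"
      unfolding hat_def
      by (intro simple_decomposition[OF \<psi>, where F = "\<lambda>b. norm (snd z b) powr q"]) (auto simp: s_zero)
  qed
  also have "\<dots> = (\<Sum>a\<in>?V. \<integral>z. norm (hat (step (?B a) a) z) powr q \<partial>(N \<Otimes>\<^sub>M \<beta>))"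
    using hat_Lp[OF s] by (intro Bochner_Integration.integral_sum) (simp add: Lp_def)
  finally show ?thesis
    unfolding L using simple_pieces[OF \<psi>] by (auto intro!: tendsto_sum energy_step)
qed

section \<open>Linearity and bounds of the pairings\<close>

lemma simple_add: "simple \<psi> \<Longrightarrow> simple \<phi> \<Longrightarrow> simple (\<lambda>x. \<psi> x + \<phi> x)"
  unfolding simple_def by (auto intro: add simple_bochner_integrable_compose2[where p = "(+)"])

lemma simple_scale:
  assumes "simple \<psi>" shows "simple (\<lambda>x. scale c (\<psi> x))"
proof -
  have 0: "scale c 0 = 0"
    by (rule bcontfun_eqI) (simp add: apply_scale[OF zero])
  have s: "Bochner_Integration.simple_bochner_integrable N \<psi>" using assms by (simp add: simple_def)
  have "Bochner_Integration.simple_bochner_integrable N (\<lambda>x. scale c (\<psi> x))"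
    by (rule simple_bochner_integrable_compose2[where p = "\<lambda>a b. scale c a", OF 0 s s])
  then show ?thesis using assms by (auto simp: simple_def scale_mem)
qed

lemma simple_zero: "simple (\<lambda>x. 0)"
  unfolding simple_def by (auto intro!: simple_bochner_integrable.intros zero)

lemma pair_add: "Lp_A N q A \<psi> \<Longrightarrow> Lp_A N q A \<phi> \<Longrightarrow> pair n (\<lambda>x. \<psi> x + \<phi> x) = pair n \<psi> + pair n \<phi>"
  unfolding pair_def plus_bcontfun.rep_eq distrib_left
  by (intro Bochner_Integration.integral_add pair_integrable)

lemma pair_scale:
  assumes "\<And>x. x \<in> space N \<Longrightarrow> \<psi> x \<in> A"
  shows "pair n (\<lambda>x. scale c (\<psi> x)) = c * pair n \<psi>"
proof -
  have "pair n (\<lambda>x. scale c (\<psi> x)) = (\<integral>x. c * (u n x * apply_bcontfun (\<psi> x) (h n x)) \<partial>N)"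
    unfolding pair_def by (intro Bochner_Integration.integral_cong refl) (simp add: apply_scale[OF assms] mult.left_commute)
  then show ?thesis by (simp add: pair_def)
qed

text \<open>The exact factors \<open>1 / p\<close> and \<open>1 / q\<close> are kept: the second is
  the normalisation of the energy in \<open>Lq_functional_representation\<close>, and
  \<open>C / p\<close> becomes the constant \<open>K\<close> there.\<close>

lemma pair_Young:
  assumes \<psi>: "Lp_A N q A \<psi>"
  shows "norm (pair n \<psi>) \<le> C / p + (\<integral>x. norm (apply_bcontfun (\<psi> x) (h n x)) powr q \<partial>N) / q"
proof -
  have ui: "integrable N (\<lambda>x. norm (u n x) powr p)" using u_Lp by (simp add: Lp_def)
  have ti: "integrable N (\<lambda>x. norm (apply_bcontfun (\<psi> x) (h n x)) powr q)" using trace_Lp[OF \<psi>] by (simp add: Lp_def)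
  have "norm (pair n \<psi>) \<le> (\<integral>x. norm (u n x * apply_bcontfun (\<psi> x) (h n x)) \<partial>N)"
    unfolding pair_def by (rule integral_norm_bound)
  also have "\<dots> \<le> (\<integral>x. norm (u n x) powr p / p + norm (apply_bcontfun (\<psi> x) (h n x)) powr q / q \<partial>N)"
  proof (rule integral_mono)
    show "norm (u n x * apply_bcontfun (\<psi> x) (h n x)) \<le> norm (u n x) powr p / p + norm (apply_bcontfun (\<psi> x) (h n x)) powr q / q" for x
      unfolding norm_mult
    proof (rule Youngs_inequality)
      show "1 / p + 1 / q = 1" using p by (simp add: field_simps)
    qed (use p q in auto)
  qed (use pair_integrable[OF \<psi>] ui ti in \<open>auto intro!: Bochner_Integration.integrable_add integrable_divide\<close>)
  also have "\<dots> = (\<integral>x. norm (u n x) powr p \<partial>N) / p + (\<integral>x. norm (apply_bcontfun (\<psi> x) (h n x)) powr q \<partial>N) / q"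
    using ui ti by simp
  also have "\<dots> \<le> C / p + (\<integral>x. norm (apply_bcontfun (\<psi> x) (h n x)) powr q \<partial>N) / q"
    using u_bound[of n] p by (intro add_mono divide_right_mono) auto
  finally show ?thesis .
qed

lemma pair_bounded:
  assumes \<psi>: "Lp_A N q A \<psi>" shows "bounded (range (\<lambda>n. pair n \<psi>))"
proof (rule boundedI)
  fix z assume "z \<in> range (\<lambda>n. pair n \<psi>)"
  then obtain n where "z = pair n \<psi>" by blast
  moreover have "(\<integral>x. norm (apply_bcontfun (\<psi> x) (h n x)) powr q \<partial>N) \<le> (\<integral>x. norm (\<psi> x) powr q \<partial>N)"
    by (rule dominated_Lq(2)[OF trace_measurable[OF Lp_A_D(1,2)[OF \<psi>]] Lp_A_D(3)[OF \<psi>]])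
      (auto simp: norm_apply_bcontfun_le)
  then have "(\<integral>x. norm (apply_bcontfun (\<psi> x) (h n x)) powr q \<partial>N) / q \<le> (\<integral>x. norm (\<psi> x) powr q \<partial>N) / q"
    using q by (intro divide_right_mono) auto
  ultimately show "norm z \<le> C / p + (\<integral>x. norm (\<psi> x) powr q \<partial>N) / q"
    using pair_Young[OF \<psi>, of n] by simp
qed

lemma subsequence:
  assumes r: "strict_mono r"
  shows "sigma_setting A N D \<beta> p C (\<lambda>n. h (r n)) (\<lambda>n. u (r n))"
proof unfold_locales
  show "(\<lambda>n. \<integral>x. apply_bcontfun a (h (r n) x) * f x \<partial>N) \<longlonglongrightarrow> (\<integral>s. s a \<partial>\<beta>) * (\<integral>x. f x \<partial>N)"
    if "a \<in> A" "integrable N f" for a and f :: "'x \<Rightarrow> complex"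
    using LIMSEQ_subseq_LIMSEQ[OF mean_value[OF that] r] by (simp add: o_def)
qed (rule D p sets_\<beta> prob_\<beta> comp_measurable u_Lp u_bound, assumption?)+

end

section \<open>The limit functional along a convergent subsequence and its representation\<close>

locale sigma_convergent = sigma_setting +
  fixes \<R> :: "'a set set"
  assumes \<R>: "\<R> \<subseteq> sets N" "\<And>R. R \<in> \<R> \<Longrightarrow> emeasure N R < \<infinity>"
      "\<And>B e. B \<in> sets N \<Longrightarrow> emeasure N B < \<infinity> \<Longrightarrow> 0 < e \<Longrightarrow> \<exists>R\<in>\<R>. measure N ((B - R) \<union> (R - B)) < e"
    and convergent_step: "\<And>R d. R \<in> \<R> \<Longrightarrow> d \<in> D \<Longrightarrow> convergent (\<lambda>n. pair n (step R d))"
begin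

text \<open>Convergence is given only for sets in \<open>\<R>\<close> and values in
  \<open>D\<close>. It extends first to all sets of finite measure, then to all values in
  \<open>A\<close>, and then to finite sums.\<close>

lemma convergent_simple:
  assumes \<psi>: "simple \<psi>" shows "convergent (\<lambda>n. pair n \<psi>)"
proof -
  have D: "convergent (\<lambda>n. pair n (step B d))" if B: "B \<in> sets N" "emeasure N B < \<infinity>" and d: "d \<in> D" for B d
  proof (rule convergent_step_approx_set[OF B])
    show "d \<in> A" using d D(2) by blast
    fix e :: real assume "0 < e"
    then obtain R where "R \<in> \<R>" "measure N ((B - R) \<union> (R - B)) < e" using \<R>(3)[OF B] by blast
    then show "\<exists>R\<in>sets N. emeasure N R < \<infinity> \<and> measure N ((B - R) \<union> (R - B)) < e \<and> convergent (\<lambda>n. pair n (step R d))"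
      using \<R>(1,2) convergent_step[OF _ d] by blast
  qed
  have *: "convergent (\<lambda>n. pair n (step {y \<in> space N. \<psi> y = a} a))" if a: "a \<in> \<psi> ` space N - {0}" for a
    by (rule convergent_step_approx_value[OF simple_pieces[OF \<psi> a] D[OF simple_pieces(1,2)[OF \<psi> a]]])
  show ?thesis unfolding pair_simple[OF \<psi>] by (rule convergent_sum) (rule *)
qed

lemma convergent_pair:
  assumes \<psi>: "Lp_A N q A \<psi>" shows "convergent (\<lambda>n. pair n \<psi>)"
proof (rule pair_convergent_closed[OF \<psi>])
  fix \<delta> :: real assume "0 < \<delta>"
  then obtain \<phi> where "simple \<phi>" "close \<delta> \<psi> \<phi>" using Lp_A_approx_simple[OF \<psi>] by blast
  then show "\<exists>\<phi>. Lp_A N q A \<phi> \<and> close \<delta> \<psi> \<phi> \<and> convergent (\<lambda>n. pair n \<phi>)"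
    using convergent_simple simple_Lp_A by blast
qed

definition limit :: "('a \<Rightarrow> 'a \<Rightarrow>\<^sub>C complex) \<Rightarrow> complex" where
  "limit \<psi> = lim (\<lambda>n. pair n \<psi>)"

lemma pair_tendsto_limit: "Lp_A N q A \<psi> \<Longrightarrow> (\<lambda>n. pair n \<psi>) \<longlonglongrightarrow> limit \<psi>"
  unfolding limit_def using convergent_pair by (simp add: convergent_LIMSEQ_iff)

lemma limit_add:
  assumes "simple \<psi>" "simple \<phi>" shows "limit (\<lambda>x. \<psi> x + \<phi> x) = limit \<psi> + limit \<phi>"
proof -
  have "(\<lambda>n. pair n (\<lambda>x. \<psi> x + \<phi> x)) \<longlonglongrightarrow> limit \<psi> + limit \<phi>"
    unfolding pair_add[OF assms[THEN simple_Lp_A]] by (intro tendsto_add pair_tendsto_limit simple_Lp_A assms)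
  then show ?thesis unfolding limit_def by (rule limI)
qed

lemma limit_scale:
  assumes "simple \<psi>" shows "limit (\<lambda>x. scale c (\<psi> x)) = c * limit \<psi>"
proof -
  have "pair n (\<lambda>x. scale c (\<psi> x)) = c * pair n \<psi>" for n
    using assms by (intro pair_scale) (simp add: simple_def)
  then have "(\<lambda>n. pair n (\<lambda>x. scale c (\<psi> x))) \<longlonglongrightarrow> c * limit \<psi>"
    using tendsto_mult[OF tendsto_const pair_tendsto_limit[OF simple_Lp_A[OF assms]], of c] by simp
  then show ?thesis unfolding limit_def by (rule limI)
qed

text \<open>In the limit of \<open>pair_Young\<close> the traces give way to the transform, so the
  bound sees \<open>\<psi>\<close> only through \<open>hat \<psi>\<close> in \<open>L^q\<close> of
  the product. This is the hypothesis \<open>bound\<close> of the representation lemma.\<close>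

lemma limit_bound:
  assumes \<psi>: "simple \<psi>"
  shows "Re (limit \<psi>) \<le> C / p + (\<integral>z. norm (hat \<psi> z) powr q \<partial>(N \<Otimes>\<^sub>M \<beta>)) / q"
proof (rule LIMSEQ_le)
  show "(\<lambda>n. Re (pair n \<psi>)) \<longlonglongrightarrow> Re (limit \<psi>)"
    by (intro tendsto_Re pair_tendsto_limit simple_Lp_A \<psi>)
  show "(\<lambda>n. C / p + (\<integral>x. norm (apply_bcontfun (\<psi> x) (h n x)) powr q \<partial>N) / q) \<longlonglongrightarrow>
      C / p + (\<integral>z. norm (hat \<psi> z) powr q \<partial>(N \<Otimes>\<^sub>M \<beta>)) / q"
    using q by (intro tendsto_intros energy_simple[OF \<psi>]) auto
  show "\<exists>N'. \<forall>n\<ge>N'. Re (pair n \<psi>) \<le> C / p + (\<integral>x. norm (apply_bcontfun (\<psi> x) (h n x)) powr q \<partial>N) / q"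
    by (intro exI[of _ 0] allI impI order_trans[OF complex_Re_le_cmod pair_Young[OF simple_Lp_A[OF \<psi>]]])
qed

lemma hat_scale:
  assumes "z \<in> space (N \<Otimes>\<^sub>M \<beta>)" "simple \<psi>"
  shows "hat (\<lambda>x. scale c (\<psi> x)) z = c * hat \<psi> z"
proof -
  have z: "snd z \<in> spectrum_set A" "\<psi> (fst z) \<in> A" using space_pair[OF assms(1)] assms(2) by (auto simp: simple_def)
  show ?thesis unfolding hat_def
    by (rule s_scale[OF z scale_mem[OF z(2)]]) (rule apply_scale[OF z(2)])
qed

lemma limit_representation:
  obtains u0 where "Lp (N \<Otimes>\<^sub>M \<beta>) p u0" "\<And>\<psi>. simple \<psi> \<Longrightarrow> (\<integral>z. u0 z * hat \<psi> z \<partial>(N \<Otimes>\<^sub>M \<beta>)) = limit \<psi>"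
proof -
  let ?M = "N \<Otimes>\<^sub>M \<beta>"
  \<comment> \<open>Agreement with \<open>hat \<psi>\<close> is asked only on the space of the
    product, where the second component is a character and hence linear on \<open>A\<close>. This
    keeps \<open>P\<close> stable under sums and multiples.\<close>
  define P where "P = {(w, c). w \<in> borel_measurable ?M \<and> (\<exists>\<psi>. simple \<psi> \<and> (\<forall>z\<in>space ?M. w z = hat \<psi> z) \<and> c = Re (limit \<psi>))}"
  have hat_eq: "(\<integral>z. norm (w z) powr q \<partial>?M) = (\<integral>z. norm (hat \<psi> z) powr q \<partial>?M)"
    if "\<forall>z\<in>space ?M. w z = hat \<psi> z" for w \<psi>
    using that by (intro Bochner_Integration.integral_cong) auto
  have hatP: "(hat \<psi>, Re (limit \<psi>)) \<in> P" if "simple \<psi>" for \<psi>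
    using that hat_Lp[OF simple_Lp_A[OF that]] by (auto simp: P_def Lp_def)
  obtain u0 where u0: "Lp ?M (q / (q - 1)) u0" "\<And>w c. (w, c) \<in> P \<Longrightarrow> (\<integral>z. Re (u0 z * w z) \<partial>?M) = c"
  proof (rule Lq_functional_representation[OF q(1), of P ?M "C / p"])
    show "P \<noteq> {}" using hatP[OF simple_zero] by auto
    fix w c assume P: "(w, c) \<in> P"
    then obtain \<psi> where w: "w \<in> borel_measurable ?M" and \<psi>: "simple \<psi>" "\<forall>z\<in>space ?M. w z = hat \<psi> z" "c = Re (limit \<psi>)"
      by (auto simp: P_def)
    show "w \<in> borel_measurable ?M" by (rule w)
    have "integrable ?M (\<lambda>z. norm (hat \<psi> z) powr q)" using hat_Lp[OF simple_Lp_A[OF \<psi>(1)]] by (simp add: Lp_def)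
    then show "integrable ?M (\<lambda>z. norm (w z) powr q)"
      by (rule Bochner_Integration.integrable_cong[THEN iffD1, rotated -1]) (use \<psi>(2) in auto)
    show "c \<le> C / p + (\<integral>z. norm (w z) powr q \<partial>?M) / q"
      unfolding hat_eq[OF \<psi>(2)] \<psi>(3) by (rule limit_bound[OF \<psi>(1)])
    show "((\<lambda>z. complex_of_real t * w z), t * c) \<in> P" for t
    proof -
      have "(\<lambda>z. complex_of_real t * w z) \<in> borel_measurable ?M" using w by simp
      moreover have "simple (\<lambda>x. scale (complex_of_real t) (\<psi> x))" by (rule simple_scale[OF \<psi>(1)])
      moreover have "\<forall>z\<in>space ?M. complex_of_real t * w z = hat (\<lambda>x. scale (complex_of_real t) (\<psi> x)) z"
        using \<psi>(2) hat_scale[OF _ \<psi>(1)] by simp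
      moreover have "t * c = Re (limit (\<lambda>x. scale (complex_of_real t) (\<psi> x)))"
        by (simp add: limit_scale[OF \<psi>(1)] \<psi>(3))
      ultimately show ?thesis unfolding P_def by blast
    qed
    fix w' c' assume "(w', c') \<in> P"
    then obtain \<phi> where w': "w' \<in> borel_measurable ?M" and \<phi>: "simple \<phi>" "\<forall>z\<in>space ?M. w' z = hat \<phi> z" "c' = Re (limit \<phi>)"
      by (auto simp: P_def)
    have "(\<lambda>z. w z + w' z) \<in> borel_measurable ?M" using w w' by simp
    moreover have "simple (\<lambda>x. \<psi> x + \<phi> x)" by (rule simple_add[OF \<psi>(1) \<phi>(1)])
    moreover have "w z + w' z = hat (\<lambda>x. \<psi> x + \<phi> x) z" if z: "z \<in> space ?M" for z
    proof -
      have "snd z \<in> spectrum_set A" "\<psi> (fst z) \<in> A" "\<phi> (fst z) \<in> A"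
        using space_pair[OF z] \<psi>(1) \<phi>(1) by (auto simp: simple_def)
      then have "hat (\<lambda>x. \<psi> x + \<phi> x) z = hat \<psi> z + hat \<phi> z" unfolding hat_def by (rule s_add)
      then show ?thesis using \<psi>(2) \<phi>(2) z by simp
    qed
    moreover have "c + c' = Re (limit (\<lambda>x. \<psi> x + \<phi> x))" by (simp add: limit_add[OF \<psi>(1) \<phi>(1)] \<psi>(3) \<phi>(3))
    ultimately show "((\<lambda>z. w z + w' z), c + c') \<in> P" unfolding P_def by blast
  qed blast
  have u0p: "Lp ?M p u0" using u0(1) unfolding q(3) .
  show thesis
  proof (rule that[OF u0p])
    fix \<psi> assume \<psi>: "simple \<psi>"
    have i: "integrable ?M (\<lambda>z. u0 z * hat \<psi> z)"
      by (rule Lp_pairing_integrable[OF p u0p hat_Lp[OF simple_Lp_A[OF \<psi>]]])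
    have "Re (\<integral>z. u0 z * hat \<psi> z \<partial>?M) = (\<integral>z. Re (u0 z * hat \<psi> z) \<partial>?M)" using i by (simp del: times_complex.sel)
    then have re: "Re (\<integral>z. u0 z * hat \<psi> z \<partial>?M) = Re (limit \<psi>)"
      using u0(2)[OF hatP[OF \<psi>]] by simp
    \<comment> \<open>The graph \<open>P\<close> records only real parts; the imaginary part is
      recovered from the test function \<open>\<i> * \<psi>\<close>.\<close>
    have "- Im (\<integral>z. u0 z * hat \<psi> z \<partial>?M) = - (\<integral>z. Im (u0 z * hat \<psi> z) \<partial>?M)" using i by (simp del: times_complex.sel)
    also have "\<dots> = (\<integral>z. Re (u0 z * hat (\<lambda>x. scale \<i> (\<psi> x)) z) \<partial>?M)"
      unfolding Bochner_Integration.integral_minus[symmetric]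
      by (intro Bochner_Integration.integral_cong refl) (simp add: hat_scale[OF _ \<psi>])
    also have "\<dots> = - Im (limit \<psi>)"
      using u0(2)[OF hatP[OF simple_scale[OF \<psi>, of \<i>]]] by (simp add: limit_scale[OF \<psi>])
    finally show "(\<integral>z. u0 z * hat \<psi> z \<partial>?M) = limit \<psi>" using re by (simp add: complex_eq_iff)
  qed
qed

lemma weak_limit:
  obtains u0 where "Lp (N \<Otimes>\<^sub>M \<beta>) p u0"
    "\<And>\<psi>. Lp_A N q A \<psi> \<Longrightarrow> (\<lambda>n. pair n \<psi>) \<longlonglongrightarrow> (\<integral>z. u0 z * hat \<psi> z \<partial>(N \<Otimes>\<^sub>M \<beta>))"
proof -
  let ?M = "N \<Otimes>\<^sub>M \<beta>"
  obtain u0 where u0: "Lp ?M p u0" "\<And>\<psi>. simple \<psi> \<Longrightarrow> (\<integral>z. u0 z * hat \<psi> z \<partial>?M) = limit \<psi>"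
    using limit_representation by blast
  have "limit \<psi> = (\<integral>z. u0 z * hat \<psi> z \<partial>?M)" if \<psi>: "Lp_A N q A \<psi>" for \<psi>
  proof -
    have "norm (limit \<psi> - (\<integral>z. u0 z * hat \<psi> z \<partial>?M)) \<le> 0 + e" if e: "0 < e" for e
    proof -
      have e2: "0 < e / 2" using e by simp
      obtain \<delta>1 where \<delta>1: "0 < \<delta>1" "\<And>\<psi> \<phi> n. Lp_A N q A \<psi> \<Longrightarrow> Lp_A N q A \<phi> \<Longrightarrow> close \<delta>1 \<psi> \<phi> \<Longrightarrow>
          norm (pair n \<psi> - pair n \<phi>) \<le> e / 2" using pair_close[OF e2] by blast
      obtain \<delta>2 where \<delta>2: "0 < \<delta>2" "\<And>f g :: _ \<Rightarrow> complex. Lp ?M p f \<Longrightarrow>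
          (\<integral>x. norm (f x) powr p \<partial>?M) \<le> (\<integral>x. norm (u0 x) powr p \<partial>?M) \<Longrightarrow>
          Lp ?M q g \<Longrightarrow> (\<integral>x. norm (g x) powr q \<partial>?M) \<le> \<delta>2 \<Longrightarrow> norm (\<integral>x. f x * g x \<partial>?M) \<le> e / 2"
        using Lp_pairing_small[OF p e2] by blast
      \<comment> \<open>One simple \<open>\<phi>\<close> has to approximate on both sides:
        \<open>\<delta>1\<close> controls the limits of the pairings, \<open>\<delta>2\<close> the
        integral against \<open>u0\<close>.\<close>
      have "0 < min \<delta>1 \<delta>2" using \<delta>1 \<delta>2 by simp
      then obtain \<phi> where \<phi>: "simple \<phi>" "close (min \<delta>1 \<delta>2) \<psi> \<phi>" using Lp_A_approx_simple[OF \<psi>] by blast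
      have \<phi>A: "Lp_A N q A \<phi>" by (rule simple_Lp_A[OF \<phi>(1)])
      obtain G where G: "integrable N (\<lambda>x. G x powr q)" "(\<integral>x. G x powr q \<partial>N) \<le> min \<delta>1 \<delta>2"
        "\<And>x. x \<in> space N \<Longrightarrow> norm (\<psi> x - \<phi> x) \<le> G x" using \<phi>(2) by (auto simp: close_def)
      have cl: "close \<delta>1 \<psi> \<phi>" unfolding close_def using G by (intro exI[of _ G]) auto
      have 1: "norm (limit \<psi> - limit \<phi>) \<le> e / 2"
        by (intro LIMSEQ_le_const2[OF tendsto_norm[OF tendsto_diff[OF pair_tendsto_limit[OF \<psi>] pair_tendsto_limit[OF \<phi>A]]]])
          (intro exI[of _ 0] allI impI \<delta>1(2)[OF \<psi> \<phi>A cl])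
      let ?g = "\<lambda>z. hat \<phi> z - hat \<psi> z"
      have gm: "?g \<in> borel_measurable ?M"
        by (rule borel_measurable_diff[OF hat_measurable[OF Lp_A_D(1,2)[OF \<phi>A]] hat_measurable[OF Lp_A_D(1,2)[OF \<psi>]]])
      have gG: "norm (?g z) \<le> G (fst z)" if "z \<in> space ?M" for z
      proof -
        have z: "fst z \<in> space N" "snd z \<in> spectrum_set A" using space_pair[OF that] by auto
        have "norm (?g z) \<le> norm (\<phi> (fst z) - \<psi> (fst z))"
          unfolding hat_def by (rule s_norm_diff_le[OF z(2) Lp_A_D(2)[OF \<phi>A z(1)] Lp_A_D(2)[OF \<psi> z(1)]])
        also have "\<dots> = norm (\<psi> (fst z) - \<phi> (fst z))" by (rule norm_minus_commute)
        also have "\<dots> \<le> G (fst z)" by (rule G(3)[OF z(1)])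
        finally show ?thesis .
      qed
      have "limit \<phi> - (\<integral>z. u0 z * hat \<psi> z \<partial>?M) = (\<integral>z. u0 z * ?g z \<partial>?M)"
        unfolding u0(2)[OF \<phi>(1), symmetric] right_diff_distrib
        by (rule Bochner_Integration.integral_diff[symmetric, OF Lp_pairing_integrable[OF p u0(1) hat_Lp[OF \<phi>A]]
              Lp_pairing_integrable[OF p u0(1) hat_Lp[OF \<psi>]]])
      moreover have "norm (\<integral>z. u0 z * ?g z \<partial>?M) \<le> e / 2"
        using dominated_Lq_product[OF gm G(1) gG] G(2) by (intro \<delta>2(2) u0(1)) auto
      ultimately have "norm (limit \<phi> - (\<integral>z. u0 z * hat \<psi> z \<partial>?M)) \<le> e / 2" by simp
      with 1 show ?thesis
        using norm_triangle_ineq[of "limit \<psi> - limit \<phi>" "limit \<phi> - (\<integral>z. u0 z * hat \<psi> z \<partial>?M)"] by simp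
    qed
    then have "norm (limit \<psi> - (\<integral>z. u0 z * hat \<psi> z \<partial>?M)) \<le> 0" by (rule field_le_epsilon)
    then show ?thesis by simp
  qed
  then show thesis using that[OF u0(1)] pair_tendsto_limit by simp
qed

end

section \<open>Homogenizers\<close>

text \<open>The hypothesis is multiplied by \<open>mul a (ginv b)\<close>. With \<open>b\<close> a
  large integer, this produces elements of \<open>E\<close> below any prescribed
  \<open>a\<close>.\<close>

lemma R_group_inverse_antimono:
  assumes G: "R_group E mul one ginv" and a: "a \<in> E" "b \<in> E" and le: "ginv a \<le> b"
  shows "ginv b \<le> a"
proof -
  have mem: "mul x y \<in> E" "ginv x \<in> E" if "x \<in> E" "y \<in> E" for x y
    using G that unfolding R_group_def by blast+
  have assoc: "mul (mul x y) z = mul x (mul y z)" if "x \<in> E" "y \<in> E" "z \<in> E" for x y z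
    using G that unfolding R_group_def by blast
  have comm: "mul x y = mul y x" if "x \<in> E" "y \<in> E" for x y
    using G that unfolding R_group_def by blast
  have one: "one \<in> E" "mul one x = x" "mul (ginv x) x = one" if "x \<in> E" for x
    using G that unfolding R_group_def by blast+
  have mono: "mul x z \<le> mul y z" if "x \<in> E" "y \<in> E" "z \<in> E" "x \<le> y" for x y z
    using G that unfolding R_group_def by blast
  have "mul (ginv a) (mul a (ginv b)) \<le> mul b (mul a (ginv b))"
    by (rule mono) (use a mem le in auto)
  also have "mul (ginv a) (mul a (ginv b)) = ginv b"
    using a mem by (simp add: one flip: assoc)
  also have "mul b (mul a (ginv b)) = mul a (mul (ginv b) b)"
    using a mem assoc comm by metis
  also have "\<dots> = a" using a one comm by metis
  finally show ?thesis .
qed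

lemma R_group_inverse_inverse:
  assumes G: "R_group E mul one ginv" and a: "a \<in> E"
  shows "ginv (ginv a) = a"
proof -
  have mem: "mul x y \<in> E" "ginv x \<in> E" if "x \<in> E" "y \<in> E" for x y
    using G that unfolding R_group_def by blast+
  have assoc: "mul (mul x y) z = mul x (mul y z)" if "x \<in> E" "y \<in> E" "z \<in> E" for x y z
    using G that unfolding R_group_def by blast
  have comm: "mul x y = mul y x" if "x \<in> E" "y \<in> E" for x y
    using G that unfolding R_group_def by blast
  have one: "one \<in> E" "mul one x = x" "mul (ginv x) x = one" if "x \<in> E" for x
    using G that unfolding R_group_def by blast+
  have "mul (mul (ginv (ginv a)) (ginv a)) a = mul (ginv (ginv a)) (mul (ginv a) a)"
    by (rule assoc) (use a mem in auto)
  then have "a = mul (ginv (ginv a)) one"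
    using one(2,3)[OF a] one(3)[OF mem(2)[OF a a]] by simp
  also have "\<dots> = ginv (ginv a)" using a mem one comm by metis
  finally show ?thesis by simp
qed

lemma homogenizer_continuous_on:
  assumes "homogenizer E mul one ginv H lam" "a \<in> E"
  shows "continuous_on UNIV (H a)"
proof -
  have "continuous_on (E \<times> UNIV) (\<lambda>(a, x). H a x)"
    using assms by (simp add: homogenizer_def continuous_action_def)
  moreover have "continuous_on UNIV (\<lambda>x. (a, x))" by (intro continuous_intros)
  ultimately have "continuous_on UNIV (\<lambda>x. (\<lambda>(a, x). H a x) (a, x))"
    by (rule continuous_on_compose2) (use assms in auto)
  then show ?thesis by simp
qed

text \<open>The integers are cofinal in \<open>E\<close>, so the inverse images under \<open>H n\<close> of a compact
  neighbourhood of the center cover the space.\<close>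
lemma homogenizer_sigma_compact:
  fixes H :: "real \<Rightarrow> 'x::metric_space \<Rightarrow> 'x"
  assumes hom: "homogenizer E mul one ginv H lam"
  obtains K :: "nat \<Rightarrow> 'x set" where "\<And>n. compact (K n)" "(\<Union>n. K n) = UNIV"
proof -
  have G: "R_group E mul one ginv" and act: "action E mul one H"
    using hom by (auto simp: homogenizer_def)
  obtain \<omega> where \<omega>: "absorption_center E ginv H \<omega>" using hom by (auto simp: homogenizer_def)
  have "locally_compact_space (euclidean :: 'x topology)" using hom by (simp add: homogenizer_def)
  then have "\<forall>x::'x. \<exists>U. open U \<and> (\<exists>C. compact C \<and> x \<in> U \<and> U \<subseteq> C)"
    by (simp add: locally_compact_space_def)
  then obtain V C where V: "open V" "compact C" "\<omega> \<in> V" "V \<subseteq> C"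
    by blast
  have nE: "real (Suc n) \<in> E" for n using G unfolding R_group_def by (metis Suc_le_mono le0 One_nat_def)
  have gE: "ginv a \<in> E" if "a \<in> E" for a using G that unfolding R_group_def by blast
  \<comment> \<open>The preimage of \<open>C\<close> under \<open>H (Suc n)\<close>, written as an
    image under the inverse map and therefore compact. The successor is used because positive
    integers are the ones known to lie in \<open>E\<close>.\<close>
  define K where "K n = H (ginv (real (Suc n))) ` C" for n
  have "compact (K n)" for n
    unfolding K_def
    by (intro compact_continuous_image continuous_on_subset[OF homogenizer_continuous_on[OF hom gE[OF nE]]] V) auto
  moreover have "x \<in> (\<Union>n. K n)" for x
  proof -
    obtain U \<alpha> where U: "x \<in> U" "\<alpha> \<in> E" "\<And>\<epsilon>. \<epsilon> \<in> E \<Longrightarrow> \<epsilon> \<le> \<alpha> \<Longrightarrow> H (ginv \<epsilon>) ` U \<subseteq> V"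
      using \<omega> V unfolding absorption_center_def by meson
    obtain n :: nat where n: "ginv \<alpha> \<le> real n" using real_arch_simple by blast
    \<comment> \<open>In the absorption property \<open>\<epsilon>\<close> is the inverse of
      \<open>Suc n\<close>, so that the map carrying \<open>x\<close> into \<open>V\<close> is
      \<open>H (Suc n)\<close> itself.\<close>
    then have "ginv (real (Suc n)) \<le> \<alpha>"
      by (intro R_group_inverse_antimono[OF G U(2) nE]) simp
    then have "H (ginv (ginv (real (Suc n)))) x \<in> V" using U gE[OF nE] by blast
    then have 1: "H (real (Suc n)) x \<in> C" unfolding R_group_inverse_inverse[OF G nE] using V by blast
    have "H (ginv (real (Suc n))) \<circ> H (real (Suc n)) = H (mul (ginv (real (Suc n))) (real (Suc n)))"
      using act gE[OF nE] nE unfolding action_def by blast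
    also have "mul (ginv (real (Suc n))) (real (Suc n)) = one" using G nE unfolding R_group_def by blast
    also have "H one = id" using act unfolding action_def by blast
    finally have "H (ginv (real (Suc n))) (H (real (Suc n)) x) = x" by (simp add: fun_eq_iff)
    with 1 have "x \<in> K n" unfolding K_def by (metis imageI)
    then show ?thesis by blast
  qed
  ultimately show thesis using that[of K] by blast
qed

text \<open>Each \<open>K m\<close> is totally bounded; the balls of its finite nets at all radii
  \<open>1 / Suc n\<close> are countable in number and small enough to form a base.\<close>

lemma sigma_compact_countable_base:
  fixes K :: "nat \<Rightarrow> 'x::metric_space set"
  assumes K: "\<And>n. compact (K n)" "(\<Union>n. K n) = UNIV"
  obtains \<B> where "countable \<B>" "\<And>B. B \<in> \<B> \<Longrightarrow> open B"
    "\<And>U x. open U \<Longrightarrow> x \<in> U \<Longrightarrow> \<exists>B\<in>\<B>. x \<in> B \<and> B \<subseteq> (U :: 'x set)"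
proof -
  have "\<exists>k. finite k \<and> K m \<subseteq> (\<Union>x\<in>k. ball x (1 / Suc n))" for m n
    using K(1)[of m] unfolding compact_eq_totally_bounded by (auto simp del: of_nat_Suc)
  then obtain k where k: "\<And>m n. finite (k m n)" "\<And>m n. K m \<subseteq> (\<Union>x\<in>k m n. ball x (1 / Suc n))" by metis
  define \<B> where "\<B> = (\<Union>m n. (\<lambda>c. ball c (1 / real (Suc n))) ` k m n)"
  show thesis
  proof (rule that[of \<B>])
    show "countable \<B>" unfolding \<B>_def by (simp add: k countable_finite)
    show "open B" if "B \<in> \<B>" for B using that by (auto simp: \<B>_def)
    show "\<exists>B\<in>\<B>. x \<in> B \<and> B \<subseteq> U" if Ux: "open U" "x \<in> U" for U x
    proof -
      obtain e where e: "0 < e" "ball x e \<subseteq> U" by (rule openE[OF Ux])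
      obtain n where n: "1 / real (Suc n) < e / 2"
        using nat_approx_posE[of "e / 2"] half_gt_zero[OF e(1)] .
      obtain m where "x \<in> K m" using K(2) by blast
      then have "x \<in> (\<Union>c\<in>k m n. ball c (1 / Suc n))" using k(2)[of m n] by (rule subsetD[rotated])
      then obtain c where c: "c \<in> k m n" "x \<in> ball c (1 / Suc n)" by (rule UN_E)
      have "ball c (1 / Suc n) \<subseteq> ball x e"
      proof
        fix y assume "y \<in> ball c (1 / Suc n)"
        then have "dist c y < 1 / Suc n" "dist c x < 1 / Suc n" using c by auto
        then show "y \<in> ball x e" using n dist_triangle3[of x y c] by simp
      qed
      then show ?thesis using c e unfolding \<B>_def by (intro bexI[of _ "ball c (1 / Suc n)"]) auto
    qed
  qed
qed

lemma radon_sigma_finite: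
  fixes K :: "nat \<Rightarrow> 'x::metric_space set" and lam :: "'x measure"
  assumes lam: "radon_on UNIV lam" and K: "\<And>n. compact (K n)" "(\<Union>n. K n) = UNIV"
  shows "sigma_finite_measure lam"
proof
  have s: "sets lam = sets borel" using lam by (simp add: radon_on_def)
  show "\<exists>A. countable A \<and> A \<subseteq> sets lam \<and> \<Union> A = space lam \<and> (\<forall>a\<in>A. emeasure lam a \<noteq> \<infinity>)"
  proof (intro exI[of _ "range K"] conjI ballI)
    show "range K \<subseteq> sets lam" unfolding s using K(1) by (auto intro: borel_compact)
    show "\<Union> (range K) = space lam" using K(2) sets_eq_imp_space_eq[OF s] by simp
    have "emeasure lam (K n) < \<infinity>" for n
      using lam K(1)[of n] unfolding radon_on_def by blast
    then show "emeasure lam a \<noteq> \<infinity>" if "a \<in> range K" for a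
      using that by (auto simp: less_top)
  qed simp
qed

text \<open>Outer regularity together with a countable base makes the measure separable.\<close>
lemma radon_restrict_separable:
  fixes K :: "nat \<Rightarrow> 'x::metric_space set" and lam :: "'x measure"
  assumes lam: "radon_on UNIV lam" and K: "\<And>n. compact (K n)" "(\<Union>n. K n) = UNIV" and \<Omega>: "open \<Omega>"
  defines "N \<equiv> restrict_space lam \<Omega>"
  obtains \<R> where "countable \<R>" "\<R> \<subseteq> sets N" "\<And>R. R \<in> \<R> \<Longrightarrow> emeasure N R < \<infinity>"
    "\<And>B e. B \<in> sets N \<Longrightarrow> emeasure N B < \<infinity> \<Longrightarrow> 0 < e \<Longrightarrow> \<exists>R\<in>\<R>. measure N ((B - R) \<union> (R - B)) < e"
proof -
  have s: "sets lam = sets borel" using lam by (simp add: radon_on_def)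
  have sp: "space lam = UNIV" using sets_eq_imp_space_eq[OF s] by simp
  have \<Omega>s: "\<Omega> \<in> sets lam" unfolding s using \<Omega> by simp
  have sN: "S \<in> sets N \<longleftrightarrow> S \<in> sets lam \<and> S \<subseteq> \<Omega>" for S
    unfolding N_def using \<Omega>s by (subst sets_restrict_space_iff) (auto simp: sp)
  have eN: "emeasure N S = emeasure lam S" if "S \<subseteq> \<Omega>" for S
    unfolding N_def using \<Omega>s that by (subst emeasure_restrict_space) (auto simp: sp)
  obtain \<B> where B: "countable \<B>" "\<And>B. B \<in> \<B> \<Longrightarrow> open B"
    "\<And>U x. open U \<Longrightarrow> x \<in> U \<Longrightarrow> \<exists>B\<in>\<B>. x \<in> B \<and> B \<subseteq> (U :: 'x set)"
    using sigma_compact_countable_base[OF K] by metis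
  \<comment> \<open>A countable base has only countably many finite unions, and by continuity from
    below these exhaust every open set of finite measure.\<close>
  define \<R> where "\<R> = {R \<in> (\<lambda>F. \<Union>F \<inter> \<Omega>) ` {F. finite F \<and> F \<subseteq> \<B>}. emeasure N R < \<infinity>}"
  show thesis
  proof (rule that[of \<R>])
    have "countable ((\<lambda>F. \<Union>F \<inter> \<Omega>) ` {F. finite F \<and> F \<subseteq> \<B>})"
      by (intro countable_image countable_Collect_finite_subset B(1))
    then show "countable \<R>" by (rule countable_subset[rotated]) (auto simp: \<R>_def)
    have op: "open (\<Union>F)" if "F \<subseteq> \<B>" for F using that B(2) by (intro open_Union) auto
    show \<R>s: "\<R> \<subseteq> sets N" unfolding \<R>_def by (auto simp: sN s intro!: borel_open open_Int op \<Omega>)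
    show "emeasure N R < \<infinity>" if "R \<in> \<R>" for R using that by (simp add: \<R>_def)
    fix C and e :: real assume C: "C \<in> sets N" "emeasure N C < \<infinity>" and e: "0 < e"
    have Cl: "C \<in> sets lam" "C \<subseteq> \<Omega>" using C by (auto simp: sN)
    have Cf: "emeasure lam C < \<infinity>" using C(2) eN[OF Cl(2)] by simp
    have "emeasure lam C = (INF U \<in> {U. openin (top_of_set UNIV) U \<and> C \<subseteq> U}. emeasure lam U)"
      using lam Cl(1) unfolding radon_on_def by blast
    moreover have "emeasure lam C < emeasure lam C + ennreal (e / 2)"
    proof -
      have "emeasure lam C = ennreal (measure lam C)" using Cf by (simp add: emeasure_eq_ennreal_measure less_top)
      moreover have "ennreal (measure lam C) < ennreal (measure lam C + e / 2)" using e by (simp add: ennreal_less_iff)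
      ultimately show ?thesis using e by (simp add: ennreal_plus)
    qed
    ultimately have "(INF U \<in> {U. openin (top_of_set UNIV) U \<and> C \<subseteq> U}. emeasure lam U) < emeasure lam C + ennreal (e / 2)"
      by metis
    then obtain U0 where U0: "open U0" "C \<subseteq> U0" "emeasure lam U0 < emeasure lam C + ennreal (e / 2)"
      by (auto simp: INF_less_iff)
    \<comment> \<open>Outer regularity holds in the whole space; cutting down to \<Omega> keeps the
      approximating sets where \<open>N\<close> and \<open>lam\<close> agree.\<close>
    define U where "U = U0 \<inter> \<Omega>"
    have U: "open U" "C \<subseteq> U" "U \<subseteq> \<Omega>" using U0 \<Omega> Cl by (auto simp: U_def)
    have Us: "U \<in> sets lam" using U by (simp add: s)
    have "emeasure lam U \<le> emeasure lam U0" using U0 by (intro emeasure_mono) (auto simp: U_def s)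
    then have Ue: "emeasure lam U < emeasure lam C + ennreal (e / 2)" using U0(3) by simp
    then have Uf: "emeasure lam U < \<infinity>" using Cf by (metis ennreal_add_less_top ennreal_less_top infinity_ennreal_def order.strict_trans)
    have mU: "measure lam U < measure lam C + e / 2"
    proof -
      have "ennreal (measure lam U) < ennreal (measure lam C + e / 2)"
        using Ue Uf Cf e by (simp add: emeasure_eq_ennreal_measure less_top ennreal_plus)
      then show ?thesis by (simp add: ennreal_less_iff)
    qed
    have d1: "measure lam (U - C) < e / 2"
      using mU Uf Us Cl U(2) by (simp add: measure_Diff less_top)
    define \<B>' where "\<B>' = {B \<in> \<B>. B \<subseteq> U}"
    have cB': "countable \<B>'" unfolding \<B>'_def by (rule countable_subset[OF _ B(1)]) auto
    have UB': "U = \<Union>\<B>'"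
    proof
      show "U \<subseteq> \<Union>\<B>'" using B(3)[OF U(1)] unfolding \<B>'_def by blast
    qed (auto simp: \<B>'_def)
    \<comment> \<open>Intersecting with \<open>\<B>'\<close> matters when \<open>\<B>'\<close> is
      empty: \<open>from_nat_into\<close> then returns an unspecified set.\<close>
    define F where "F n = \<B>' \<inter> from_nat_into \<B>' ` {..<n}" for n
    have Ff: "finite (F n)" "F n \<subseteq> \<B>" for n by (auto simp: F_def \<B>'_def)
    have Fs: "\<Union>(F n) \<in> sets lam" for n unfolding s by (intro borel_open op Ff)
    have FU: "\<Union>(F n) \<subseteq> U" for n by (auto simp: F_def \<B>'_def)
    have "(\<lambda>n. measure lam (\<Union>(F n))) \<longlonglongrightarrow> measure lam (\<Union>n. \<Union>(F n))"
    proof (rule Lim_measure_incseq)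
      show "range (\<lambda>n. \<Union>(F n)) \<subseteq> sets lam" using Fs by auto
      show "incseq (\<lambda>n. \<Union>(F n))" by (rule monoI) (auto simp: F_def)
      have "emeasure lam (\<Union>n. \<Union>(F n)) \<le> emeasure lam U" using FU by (intro emeasure_mono Us) auto
      then show "emeasure lam (\<Union>n. \<Union>(F n)) \<noteq> \<infinity>" using Uf by (auto simp: top_unique)
    qed
    also have "(\<Union>n. \<Union>(F n)) = U"
    proof
      show "U \<subseteq> (\<Union>n. \<Union>(F n))"
      proof
        fix x assume "x \<in> U"
        then obtain b where b: "b \<in> \<B>'" "x \<in> b" using UB' by blast
        then obtain i where "from_nat_into \<B>' i = b" using from_nat_into_surj[OF cB'] by blast
        then have "b \<in> F (Suc i)" using b by (auto simp: F_def)
        then show "x \<in> (\<Union>n. \<Union>(F n))" using b by blast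
      qed
    qed (use FU in auto)
    finally have "eventually (\<lambda>n. measure lam U - e / 2 < measure lam (\<Union>(F n))) sequentially"
      using e by (intro order_tendstoD(1)) auto
    then obtain n where n: "measure lam U - e / 2 < measure lam (\<Union>(F n))" by (auto simp: eventually_sequentially)
    define R where "R = \<Union>(F n)"
    have R: "R \<subseteq> U" "R \<in> sets lam" unfolding R_def by (rule FU, rule Fs)
    have d2: "measure lam (U - R) < e / 2"
      using n Uf Us R by (simp add: measure_Diff less_top R_def)
    have RO: "R \<inter> \<Omega> = R" using R U by auto
    have "emeasure lam R \<le> emeasure lam U" using R Us by (intro emeasure_mono)
    then have "R \<in> \<R>" unfolding \<R>_def using Uf eN[of R] RO R U Ff[of n]
      by (auto simp: R_def intro!: image_eqI[of _ _ "F n"])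
    moreover have "measure N ((C - R) \<union> (R - C)) < e"
    proof -
      have "measure N ((C - R) \<union> (R - C)) = measure lam ((C - R) \<union> (R - C))"
        unfolding measure_def by (subst eN) (use Cl R U in auto)
      also have "\<dots> \<le> measure lam ((U - R) \<union> (U - C))"
      proof (rule measure_mono_fmeasurable)
        show "(U - R) \<union> (U - C) \<in> fmeasurable lam"
          by (rule fmeasurableI2[of U]) (use Uf Us R Cl in \<open>auto simp: fmeasurable_def\<close>)
      qed (use U R Cl in auto)
      also have "\<dots> \<le> measure lam (U - R) + measure lam (U - C)"
        using Us R Cl by (intro measure_Un_le) auto
      also have "\<dots> < e" using d1 d2 by simp
      finally show ?thesis .
    qed
    ultimately show "\<exists>R\<in>\<R>. measure N ((C - R) \<union> (R - C)) < e" by blast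
  qed
qed

section \<open>Means along fundamental sequences and passage to the concrete setting\<close>

lemma homogenization_algebra_selfadjoint:
  assumes "homogenization_algebra E H lam A" shows "selfadjoint_algebra A"
  using assms unfolding homogenization_algebra_def by unfold_locales auto

lemma fundamental_sequence_to_theta:
  assumes "fundamental_sequence E one eps"
  shows "filterlim eps (to_theta E) sequentially"
proof -
  have eps: "\<And>n. eps n \<in> E" "(\<lambda>n. ereal (eps n)) \<longlonglongrightarrow> theta E"
    using assms by (auto simp: fundamental_sequence_def)
  have "filterlim eps (filtercomap ereal (nhds (theta E))) sequentially"
    using eps(2) by (simp add: filterlim_filtercomap_iff o_def)
  moreover have "filterlim eps (principal E) sequentially"
    using eps(1) by (simp add: filterlim_principal)
  ultimately show ?thesis unfolding to_theta_def by (simp add: filterlim_inf)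
qed

text \<open>\<open>mean\<close> is a definite description, so uniqueness of the constant has to be
  shown. The test function is the indicator of a compact set of positive finite measure, which
  exists because \<lambda> is nonzero and the space is sigma-compact. The fundamental sequence
  reduces the claim to uniqueness of sequential limits.\<close>

lemma mean_eq:
  fixes H :: "real \<Rightarrow> 'x::metric_space \<Rightarrow> 'x"
  assumes hom: "homogenizer E mul one ginv H lam" and S: "fundamental_sequence E one eps"
    and c: "Pi_inf E H lam a c"
  shows "mean E H lam a = c"
  unfolding mean_def
proof (rule the_equality[of "Pi_inf E H lam a", OF c])
  fix c' assume c': "Pi_inf E H lam a c'"
  obtain K :: "nat \<Rightarrow> 'x set" where K: "\<And>n. compact (K n)" "(\<Union>n. K n) = UNIV"
    using homogenizer_sigma_compact[OF hom] by metis
  have lam: "radon_on UNIV lam" using hom by (auto simp: homogenizer_def)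
  have s: "sets lam = sets borel" using lam by (simp add: radon_on_def)
  have Ks: "K n \<in> sets lam" for n unfolding s by (rule borel_compact[OF K(1)])
  have Kf: "emeasure lam (K n) < \<infinity>" for n using lam K(1)[of n] unfolding radon_on_def by blast
  obtain B where B: "B \<in> sets lam" "emeasure lam B \<noteq> 0" using hom by (auto simp: homogenizer_def)
  have "\<exists>n. emeasure lam (K n) \<noteq> 0"
  proof (rule ccontr)
    assume "\<not> ?thesis"
    then have "emeasure lam (\<Union>n. K n) = 0" using Ks by (intro emeasure_UN_eq_0) auto
    moreover have "emeasure lam B \<le> emeasure lam (\<Union>n. K n)"
      unfolding K(2) by (rule emeasure_mono) (simp_all add: s)
    ultimately have "emeasure lam B = 0" by simp
    then show False using B by simp
  qed
  then obtain n where n: "emeasure lam (K n) \<noteq> 0" by blast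
  let ?f = "\<lambda>x. complex_of_real (indicator (K n) x)"
  have "integrable lam (indicator (K n) :: 'x \<Rightarrow> real)" using Ks Kf by simp
  then have f: "integrable lam ?f" by simp
  have "(\<integral>x. ?f x \<partial>lam) = complex_of_real (\<integral>x. indicator (K n) x \<partial>lam)" by (rule integral_complex_of_real)
  also have "\<dots> = complex_of_real (measure lam (K n))" using Ks Kf by simp
  finally have "(\<integral>x. ?f x \<partial>lam) = complex_of_real (measure lam (K n))" .
  moreover have "emeasure lam (K n) = ennreal (measure lam (K n))"
    using Kf[of n] by (simp add: emeasure_eq_ennreal_measure less_top)
  ultimately have f0: "(\<integral>x. ?f x \<partial>lam) \<noteq> 0" using n by auto
  have "(\<lambda>k. \<integral>x. apply_bcontfun a (H (eps k) x) * ?f x \<partial>lam) \<longlonglongrightarrow> d * (\<integral>x. ?f x \<partial>lam)"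
    if "Pi_inf E H lam a d" for d
    using that f filterlim_compose[OF _ fundamental_sequence_to_theta[OF S]] unfolding Pi_inf_def by blast
  from LIMSEQ_unique[OF this[OF c] this[OF c']] show "c' = c" using f0 by simp
qed

theorem theorem6p1:
  fixes E :: "real set" and mul :: "real \<Rightarrow> real \<Rightarrow> real" and one :: real
    and ginv :: "real \<Rightarrow> real" and H :: "real \<Rightarrow> 'x::metric_space \<Rightarrow> 'x"
    and lam :: "'x measure" and \<Omega> :: "'x set" and A :: "('x \<Rightarrow>\<^sub>C complex) set"
    and \<beta> :: "(('x \<Rightarrow>\<^sub>C complex) \<Rightarrow> complex) measure" and p :: real
    and eps :: "nat \<Rightarrow> real" and u :: "nat \<Rightarrow> 'x \<Rightarrow> complex"
  assumes hom: "homogenizer E mul one ginv H lam"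
    and \<Omega>: "open \<Omega>" "\<Omega> \<noteq> {}"
    and alg: "homogenization_algebra E H lam A"
    and beta: "is_beta E H lam A \<beta>"
    and p: "1 < p"
    and S: "fundamental_sequence E one eps"
    and u_Lp: "\<forall>n. Lp (restrict_space lam \<Omega>) p (u n)"
    and u_bdd: "\<exists>C. \<forall>n. (\<integral>x. norm (u n x) powr p \<partial>restrict_space lam \<Omega>) \<le> C"
  shows "\<exists>r u0. strict_mono r \<and>
           Lp (restrict_space lam \<Omega> \<Otimes>\<^sub>M \<beta>) p u0 \<and>
           weak_Sigma_conv H (restrict_space lam \<Omega>) A \<beta> p (eps \<circ> r) (u \<circ> r) u0"
proof -
  let ?N = "restrict_space lam \<Omega>"
  obtain K :: "nat \<Rightarrow> 'x set" where K: "\<And>n. compact (K n)" "(\<Union>n. K n) = UNIV"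
    using homogenizer_sigma_compact[OF hom] by metis
  have lam: "radon_on UNIV lam" using hom by (auto simp: homogenizer_def)
  have s: "sets lam = sets borel" using lam by (simp add: radon_on_def)
  have \<Omega>s: "\<Omega> \<in> sets lam" unfolding s using \<Omega> by simp
  obtain D where D: "countable D" "D \<subseteq> A" "A \<subseteq> closure D"
    using alg unfolding homogenization_algebra_def by blast
  obtain C where C: "\<And>n. (\<integral>x. norm (u n x) powr p \<partial>?N) \<le> C" using u_bdd by blast
  have epsE: "eps n \<in> E" for n using S by (simp add: fundamental_sequence_def)
  interpret selfadjoint_algebra A by (rule homogenization_algebra_selfadjoint[OF alg])
  interpret N: sigma_finite_measure ?N
    by (rule sigma_finite_measure_restrict_space[OF radon_sigma_finite[OF lam K] \<Omega>s])
  have setting: "sigma_setting A ?N D \<beta> p C (\<lambda>n. H (eps n)) u"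
  proof unfold_locales
    show "countable D" "D \<subseteq> A" "A \<subseteq> closure D" by fact+
    show "1 < p" by fact
    show "sets \<beta> = sets (spectrum_space A)" "emeasure \<beta> (space \<beta>) = 1"
      using beta by (auto simp: is_beta_def)
    show "Lp ?N p (u n)" "(\<integral>x. norm (u n x) powr p \<partial>?N) \<le> C" for n using u_Lp C by auto
    show "(\<lambda>x. apply_bcontfun w (H (eps n) x)) \<in> borel_measurable ?N" for w n
    proof (rule measurable_restrict_space1)
      have "continuous_on UNIV (\<lambda>x. apply_bcontfun w (H (eps n) x))"
        by (rule continuous_on_compose2[OF continuous_on_apply_bcontfun homogenizer_continuous_on[OF hom epsE]]) auto
      then show "(\<lambda>x. apply_bcontfun w (H (eps n) x)) \<in> borel_measurable lam"
        using borel_measurable_continuous_onI measurable_cong_sets[OF s refl] by blast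
    qed
    fix a and f :: "'x \<Rightarrow> complex" assume a: "a \<in> A" and f: "integrable ?N f"
    obtain c where c: "Pi_inf E H lam a c" using alg a unfolding homogenization_algebra_def by blast
    have "(\<integral>s. s a \<partial>\<beta>) = c"
      using beta a mean_eq[OF hom S c] by (simp add: is_beta_def)
    have \<Omega>': "\<Omega> \<inter> space lam \<in> sets lam" using \<Omega>s by auto
    \<comment> \<open>Extension by zero turns a test function on \<Omega> into one on the whole
      space, where \<open>Pi_inf\<close> is formulated.\<close>
    let ?f = "\<lambda>x. indicator \<Omega> x *\<^sub>R f x"
    have "integrable lam ?f" using f by (simp add: integrable_restrict_space[OF \<Omega>'])
    then have "((\<lambda>\<epsilon>. \<integral>x. apply_bcontfun a (H \<epsilon> x) * ?f x \<partial>lam) \<longlongrightarrow> c * (\<integral>x. ?f x \<partial>lam)) (to_theta E)"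
      using c unfolding Pi_inf_def by blast
    then have "(\<lambda>n. \<integral>x. apply_bcontfun a (H (eps n) x) * ?f x \<partial>lam) \<longlonglongrightarrow> c * (\<integral>x. ?f x \<partial>lam)"
      by (rule filterlim_compose[OF _ fundamental_sequence_to_theta[OF S]])
    then show "(\<lambda>n. \<integral>x. apply_bcontfun a (H (eps n) x) * f x \<partial>?N) \<longlonglongrightarrow> (\<integral>s. s a \<partial>\<beta>) * (\<integral>x. f x \<partial>?N)"
      unfolding \<open>(\<integral>s. s a \<partial>\<beta>) = c\<close> by (simp add: integral_restrict_space[OF \<Omega>'])
  qed
  interpret sigma_setting A ?N D \<beta> p C "\<lambda>n. H (eps n)" u by (rule setting)
  obtain \<R> where \<R>: "countable \<R>" "\<R> \<subseteq> sets ?N" "\<And>R. R \<in> \<R> \<Longrightarrow> emeasure ?N R < \<infinity>"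
    "\<And>B e. B \<in> sets ?N \<Longrightarrow> emeasure ?N B < \<infinity> \<Longrightarrow> 0 < e \<Longrightarrow> \<exists>R\<in>\<R>. measure ?N ((B - R) \<union> (R - B)) < e"
    using radon_restrict_separable[OF lam K \<Omega>(1)] by metis
  \<comment> \<open>The diagonal choice makes only these countably many pairings converge, one for
    each set in \<open>\<R>\<close> and value in \<open>D\<close>; \<open>sigma_convergent\<close>
    covers the rest by density.\<close>
  have "countable (\<R> \<times> D)" using \<R>(1) D(1) by simp
  moreover have "bounded (range (\<lambda>n. pair n (step (fst x) (snd x))))" if "x \<in> \<R> \<times> D" for x
    using that \<R>(2,3) D(2) by (intro pair_bounded simple_Lp_A simple_step) auto
  ultimately obtain r where r: "strict_mono r"
    "\<And>x. x \<in> \<R> \<times> D \<Longrightarrow> convergent (\<lambda>n. pair (r n) (step (fst x) (snd x)))"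
    using diagonal_convergent_subsequence[of "\<R> \<times> D" "\<lambda>n x. pair n (step (fst x) (snd x))"] by blast
  interpret R: sigma_setting A ?N D \<beta> p C "\<lambda>n. H (eps (r n))" "\<lambda>n. u (r n)"
    by (rule subsequence[OF r(1)])
  interpret R: sigma_convergent A ?N D \<beta> p C "\<lambda>n. H (eps (r n))" "\<lambda>n. u (r n)" \<R>
  proof unfold_locales
    show "convergent (\<lambda>n. R.pair n (R.step R d))" if "R \<in> \<R>" "d \<in> D" for R d
      using r(2)[of "(R, d)"] that by (simp add: pair_def R.pair_def)
  qed (use \<R> in auto)
  obtain u0 where u0: "Lp (?N \<Otimes>\<^sub>M \<beta>) p u0"
    "\<And>\<psi>. Lp_A ?N q A \<psi> \<Longrightarrow> (\<lambda>n. R.pair n \<psi>) \<longlonglongrightarrow> (\<integral>z. u0 z * R.hat \<psi> z \<partial>(?N \<Otimes>\<^sub>M \<beta>))"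
    using R.weak_limit by blast
  have "weak_Sigma_conv H ?N A \<beta> p (eps \<circ> r) (u \<circ> r) u0"
    unfolding weak_Sigma_conv_def using u0(2) by (simp add: R.pair_def R.hat_def)
  then show ?thesis using r(1) u0(1) by blast
qed

end
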